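(* Let $m,n\in\mathbb N$ with $m\equiv n\pmod 2$, let $\sigma\in\mathcal B_{nm}$ with $r=\operatorname{rank}(\sigma)$, and let $P^\sigma=\operatorname{Reg}(\mathcal B_{mn}^\sigma)$. Let $0\leq q\leq r$ with $q\equiv r\pmod 2$, and let $D_q^\sigma=\{\alpha\in P^\sigma:\operatorname{rank}(\alpha)=q\}$ (a $\mathscr D^\sigma$-class of $P^\sigma$). (i) $D_q^\sigma$ contains $\binom rq(r-q-1)!!$ $\widehat{\mathscr R}^\sigma$-classes, each of which contains $\frac{(m+q-1)!!}{(r+q-1)!!}$ $\mathscr R^\sigma$-classes. (ii) $D_q^\sigma$ contains $\binom rq(r-q-1)!!$ $\widehat{\mathscr L}^\sigma$-classes, each of which contains $\frac{(n+q-1)!!}{(r+q-1)!!}$ $\mathscr L^\sigma$-classes. (iii) $D_q^\sigma$ contains $\binom rq^{2}\big((r-q-1)!!\big)^2$ $\widehat{\mathscr H}^\sigma$-classes, each of which contains $\frac{(m+q-1)!!\,(n+q-1)!!}{((r+q-1)!!)^2}$ $\mathscr H^\sigma$-classes. (iv) Each $\mathscr H^\sigma$-class in $D_q^\sigma$ has size $q!$, and group $\mathscr H^\sigma$-classes in $D_q^\sigma$ are isomorphic to the symmetric group $\mathcal S_q$. (v) For $\alpha\in D_q^\sigma$, the $\mathscr H^\sigma$-class $H_\alpha^\sigma$ of $\alpha$ is a group if and only if the $\mathscr H$-class $H_{\overline\alpha}$ of $\overline\alpha=\alpha\Psi$ in $\mathcal B_r$ is a group, in which case the $\widehat{\mathscr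 H}^\sigma$-class $\widehat H_\alpha^\sigma$ of $\alpha$ is a $\frac{(m+q-1)!!}{(r+q-1)!!}\times\frac{(n+q-1)!!}{(r+q-1)!!}$ rectangular group over $\mathcal S_q$.
   Context: $\mathbb N=\{0,1,2,\ldots\}$, $[n]=\{1,\ldots,n\}$ (with $[0]=\emptyset$), and $A'=\{a':a\in A\}$, $A''=\{a'':a\in A\}$ for $A\subseteq\mathbb N$. For $m,n\in\mathbb N$, $\mathcal B_{mn}$ is the set of all Brauer partitions, i.e. set partitions of $[m]\cup[n]'$ into blocks of size $2$. For $\alpha\in\mathcal B_{mn}$ and $\beta\in\mathcal B_{nk}$, the product $\alpha\beta\in\mathcal B_{mk}$ is formed as follows: view partitions as graphs whose connected components are the blocks; let $\alpha_\downarrow$ be the graph on $[m]\cup[n]''$ obtained from $\alpha$ by renaming each $x'$ to $x''$, let $\beta^\uparrow$ be the graph on $[n]''\cup[k]'$ obtained from $\beta$ by renaming each $x\in[n]$ to $x''$, and let $\Pi(\alpha,\beta)$ be the union of these graphs on $[m]\cup[n]''\cup[k]'$; two elements of $[m]\cup[k]'$ lie in the same block of $\alpha\beta$ iff they lie in the same connected component of $\Pi(\alpha,\beta)$. $\mathcal B_r=\mathcal B_{rr}$ is the Brauer monoid. $\alpha^*\in\mathcal B_{nm}$ is obtained from $\alpha\in\mathcal B_{mn}$ by interchanging primed and unprimed elements. Blocks of $\alpha\in\mathcal B_{mn}$ meeting both $[m]$ and $[n]'$ are transversals; the number of them is $\operatorname{rank}(\alpha)$; other blocks are upper nontransversals (contained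 in $[m]$) or lower nontransversals (contained in $[n]'$). For $\sigma\in\mathcal B_{nm}$, $\mathcal B_{mn}^\sigma$ is the set $\mathcal B_{mn}$ with operation $\alpha\star_\sigma\beta=\alpha\sigma\beta$. $\operatorname{Reg}(T)$ denotes the set of (von Neumann) regular elements of a semigroup $T$; $P^\sigma=\operatorname{Reg}(\mathcal B_{mn}^\sigma)$ is a subsemigroup of $\mathcal B_{mn}^\sigma$. $\mathscr R^\sigma,\mathscr L^\sigma,\mathscr H^\sigma,\mathscr D^\sigma$ denote Green's relations of $\mathcal B_{mn}^\sigma$, and $\mathscr R,\mathscr L,\mathscr H,\mathscr D$ those of $\mathcal B_r$. Suppose $\sigma$ has transversals $\{x_i,y_i'\}$ ($1\le i\le r$), and upper nontransversals $U_1,\ldots,U_s$. Let $\tau\in\mathcal B_{rn}$ have blocks $\{i,x_i'\}$ ($1\leq i\leq r$) and $U_1',\ldots,U_s'$. The map $\Psi:P^\sigma\to\mathcal B_r$, $\alpha\mapsto\overline\alpha=\tau\sigma\alpha\tau^*$, is a surjective homomorphism. For $\mathscr K\in\{\mathscr R,\mathscr L,\mathscr H\}$ the relation $\widehat{\mathscr K}^\sigma$ on $P^\sigma$ is defined by $\alpha\,\widehat{\mathscr K}^\sigma\,\beta\Leftrightarrow\overline\alpha\,\mathscr K\,\overline\beta$ in $\mathcal B_r$; it contains $\mathscr K^\sigma$ (restricted to $P^\sigma$) and is contained in $\mathscr D^\sigma$. A $\rho\times\lambda$ rectangular group over a group $G$ is a semigroup isomorphic to $U\times V\times G$, where $U$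 is a left-zero semigroup ($uv=u$) of size $\rho$ and $V$ a right-zero semigroup ($uv=v$) of size $\lambda$. For odd $k\ge1$, $k!!=k(k-2)\cdots3\cdot1$, and $(-1)!!=1$. *)

theory Defs
  imports Complex_Main "HOL-Library.Disjoint_Sets" "HOL-Algebra.Sym_Groups"
begin

section \<open>Brauer partitions\<close>

text \<open>\<^term>\<open>Up i\<close>, \<^term>\<open>Lo i\<close> and \<^term>\<open>Mid i\<close> stand for
  $i$, $i'$ and $i''$; the doubly primed points occur only inside product graphs.\<close>

datatype vertex = Up nat | Lo nat | Mid nat

type_synonym brauer_partition = "vertex set set"

definition brauer :: "nat \<Rightarrow> nat \<Rightarrow> brauer_partition set" where
  "brauer m n = {\<alpha>. partition_on (Up ` {1..m} \<union> Lo ` {1..n}) \<alpha> \<and> (\<forall>A\<in>\<alpha>. card A = 2)}"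

primrec lower_to_mid :: "vertex \<Rightarrow> vertex" where
  "lower_to_mid (Up i) = Up i"
| "lower_to_mid (Lo i) = Mid i"
| "lower_to_mid (Mid i) = Mid i"

primrec upper_to_mid :: "vertex \<Rightarrow> vertex" where
  "upper_to_mid (Up i) = Mid i"
| "upper_to_mid (Lo i) = Lo i"
| "upper_to_mid (Mid i) = Mid i"

primrec flip_vertex :: "vertex \<Rightarrow> vertex" where
  "flip_vertex (Up i) = Lo i"
| "flip_vertex (Lo i) = Up i"
| "flip_vertex (Mid i) = Mid i"

text \<open>The blocks of the two renamed partitions together; they are the edges of the product graph
  $\Pi(\alpha,\beta)$.\<close>

definition product_edges :: "brauer_partition \<Rightarrow> brauer_partition \<Rightarrow> vertex set set" where
  "product_edges \<alpha> \<beta> = (image lower_to_mid) ` \<alpha> \<union> (image upper_to_mid) ` \<beta>"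

definition product_connected :: "brauer_partition \<Rightarrow> brauer_partition \<Rightarrow> (vertex \<times> vertex) set" where
  "product_connected \<alpha> \<beta> = {(u, v). \<exists>A\<in>product_edges \<alpha> \<beta>. u \<in> A \<and> v \<in> A}\<^sup>*"

text \<open>For $\alpha$ in \<^term>\<open>brauer m n\<close> and $\beta$ in \<^term>\<open>brauer n k\<close> the points of
  $\Pi(\alpha,\beta)$ that are not doubly primed are exactly $[m]\cup[k]'$, so \<open>m\<close> and \<open>k\<close> need
  not be passed as arguments.\<close>

definition bprod :: "brauer_partition \<Rightarrow> brauer_partition \<Rightarrow> brauer_partition" where
  "bprod \<alpha> \<beta> =
     (let X = \<Union>(product_edges \<alpha> \<beta>) - range Mid
      in X // (product_connected \<alpha> \<beta> \<inter> X \<times> X))"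

definition bstar :: "brauer_partition \<Rightarrow> brauer_partition" where
  "bstar \<alpha> = (image flip_vertex) ` \<alpha>"

definition transversals :: "brauer_partition \<Rightarrow> vertex set set" where
  "transversals \<alpha> = {A\<in>\<alpha>. A \<inter> range Up \<noteq> {} \<and> A \<inter> range Lo \<noteq> {}}"

definition upper_nontransversals :: "brauer_partition \<Rightarrow> vertex set set" where
  "upper_nontransversals \<alpha> = {A\<in>\<alpha>. A \<subseteq> range Up}"

definition brank :: "brauer_partition \<Rightarrow> nat" where
  "brank \<alpha> = card (transversals \<alpha>)"

definition sandwich :: "brauer_partition \<Rightarrow> brauer_partition \<Rightarrow> brauer_partition \<Rightarrow> brauer_partition" where
  "sandwich \<sigma> \<alpha> \<beta> = bprod (bprod \<alpha> \<sigma>) \<beta>"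

text \<open>Here \<open>x\<close> enumerates the upper points of the transversals of $\sigma$, and \<open>r\<close> is its rank.\<close>

definition tau :: "nat \<Rightarrow> (nat \<Rightarrow> nat) \<Rightarrow> brauer_partition \<Rightarrow> brauer_partition" where
  "tau r x \<sigma> = (\<lambda>i. {Up i, Lo (x i)}) ` {1..r} \<union> (image flip_vertex) ` upper_nontransversals \<sigma>"

definition psi :: "nat \<Rightarrow> (nat \<Rightarrow> nat) \<Rightarrow> brauer_partition \<Rightarrow> brauer_partition \<Rightarrow> brauer_partition" where
  "psi r x \<sigma> \<alpha> = bprod (bprod (bprod (tau r x \<sigma>) \<sigma>) \<alpha>) (bstar (tau r x \<sigma>))"


section \<open>Semigroups given by a carrier set and an operation\<close>

definition semigroup_on :: "'a set \<Rightarrow> ('a \<Rightarrow> 'a \<Rightarrow> 'a) \<Rightarrow> bool" where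
  "semigroup_on S f \<longleftrightarrow>
     (\<forall>a\<in>S. \<forall>b\<in>S. f a b \<in> S) \<and> (\<forall>a\<in>S. \<forall>b\<in>S. \<forall>c\<in>S. f (f a b) c = f a (f b c))"

definition regular_elements :: "'a set \<Rightarrow> ('a \<Rightarrow> 'a \<Rightarrow> 'a) \<Rightarrow> 'a set" where
  "regular_elements S f = {a\<in>S. \<exists>b\<in>S. f (f a b) a = a}"

text \<open>The principal one-sided ideals $aS^1$ and $S^1a$; inserting \<open>a\<close> accounts for the adjoined
  identity, also when \<open>S\<close> already is a monoid.\<close>

definition right_ideal :: "'a set \<Rightarrow> ('a \<Rightarrow> 'a \<Rightarrow> 'a) \<Rightarrow> 'a \<Rightarrow> 'a set" where
  "right_ideal S f a = insert a ((\<lambda>b. f a b) ` S)"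

definition left_ideal :: "'a set \<Rightarrow> ('a \<Rightarrow> 'a \<Rightarrow> 'a) \<Rightarrow> 'a \<Rightarrow> 'a set" where
  "left_ideal S f a = insert a ((\<lambda>b. f b a) ` S)"

definition greenR :: "'a set \<Rightarrow> ('a \<Rightarrow> 'a \<Rightarrow> 'a) \<Rightarrow> 'a rel" where
  "greenR S f = {(a, b). a \<in> S \<and> b \<in> S \<and> right_ideal S f a = right_ideal S f b}"

definition greenL :: "'a set \<Rightarrow> ('a \<Rightarrow> 'a \<Rightarrow> 'a) \<Rightarrow> 'a rel" where
  "greenL S f = {(a, b). a \<in> S \<and> b \<in> S \<and> left_ideal S f a = left_ideal S f b}"

definition greenH :: "'a set \<Rightarrow> ('a \<Rightarrow> 'a \<Rightarrow> 'a) \<Rightarrow> 'a rel" where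
  "greenH S f = greenR S f \<inter> greenL S f"

definition greenD :: "'a set \<Rightarrow> ('a \<Rightarrow> 'a \<Rightarrow> 'a) \<Rightarrow> 'a rel" where
  "greenD S f = greenR S f O greenL S f"

definition hat :: "'a set \<Rightarrow> ('a \<Rightarrow> 'b) \<Rightarrow> 'b rel \<Rightarrow> 'a rel" where
  "hat P \<psi> K = {(a, b). a \<in> P \<and> b \<in> P \<and> (\<psi> a, \<psi> b) \<in> K}"

definition classes_in :: "'a set \<Rightarrow> 'a rel \<Rightarrow> 'a set \<Rightarrow> 'a set set" where
  "classes_in S K X = {C \<in> S // K. C \<subseteq> X}"

definition is_group_on :: "'a set \<Rightarrow> ('a \<Rightarrow> 'a \<Rightarrow> 'a) \<Rightarrow> bool" where
  "is_group_on C f \<longleftrightarrow> (\<exists>e. group \<lparr>carrier = C, mult = f, one = e\<rparr>)"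

definition group_on_iso :: "'a set \<Rightarrow> ('a \<Rightarrow> 'a \<Rightarrow> 'a) \<Rightarrow> ('b, 'c) monoid_scheme \<Rightarrow> bool" where
  "group_on_iso C f G \<longleftrightarrow>
     (\<exists>e. group \<lparr>carrier = C, mult = f, one = e\<rparr> \<and> \<lparr>carrier = C, mult = f, one = e\<rparr> \<cong> G)"

text \<open>Up to isomorphism a left-zero or right-zero semigroup is determined by its size, so finite
  sets of natural numbers suffice for the two zero factors.\<close>

definition rectangular_group ::
    "nat \<Rightarrow> nat \<Rightarrow> ('b, 'c) monoid_scheme \<Rightarrow> 'a set \<Rightarrow> ('a \<Rightarrow> 'a \<Rightarrow> 'a) \<Rightarrow> bool" where
  "rectangular_group k l G S f \<longleftrightarrow>
     group G \<and> semigroup_on S f \<and>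
     (\<exists>(U :: nat set) (V :: nat set) \<phi>.
        finite U \<and> card U = k \<and> finite V \<and> card V = l \<and>
        bij_betw \<phi> S (U \<times> V \<times> carrier G) \<and>
        (\<forall>a\<in>S. \<forall>b\<in>S. \<forall>u v g u' v' g'.
           \<phi> a = (u, v, g) \<longrightarrow> \<phi> b = (u', v', g') \<longrightarrow> \<phi> (f a b) = (u, v', g \<otimes>\<^bsub>G\<^esub> g')))"


section \<open>Double factorials\<close>

text \<open>Integer arguments, because $(-1)!! = 1$ is needed.\<close>

function dfact :: "int \<Rightarrow> nat" where
  "dfact k = (if k \<le> 0 then 1 else nat k * dfact (k - 2))"
  by auto
termination by (relation "measure nat") auto

declare dfact.simps [simp del]

end

theory Submission
  imports Defs
begin

text \<open>Brauer partitions are perfect matchings, and products arise by gluing matchings along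
  shared vertices. Gluing a fixed matching onto matchings of \<open>B\<close> all of whose edges it meets has
  fibres of constant size, because gluing a single edge \<open>{p, p'}\<close> with \<open>p, p' \<in> B\<close> has fibres of
  size \<open>card B - 1\<close> (choose the partner of \<open>p\<close>); this is the source of all double factorials.

  Algebraically, \<open>\<sigma> = \<tau>\<^sup>*\<kappa>\<close> with \<open>\<tau>\<tau>\<^sup>* = \<kappa>\<kappa>\<^sup>* = 1\<close>, and an element of rank \<open>q\<close> is \<open>a c\<^sup>*\<close> with
  \<open>a\<^sup>*a = c\<^sup>*c = 1\<close>, uniquely up to the group \<open>G\<close> of units of the Brauer monoid of degree \<open>q\<close>. It
  is regular iff \<open>\<kappa>a\<close> and \<open>\<tau>c\<close> have the same property. With representatives \<open>T\<close> of the free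
  \<open>G\<close>-orbits on such elements from \<open>r\<close> to \<open>q\<close>, every element of the class \<open>D\<close> is uniquely
  \<open>a g c\<^sup>*\<close> with \<open>\<kappa>a, \<tau>c \<in> T\<close> and \<open>g \<in> G\<close>. Green's relations and their hatted versions are
  equalities of \<open>a\<close>, \<open>c\<close>, \<open>\<kappa>a\<close>, \<open>\<tau>c\<close>, and the product is
  \<open>(a g c\<^sup>*)(a' g' c'\<^sup>*) = a (g p g') c'\<^sup>*\<close> with \<open>p = (\<tau>c)\<^sup>*(\<kappa>a')\<close>.\<close>

section \<open>Perfect matchings and gluing\<close>

text \<open>The middle factor p sees an element only through \<open>\<kappa>a\<close> and
  \<open>\<tau>c\<close>. The image of \<open>a g c\<^sup>*\<close> in the Brauer monoid of degree r
  has coordinates \<open>\<kappa>a\<close>, \<open>\<tau>c\<close>, \<open>g\<close>, hence the same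
  p, and on both sides the H-class is a group exactly when p is a unit; this is why the group
  property transfers. Both normalised factors are isometries between the same degrees, so one set T
  serves rows and columns, and the Brauer monoid itself is the case of an identity sandwich. The
  involution reverses products and exchanges \<kappa> with \<tau>, so counts and decompositions for
  columns come from those for rows. The quotients of double factorials are sizes of fibres of
  multiplication by \<kappa> or \<tau>: matchings of m+q (or n+q) points lie over matchings of r+q
  points. They are kept as product equations until the very end, so divisibility is never an issue.
  The combinatorial obstacle is that a product graph contains alternating paths and cycles of any
  length. These are never traced: gluing one edge is elementary, associativity of gluing gives the
  general case, and a product is identified by exhibiting a path for each expected block.\<close>

definition matching :: "'a set \<Rightarrow> 'a set set \<Rightarrow> bool" where
  "matching S M \<longleftrightarrow> partition_on S M \<and> (\<forall>e\<in>M. card e = 2)"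

definition link :: "'a set set \<Rightarrow> ('a \<times> 'a) set" where
  "link M = {(u, v). \<exists>e\<in>M. u \<in> e \<and> v \<in> e}"

definition conn :: "'a set set \<Rightarrow> ('a \<times> 'a) set" where
  "conn M = (link M)\<^sup>*"

text \<open>Vertices lying in both matchings are those that vanish, so a symmetric difference
  replaces the bookkeeping of upper, lower and middle rows. The operation becomes commutative and
  can be iterated edge by edge.\<close>

definition glue :: "'a set set \<Rightarrow> 'a set set \<Rightarrow> 'a set set" where
  "glue M N = (let X = sym_diff (\<Union>M) (\<Union>N) in X // (conn (M \<union> N) \<inter> X \<times> X))"

lemma matching_Union: "matching S M \<Longrightarrow> \<Union>M = S"
  by (simp add: matching_def partition_on_def)

lemma matching_subset: "matching S M \<Longrightarrow> e \<in> M \<Longrightarrow> e \<subseteq> S"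
  by (auto simp: matching_def partition_on_def)

lemma matching_disjoint:
  "matching S M \<Longrightarrow> e \<in> M \<Longrightarrow> e' \<in> M \<Longrightarrow> u \<in> e \<Longrightarrow> u \<in> e' \<Longrightarrow> e = e'"
  by (auto simp: matching_def partition_on_def disjoint_def)

lemma matching_finite: "matching S M \<Longrightarrow> finite S \<Longrightarrow> finite M"
  unfolding matching_def by (metis finite_elements)

lemma matchingE:
  assumes "matching S M" "e \<in> M"
  obtains u v where "e = {u, v}" "u \<noteq> v" "u \<in> S" "v \<in> S"
  using assms by (metis card_2_iff insert_subset matching_def matching_subset)

lemma matching_partner:
  assumes "matching S M" "u \<in> S"
  obtains v where "{u, v} \<in> M" "u \<noteq> v" "v \<in> S"
proof -
  obtain e where e: "e \<in> M" "u \<in> e"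
    using assms matching_Union by (metis UnionE)
  then obtain a b where "e = {a, b}" "a \<noteq> b" "a \<in> S" "b \<in> S"
    by (metis matchingE assms(1))
  with e show thesis
    using that[of a] that[of b] by (cases "u = a") (auto simp: insert_commute)
qed

lemma matchingI:
  assumes "\<And>e. e \<in> M \<Longrightarrow> \<exists>u v. e = {u, v} \<and> u \<noteq> v \<and> u \<in> S \<and> v \<in> S"
    and "\<And>u. u \<in> S \<Longrightarrow> \<exists>e\<in>M. u \<in> e"
    and "\<And>e e' u. e \<in> M \<Longrightarrow> e' \<in> M \<Longrightarrow> u \<in> e \<Longrightarrow> u \<in> e' \<Longrightarrow> e = e'"
  shows "matching S M"
proof -
  have "\<Union>M = S"
    using assms(1,2) by blast
  moreover have "disjoint M"
    using assms(3) by (auto simp: disjoint_def)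
  moreover have "{} \<notin> M"
    using assms(1) by blast
  moreover have "\<forall>e\<in>M. card e = 2"
    using assms(1) by (metis card_2_iff)
  ultimately show ?thesis
    by (simp add: matching_def partition_on_def)
qed

lemma matching_eq_pair:
  assumes "matching S M" "{u, v} \<in> M" "{u, w} \<in> M"
  shows "v = w"
proof -
  have "{u, v} = {u, w}"
    using matching_disjoint[OF assms, of u] by simp
  thus ?thesis by (metis doubleton_eq_iff)
qed

lemma matching_pair_neq: "matching S M \<Longrightarrow> {u, v} \<in> M \<Longrightarrow> u \<noteq> v"
  by (auto simp: matching_def)

text \<open>A block of \<open>N\<close> at \<open>u\<close> must be the block that \<open>M\<close>
  already has there, so proper inclusion between perfect matchings of one set is impossible. Later
  equalities need only one inclusion.\<close>

lemma matching_eqI: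
  assumes "matching S M" "matching S N" "M \<subseteq> N"
  shows "M = N"
proof (intro equalityI assms subsetI)
  fix e assume e: "e \<in> N"
  obtain u v where uv: "e = {u, v}" "u \<in> S" by (metis e assms(2) matchingE)
  then obtain w where "{u, w} \<in> M" by (metis assms(1) matching_partner)
  with assms e uv show "e \<in> M"
    by (metis insertI1 matching_disjoint subsetD)
qed

lemma matching_image:
  assumes "matching S M" "inj_on f S"
  shows "matching (f ` S) ((`) f ` M)"
proof (rule matchingI)
  fix e assume "e \<in> (`) f ` M"
  then obtain d where d: "d \<in> M" "e = f ` d" by blast
  then obtain u v where "d = {u, v}" "u \<noteq> v" "u \<in> S" "v \<in> S"
    by (metis matchingE assms(1))
  hence "e = {f u, f v}" "f u \<noteq> f v" "f u \<in> f ` S" "f v \<in> f ` S"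
    using d inj_onD[OF assms(2), of u v] by auto
  thus "\<exists>u v. e = {u, v} \<and> u \<noteq> v \<and> u \<in> f ` S \<and> v \<in> f ` S" by blast
next
  fix u assume "u \<in> f ` S"
  thus "\<exists>e\<in>(`) f ` M. u \<in> e"
    using matching_Union[OF assms(1)] by blast
next
  fix e e' u assume *: "e \<in> (`) f ` M" "e' \<in> (`) f ` M" "u \<in> e" "u \<in> e'"
  then obtain d d' x x' where d: "d \<in> M" "e = f ` d" "d' \<in> M" "e' = f ` d'"
      "x \<in> d" "u = f x" "x' \<in> d'" "u = f x'"
    by blast
  hence "x = x'"
    using assms matching_subset by (metis inj_onD subsetD)
  thus "e = e'"
    using d assms(1) matching_disjoint by metis
qed

lemma matching_disjoint_Un:
  assumes "matching S M" "matching T N" "S \<inter> T = {}"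
  shows "matching (S \<union> T) (M \<union> N)"
proof -
  have "disjoint (M \<union> N)"
    using assms by (intro disjoint_union) (auto simp: matching_def partition_on_def)
  thus ?thesis
    using assms by (auto simp: matching_def partition_on_def)
qed

lemma matching_single: "u \<noteq> v \<Longrightarrow> matching {u, v} {{u, v}}"
  by (auto simp: matching_def partition_on_def disjoint_def)

lemma matching_Diff:
  assumes "matching S M" "N \<subseteq> M"
  shows "matching (S - \<Union>N) (M - N)"
proof -
  have "disjoint (M - N)"
    using assms by (auto simp: matching_def partition_on_def intro: pairwise_subset)
  moreover have "\<Union>(M - N) = S - \<Union>N"
  proof (intro equalityI subsetI)
    fix u assume "u \<in> S - \<Union>N"
    thus "u \<in> \<Union>(M - N)" using matching_Union[OF assms(1)] by auto
  next
    fix u assume "u \<in> \<Union>(M - N)"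
    then obtain e where e: "e \<in> M" "e \<notin> N" "u \<in> e" by blast
    hence "u \<notin> \<Union>N" using assms matching_disjoint by (metis UnionE subsetD)
    thus "u \<in> S - \<Union>N" using e matching_subset assms by blast
  qed
  ultimately show ?thesis
    using assms by (auto simp: matching_def partition_on_def)
qed

lemma matching_empty_iff [simp]: "matching {} M \<longleftrightarrow> M = {}"
  by (auto simp: matching_def partition_on_def)

lemma matching_empty2 [simp]: "matching S {} \<longleftrightarrow> S = {}"
  by (auto simp: matching_def partition_on_def)

section \<open>Connectivity, contraction and associativity of gluing\<close>

lemma link_Un: "link (M \<union> N) = link M \<union> link N"
  by (auto simp: link_def)

lemma sym_link: "sym (link M)"
  by (auto simp: link_def sym_def)

lemma conn_refl [simp]: "(u, u) \<in> conn M"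
  by (simp add: conn_def)

lemma conn_trans: "(u, v) \<in> conn M \<Longrightarrow> (v, w) \<in> conn M \<Longrightarrow> (u, w) \<in> conn M"
  by (simp add: conn_def)

lemma conn_sym: "(u, v) \<in> conn M \<Longrightarrow> (v, u) \<in> conn M"
  unfolding conn_def by (metis sym_link sym_rtrancl symD)

lemma conn_edge: "e \<in> M \<Longrightarrow> u \<in> e \<Longrightarrow> v \<in> e \<Longrightarrow> (u, v) \<in> conn M"
  by (auto simp: conn_def link_def)

text \<open>The set contains every edge it meets, so no walk leaves it; this is how non-connection
  is certified.\<close>

lemma conn_closed:
  assumes "(u, v) \<in> conn M" "u \<in> S" "\<And>e. e \<in> M \<Longrightarrow> e \<inter> S \<noteq> {} \<Longrightarrow> e \<subseteq> S"
  shows "v \<in> S"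
  using assms(1,2) unfolding conn_def
proof (induction rule: rtrancl_induct)
  case (step y z)
  thus ?case using assms(3) by (fastforce simp: link_def)
qed

lemma equiv_conn: "equiv X (conn M \<inter> X \<times> X)"
  by (rule equivI) (auto simp: refl_on_def sym_def trans_def intro: conn_sym conn_trans)

lemma partition_on_glue: "partition_on (sym_diff (\<Union>M) (\<Union>N)) (glue M N)"
  unfolding glue_def Let_def by (rule partition_on_quotient[OF equiv_conn])

lemma Union_glue: "\<Union>(glue M N) = sym_diff (\<Union>M) (\<Union>N)"
  using partition_on_glue by (metis partition_onD1)

text \<open>Passing to classes and back loses nothing, which lets adjacency in a glued matching be
  read as connectivity in the union graph.\<close>

lemma link_quotient: "equiv X E \<Longrightarrow> link (X // E) = E"
proof (intro equalityI subrelI)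
  fix u v assume E: "equiv X E"
  show "(u, v) \<in> E" if "(u, v) \<in> link (X // E)"
    using that E by (auto simp: link_def quotient_def) (metis E equivE symD transD)
  show "(u, v) \<in> link (X // E)" if "(u, v) \<in> E"
  proof -
    have "u \<in> X" using that E equiv_type by blast
    moreover have "u \<in> E `` {u}" using equiv_class_self[OF E \<open>u \<in> X\<close>] .
    ultimately show ?thesis using that by (auto simp: link_def quotient_def)
  qed
qed

lemma link_glue:
  "link (glue M N) = conn (M \<union> N) \<inter> sym_diff (\<Union>M) (\<Union>N) \<times> sym_diff (\<Union>M) (\<Union>N)"
  unfolding glue_def Let_def by (rule link_quotient[OF equiv_conn])

lemma glue_commute: "glue M N = glue N M"
  by (simp add: glue_def Un_commute)

text \<open>Vertices at which \<open>F\<close> does not meet \<open>E\<close> may be contracted away: only the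
  boundary \<open>X\<close> of \<open>F\<close> matters.\<close>

lemma rtrancl_contract:
  assumes "Field E \<inter> Field F \<subseteq> X" "u \<in> Field F \<Longrightarrow> u \<in> X" "w \<in> Field F \<Longrightarrow> w \<in> X"
  shows "(u, w) \<in> (E \<union> F)\<^sup>* \<longleftrightarrow> (u, w) \<in> (E \<union> (F\<^sup>* \<inter> X \<times> X))\<^sup>*"
proof
  let ?F = "F\<^sup>* \<inter> X \<times> X"
  have fld: "v = w \<or> v \<in> Field F \<and> w \<in> Field F" if "(v, w) \<in> F\<^sup>*" for v w
    using that by (metis FieldI1 FieldI2 converse_rtranclE rtranclE)
  assume "(u, w) \<in> (E \<union> F)\<^sup>*"
  \<comment> \<open>\<open>v\<close> is where the current run inside \<open>F\<close> began: up to
    \<open>v\<close> the walk is already contracted, and from \<open>v\<close> to \<open>w\<close>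
    only \<open>F\<close> has been used. A run start that belongs to \<open>Field F\<close> lies on
    the boundary \<open>X\<close>.\<close>
  hence "\<exists>v. (u, v) \<in> (E \<union> ?F)\<^sup>* \<and> (v, w) \<in> F\<^sup>* \<and> (v \<in> Field F \<longrightarrow> v \<in> X)"
  proof (induction rule: rtrancl_induct)
    case base
    thus ?case using assms(2) by blast
  next
    case (step w w')
    then obtain v where v: "(u, v) \<in> (E \<union> ?F)\<^sup>*" "(v, w) \<in> F\<^sup>*" "v \<in> Field F \<longrightarrow> v \<in> X"
      by blast
    show ?case
    proof (cases "(w, w') \<in> F")
      case True
      thus ?thesis using v by (meson rtrancl.rtrancl_into_rtrancl)
    next
      case False
      hence E: "(w, w') \<in> E" using step by blast
      hence "w \<in> Field E" "w' \<in> Field E" by (auto simp: Field_def)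
      hence "v = w \<or> (v, w) \<in> ?F"
        using fld[OF v(2)] v assms(1) by blast
      hence "(u, w) \<in> (E \<union> ?F)\<^sup>*"
        using v(1) by (auto intro: rtrancl.rtrancl_into_rtrancl)
      hence "(u, w') \<in> (E \<union> ?F)\<^sup>*"
        using E by (auto intro: rtrancl.rtrancl_into_rtrancl)
      thus ?thesis using \<open>w' \<in> Field E\<close> assms(1) by blast
    qed
  qed
  then obtain v where v: "(u, v) \<in> (E \<union> ?F)\<^sup>*" "(v, w) \<in> F\<^sup>*" "v \<in> Field F \<longrightarrow> v \<in> X"
    by blast
  hence "v = w \<or> (v, w) \<in> ?F"
    using fld[OF v(2)] assms(3) by blast
  thus "(u, w) \<in> (E \<union> ?F)\<^sup>*"
    using v(1) by (auto intro: rtrancl.rtrancl_into_rtrancl)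
next
  let ?F = "F\<^sup>* \<inter> X \<times> X"
  assume "(u, w) \<in> (E \<union> ?F)\<^sup>*"
  moreover have "E \<union> ?F \<subseteq> (E \<union> F)\<^sup>*"
    using rtrancl_mono[of F "E \<union> F"] by auto
  ultimately show "(u, w) \<in> (E \<union> F)\<^sup>*"
    using rtrancl_subset_rtrancl by blast
qed

lemma Field_link: "Field (link M) = \<Union>M"
  by (auto simp: Field_def link_def)

text \<open>A vertex common to all three would vanish in \<open>glue M N\<close> while
  \<open>L\<close> still passes through it. Without such vertices, \<open>M \<union> N\<close> meets
  \<open>L\<close> only in points that survive the gluing, and contraction applies.\<close>

lemma conn_glue:
  assumes "\<Union>M \<inter> \<Union>N \<inter> \<Union>L = {}" "u \<notin> \<Union>M \<inter> \<Union>N" "v \<notin> \<Union>M \<inter> \<Union>N"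
  shows "(u, v) \<in> conn (L \<union> glue M N) \<longleftrightarrow> (u, v) \<in> conn (L \<union> M \<union> N)"
proof -
  have "(u, v) \<in> (link L \<union> link (M \<union> N))\<^sup>* \<longleftrightarrow> (u, v) \<in> (link L \<union>
      ((link (M \<union> N))\<^sup>* \<inter> sym_diff (\<Union>M) (\<Union>N) \<times> sym_diff (\<Union>M) (\<Union>N)))\<^sup>*"
    by (rule rtrancl_contract) (use assms in \<open>auto simp: Field_link\<close>)
  thus ?thesis
    by (simp add: conn_def[of "L \<union> _"] link_Un link_glue[unfolded conn_def] conn_def Un_assoc)
qed

text \<open>Both sides consist of the classes of connectivity in
  \<open>M \<union> N \<union> L\<close> on one vertex set, because symmetric difference is
  associative.\<close>

lemma glue_assoc:
  assumes "\<Union>M \<inter> \<Union>N \<inter> \<Union>L = {}"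
  shows "glue (glue M N) L = glue M (glue N L)"
proof -
  define X where "X = sym_diff (sym_diff (\<Union>M) (\<Union>N)) (\<Union>L)"
  have X: "X = sym_diff (\<Union>M) (sym_diff (\<Union>N) (\<Union>L))"
    unfolding X_def by blast
  have "(u, v) \<in> conn (glue M N \<union> L) \<longleftrightarrow> (u, v) \<in> conn (M \<union> N \<union> L)"
    if "u \<in> X" "v \<in> X" for u v
  proof -
    have "u \<notin> \<Union>M \<inter> \<Union>N" "v \<notin> \<Union>M \<inter> \<Union>N"
      using that assms unfolding X_def by blast+
    from conn_glue[OF assms this] show ?thesis by (simp add: Un_ac)
  qed
  hence 1: "conn (glue M N \<union> L) \<inter> X \<times> X = conn (M \<union> N \<union> L) \<inter> X \<times> X"
    by blast
  have "(u, v) \<in> conn (M \<union> glue N L) \<longleftrightarrow> (u, v) \<in> conn (M \<union> N \<union> L)"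
    if "u \<in> X" "v \<in> X" for u v
  proof -
    have "u \<notin> \<Union>N \<inter> \<Union>L" "v \<notin> \<Union>N \<inter> \<Union>L"
      using that assms unfolding X_def by blast+
    moreover have "\<Union>N \<inter> \<Union>L \<inter> \<Union>M = {}" using assms by blast
    ultimately show ?thesis using conn_glue[of N L M u v] by (simp add: Un_ac)
  qed
  hence 2: "conn (M \<union> glue N L) \<inter> X \<times> X = conn (M \<union> N \<union> L) \<inter> X \<times> X"
    by blast
  have 3: "glue (glue M N) L = X // (conn (glue M N \<union> L) \<inter> X \<times> X)"
    by (subst glue_def) (simp only: Let_def Union_glue X_def)
  have 4: "glue M (glue N L) = X // (conn (M \<union> glue N L) \<inter> X \<times> X)"
    by (subst glue_def) (simp only: Let_def Union_glue X)
  show ?thesis unfolding 3 4 1 2 ..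
qed

lemma quotient_link: "matching X G \<Longrightarrow> X // link G = G"
proof -
  assume G: "matching X G"
  have 1: "link G `` {u} = e" if "e \<in> G" "u \<in> e" for u e
    using that matching_disjoint[OF G] unfolding link_def by blast
  show ?thesis
  proof (intro equalityI subsetI)
    fix C assume "C \<in> X // link G"
    then obtain u where "u \<in> X" "C = link G `` {u}" by (auto simp: quotient_def)
    then show "C \<in> G" using 1 matching_Union[OF G] by (metis UnionE)
  next
    fix e assume e: "e \<in> G"
    then obtain u where "u \<in> e" using matchingE[OF G e] by blast
    thus "e \<in> X // link G" using 1[OF e] e matching_Union[OF G] by (auto simp: quotient_def)
  qed
qed

text \<open>The set \<open>S\<close> is the connected component of the block \<open>g\<close> in the union graph.\<close>

lemma glue_eqI:
  assumes "matching X G" "X = sym_diff (\<Union>M) (\<Union>N)"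
    and "\<And>g. g \<in> G \<Longrightarrow> \<exists>S. g \<subseteq> S \<and> S \<inter> X \<subseteq> g \<and> (\<forall>e\<in>M \<union> N. e \<inter> S \<noteq> {} \<longrightarrow> e \<subseteq> S)
      \<and> (\<forall>u\<in>g. \<forall>v\<in>g. (u, v) \<in> conn (M \<union> N))"
  shows "glue M N = G"
proof -
  have "conn (M \<union> N) \<inter> X \<times> X = link G"
  proof (intro equalityI subrelI)
    fix u v assume uv: "(u, v) \<in> conn (M \<union> N) \<inter> X \<times> X"
    then obtain g where g: "g \<in> G" "u \<in> g"
      using matching_Union[OF assms(1)] by blast
    obtain S where S: "g \<subseteq> S \<and> S \<inter> X \<subseteq> g \<and> (\<forall>e\<in>M \<union> N. e \<inter> S \<noteq> {} \<longrightarrow> e \<subseteq> S)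
      \<and> (\<forall>u\<in>g. \<forall>v\<in>g. (u, v) \<in> conn (M \<union> N))"
      using assms(3)[OF g(1)] ..
    have "v \<in> S"
    proof (rule conn_closed)
      show "(u, v) \<in> conn (M \<union> N)" using uv by blast
      show "u \<in> S" using g S by blast
      show "e \<subseteq> S" if "e \<in> M \<union> N" "e \<inter> S \<noteq> {}" for e using that S by blast
    qed
    thus "(u, v) \<in> link G" using S g uv by (auto simp: link_def)
  next
    fix u v assume "(u, v) \<in> link G"
    then obtain g where g: "g \<in> G" "u \<in> g" "v \<in> g" by (auto simp: link_def)
    have "(u, v) \<in> conn (M \<union> N)" using assms(3)[OF g(1)] g(2,3) by (elim exE conjE) simp
    moreover have "u \<in> X" "v \<in> X" using matching_subset[OF assms(1) g(1)] g by blast+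
    ultimately show "(u, v) \<in> conn (M \<union> N) \<inter> X \<times> X" by simp
  qed
  thus ?thesis
    using quotient_link[OF assms(1)] assms(2) by (simp add: glue_def)
qed

section \<open>Gluing a single edge, then arbitrary finite matchings\<close>

lemma glue_disjoint:
  assumes "matching A M" "matching B N" "A \<inter> B = {}"
  shows "glue M N = M \<union> N"
proof (rule glue_eqI)
  show MN: "matching (A \<union> B) (M \<union> N)"
    by (rule matching_disjoint_Un[OF assms])
  show "A \<union> B = sym_diff (\<Union>M) (\<Union>N)"
    using assms by (auto simp: matching_Union)
  fix g assume g: "g \<in> M \<union> N"
  show "\<exists>S. g \<subseteq> S \<and> S \<inter> (A \<union> B) \<subseteq> g \<and> (\<forall>e\<in>M \<union> N. e \<inter> S \<noteq> {} \<longrightarrow> e \<subseteq> S)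
      \<and> (\<forall>u\<in>g. \<forall>v\<in>g. (u, v) \<in> conn (M \<union> N))"
    using g matching_disjoint[OF MN _ g] by (intro exI[of _ g]) (auto intro: conn_edge[OF g])
qed

text \<open>An edge with one end in \<open>B\<close> hangs a new leaf on \<open>p\<close>;
  contracting it only renames \<open>p\<close> to \<open>p'\<close>.\<close>

lemma glue_edge_transpose:
  assumes B: "matching B N" and p: "p \<in> B" "p' \<notin> B"
  shows "glue {{p, p'}} N = (`) (transpose p p') ` N"
proof (rule glue_eqI)
  let ?t = "transpose p p'"
  show G: "matching (?t ` B) ((`) ?t ` N)"
    by (rule matching_image[OF B]) (rule inj_on_transpose)
  have "?t ` B = insert p' (B - {p})"
    using p by (auto simp: transpose_def image_iff)
  also have *: "\<dots> = sym_diff (\<Union>{{p, p'}}) (\<Union>N)"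
    using p matching_Union[OF B] by auto
  finally show "?t ` B = sym_diff (\<Union>{{p, p'}}) (\<Union>N)" .
  have tB: "?t ` B = insert p' (B - {p})" by fact
  let ?C = "\<lambda>g S. g \<subseteq> S \<and> S \<inter> ?t ` B \<subseteq> g
      \<and> (\<forall>e\<in>{{p, p'}} \<union> N. e \<inter> S \<noteq> {} \<longrightarrow> e \<subseteq> S)
      \<and> (\<forall>u\<in>g. \<forall>v\<in>g. (u, v) \<in> conn ({{p, p'}} \<union> N))"
  fix g assume "g \<in> (`) ?t ` N"
  then obtain e where e: "e \<in> N" "g = ?t ` e" by blast
  have eB: "e \<subseteq> B" by (rule matching_subset[OF B e(1)])
  have disj: "d = e" if "d \<in> N" "d \<inter> e \<noteq> {}" for d
    using that matching_disjoint[OF B] e by blast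
  show "\<exists>S. ?C g S"
  proof (cases "p \<in> e")
    case True
    obtain u where u: "e = {p, u}" "u \<noteq> p" "u \<in> B"
      using matchingE[OF B e(1)] True by blast
    hence up: "u \<noteq> p'" using p by blast
    have g: "g = {p', u}" using e u up by (auto simp: transpose_def)
    have 1: "(p', p) \<in> conn ({{p, p'}} \<union> N)" by (rule conn_edge[of "{p, p'}"]) auto
    have 2: "(p, u) \<in> conn ({{p, p'}} \<union> N)" by (rule conn_edge[of e]) (use e u in auto)
    have 3: "(p', u) \<in> conn ({{p, p'}} \<union> N)" by (rule conn_trans[OF 1 2])
    have "e' \<subseteq> {p, p', u}" if "e' \<in> {{p, p'}} \<union> N" "e' \<inter> {p, p', u} \<noteq> {}" for e'
    proof (cases "e' \<in> N")
      case True
      hence "p' \<notin> e'" using p(2) matching_subset[OF B] by blast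
      hence "e' \<inter> e \<noteq> {}" using that u(1) by blast
      thus ?thesis using disj[OF True] u(1) by blast
    qed (use that in blast)
    hence "?C g {p, p', u}"
      using g 3 conn_sym[OF 3] u by (simp add: tB)
    thus ?thesis ..
  next
    case False
    have p'e: "p' \<notin> e" using eB p(2) by blast
    have g: "g = e" using e False p'e by (auto simp: transpose_def image_iff)
    have "e' \<subseteq> e" if "e' \<in> {{p, p'}} \<union> N" "e' \<inter> e \<noteq> {}" for e'
      using that disj False p'e by blast
    moreover have "\<forall>u\<in>e. \<forall>v\<in>e. (u, v) \<in> conn ({{p, p'}} \<union> N)"
      using conn_edge[of e "{{p, p'}} \<union> N"] e by blast
    ultimately have "?C g e" unfolding g by blast
    thus ?thesis ..
  qed
qed

text \<open>The edge runs parallel to a block of \<open>N\<close>, and its ends form a component of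
  which no vertex survives.\<close>

lemma glue_edge_remove:
  assumes B: "matching B N" and p: "{p, p'} \<in> N"
  shows "glue {{p, p'}} N = N - {{p, p'}}"
proof (rule glue_eqI)
  show G: "matching (B - {p, p'}) (N - {{p, p'}})"
    using matching_Diff[OF B, of "{{p, p'}}"] p by simp
  show "B - {p, p'} = sym_diff (\<Union>{{p, p'}}) (\<Union>N)"
    using matching_Union[OF B] matching_subset[OF B p] by auto
  fix g assume g: "g \<in> N - {{p, p'}}"
  have disj: "d = g" if "d \<in> N" "d \<inter> g \<noteq> {}" for d
    using that matching_disjoint[OF B] g by blast
  have "(u, v) \<in> conn ({{p, p'}} \<union> N)" if "u \<in> g" "v \<in> g" for u v
    by (rule conn_edge[of g]) (use g that in auto)
  thus "\<exists>S. g \<subseteq> S \<and> S \<inter> (B - {p, p'}) \<subseteq> g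
      \<and> (\<forall>e\<in>{{p, p'}} \<union> N. e \<inter> S \<noteq> {} \<longrightarrow> e \<subseteq> S)
      \<and> (\<forall>u\<in>g. \<forall>v\<in>g. (u, v) \<in> conn ({{p, p'}} \<union> N))"
    using disj p by (intro exI[of _ g]) blast
qed

text \<open>The edge closes the gap in the path from \<open>u\<close> over \<open>p\<close> and
  \<open>p'\<close> to \<open>v\<close>, whose ends form the new block. The condition
  \<open>u \<noteq> p'\<close> keeps this apart from the parallel case.\<close>

lemma glue_edge_join:
  assumes B: "matching B N" and p: "{p, u} \<in> N" "{p', v} \<in> N" "p \<noteq> p'" "u \<noteq> p'"
  shows "glue {{p, p'}} N = insert {u, v} (N - {{p, u}, {p', v}})"
    and "u \<noteq> v" "u \<in> B - {p, p'}" "v \<in> B - {p, p'}"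
    and "matching (B - {p, p'}) (glue {{p, p'}} N)"
proof -
  have neq: "p \<noteq> u" "p' \<noteq> v" using p matching_pair_neq[OF B] by blast+
  have "{p, u} \<inter> {p', v} = {}"
    using matching_disjoint[OF B p(1,2)] p(3,4) neq by blast
  hence uv: "u \<noteq> v" "v \<noteq> p" by blast+
  show "u \<noteq> v" by fact
  show uB: "u \<in> B - {p, p'}" "v \<in> B - {p, p'}"
    using matching_subset[OF B p(1)] matching_subset[OF B p(2)] neq uv p by auto
  have pB: "p \<in> B" "p' \<in> B" using matching_subset[OF B p(1)] matching_subset[OF B p(2)] by auto
  have D: "matching (B - {p, u, p', v}) (N - {{p, u}, {p', v}})"
  proof -
    have "\<Union>{{p, u}, {p', v}} = {p, u, p', v}" by blast
    thus ?thesis using matching_Diff[OF B, of "{{p, u}, {p', v}}"] p by simp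
  qed
  have "matching ({u, v} \<union> (B - {p, u, p', v})) ({{u, v}} \<union> (N - {{p, u}, {p', v}}))"
    by (rule matching_disjoint_Un[OF matching_single D]) (use uv in auto)
  moreover have "{u, v} \<union> (B - {p, u, p', v}) = B - {p, p'}"
    using uB by blast
  ultimately have G: "matching (B - {p, p'}) (insert {u, v} (N - {{p, u}, {p', v}}))" by simp
  show glue: "glue {{p, p'}} N = insert {u, v} (N - {{p, u}, {p', v}})"
  proof (rule glue_eqI[OF G])
    show "B - {p, p'} = sym_diff (\<Union>{{p, p'}}) (\<Union>N)"
      using matching_Union[OF B] pB by auto
    let ?C = "\<lambda>g S. g \<subseteq> S \<and> S \<inter> (B - {p, p'}) \<subseteq> g
      \<and> (\<forall>e\<in>{{p, p'}} \<union> N. e \<inter> S \<noteq> {} \<longrightarrow> e \<subseteq> S)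
      \<and> (\<forall>u\<in>g. \<forall>v\<in>g. (u, v) \<in> conn ({{p, p'}} \<union> N))"
    fix g assume "g \<in> insert {u, v} (N - {{p, u}, {p', v}})"
    then consider "g = {u, v}" | "g \<in> N" "g \<noteq> {p, u}" "g \<noteq> {p', v}" by blast
    thus "\<exists>S. ?C g S"
    proof cases
      case 1
      have c1: "(u, p) \<in> conn ({{p, p'}} \<union> N)" by (rule conn_edge[of "{p, u}"]) (use p in auto)
      have c2: "(p, p') \<in> conn ({{p, p'}} \<union> N)" by (rule conn_edge[of "{p, p'}"]) auto
      have c3: "(p', v) \<in> conn ({{p, p'}} \<union> N)" by (rule conn_edge[of "{p', v}"]) (use p in auto)
      have c: "(u, v) \<in> conn ({{p, p'}} \<union> N)" by (rule conn_trans[OF c1 conn_trans[OF c2 c3]])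
      have "e \<subseteq> {u, p, p', v}" if e: "e \<in> {{p, p'}} \<union> N" "e \<inter> {u, p, p', v} \<noteq> {}" for e
      proof (cases "e \<in> N")
        case True
        hence "e \<inter> {p, u} \<noteq> {} \<Longrightarrow> e = {p, u}" "e \<inter> {p', v} \<noteq> {} \<Longrightarrow> e = {p', v}"
          using p matching_disjoint[OF B True] by blast+
        thus ?thesis using e(2) by blast
      qed (use e in blast)
      moreover have "{u, p, p', v} \<inter> (B - {p, p'}) \<subseteq> {u, v}" by blast
      ultimately have "?C g {u, p, p', v}" unfolding 1 using c conn_sym[OF c] by simp
      thus ?thesis ..
    next
      case 2
      have disj: "d = g" if "d \<in> N" "d \<inter> g \<noteq> {}" for d
        using that matching_disjoint[OF B] 2 by blast
      have "p \<notin> g" "p' \<notin> g"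
        using 2 disj[OF p(1)] disj[OF p(2)] by blast+
      moreover have "(u, v) \<in> conn ({{p, p'}} \<union> N)" if "u \<in> g" "v \<in> g" for u v
        by (rule conn_edge[of g]) (use 2 that in auto)
      ultimately have "?C g g" using disj by blast
      thus ?thesis ..
    qed
  qed
  show "matching (B - {p, p'}) (glue {{p, p'}} N)"
    unfolding glue by (rule G)
qed

text \<open>The number of ends of \<open>e\<close> in \<open>B\<close> decides: none gives a
  disjoint union, one a renaming, two a join or a deletion.\<close>

lemma matching_glue_edge:
  assumes B: "matching B N" and e: "card e = 2"
  shows "matching (sym_diff e B) (glue {e} N)"
proof -
  obtain p p' where pp: "e = {p, p'}" "p \<noteq> p'" using e by (auto simp: card_2_iff)
  have in_out: "matching (sym_diff {p, p'} B) (glue {{p, p'}} N)" if "p \<in> B" "p' \<notin> B" for p p'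
  proof -
    have "transpose p p' ` B = sym_diff {p, p'} B"
      using that by (auto simp: transpose_def image_iff)
    thus ?thesis
      using glue_edge_transpose[OF B that] matching_image[OF B inj_on_transpose, of p p'] by simp
  qed
  consider "p \<notin> B" "p' \<notin> B" | "p \<in> B" "p' \<notin> B" | "p \<notin> B" "p' \<in> B" | "p \<in> B" "p' \<in> B"
    by blast
  thus ?thesis
  proof cases
    case 1
    have "sym_diff e B = {p, p'} \<union> B" using 1 pp by blast
    thus ?thesis
      using glue_disjoint[OF matching_single[OF pp(2)] B]
        matching_disjoint_Un[OF matching_single[OF pp(2)] B] 1 pp by simp
  next
    case 2 thus ?thesis using in_out pp by simp
  next
    case 3 thus ?thesis using in_out[of p' p] pp by (simp add: insert_commute)
  next
    case 4
    then obtain u v where uv: "{p, u} \<in> N" "{p', v} \<in> N"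
      using matching_partner[OF B] by metis
    have S: "sym_diff e B = B - {p, p'}" using 4 pp by blast
    show ?thesis
    proof (cases "u = p'")
      case True
      hence "{p, p'} \<in> N" using uv by simp
      from glue_edge_remove[OF B this] matching_Diff[OF B, of "{{p, p'}}"] this pp S
      show ?thesis by simp
    next
      case False
      show ?thesis using glue_edge_join(5)[OF B uv pp(2) False] S pp(1) by simp
    qed
  qed
qed

lemma matching_insertD:
  assumes "matching A (insert e M)" "e \<notin> M"
  shows "card e = 2" "e \<subseteq> A" "matching (A - e) M"
  using assms matching_Diff[OF assms(1), of "{e}"] matching_subset[OF assms(1), of e]
  by (auto simp: matching_def)

text \<open>\<open>e\<close> is disjoint from the blocks of \<open>M\<close>, so no vertex lies in
  all three pieces and associativity permits gluing \<open>e\<close> first. This is the inductive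
  step for everything proved block by block.\<close>

lemma glue_insert:
  assumes A: "matching A (insert e M)" "e \<notin> M" and B: "matching B N"
  shows "glue (insert e M) N = glue M (glue {e} N)"
proof -
  note i = matching_insertD[OF A]
  have e: "matching e {e}"
    using i(1) by (auto simp: matching_def partition_on_def disjoint_def)
  have "glue (insert e M) N = glue (glue M {e}) N"
    using glue_disjoint[OF i(3) e] by (simp add: Diff_disjoint Int_commute)
  also have "\<dots> = glue M (glue {e} N)"
    by (rule glue_assoc) (use matching_Union[OF i(3)] in auto)
  finally show ?thesis .
qed

text \<open>Each intermediate result of gluing block by block is again a matching, so the
  alternating paths and cycles of the union graph need no analysis.\<close>

lemma matching_glue:
  assumes "matching A M" "finite M" "matching B N"
  shows "matching (sym_diff A B) (glue M N)"
  using assms(2,1,3)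
proof (induction arbitrary: A B N)
  case empty
  thus ?case using glue_disjoint[of "{}" "{}" B N] by simp
next
  case (insert e M)
  note i = matching_insertD[OF insert.prems(1) insert.hyps(2)]
  have "matching (sym_diff (A - e) (sym_diff e B)) (glue M (glue {e} N))"
    by (rule insert.IH[OF i(3) matching_glue_edge[OF insert.prems(2) i(1)]])
  moreover have "sym_diff (A - e) (sym_diff e B) = sym_diff A B"
    using i(2) by blast
  ultimately show ?case
    using glue_insert[OF insert.prems(1) insert.hyps(2) insert.prems(2)] by simp
qed

text \<open>Every block of \<open>G\<close> joins connected vertices and hence is a block of the
  glued matching; one inclusion between matchings is enough. A product is thus verified by one path
  per expected block, with no argument that components are separate.\<close>

lemma glue_eqI_conn:
  assumes "matching X (glue M N)" "matching X G"
    and "\<And>u v. {u, v} \<in> G \<Longrightarrow> (u, v) \<in> conn (M \<union> N)"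
  shows "glue M N = G"
proof (rule sym, rule matching_eqI[OF assms(2,1)], rule subsetI)
  fix g assume g: "g \<in> G"
  obtain u v where uv: "g = {u, v}" "u \<noteq> v" "u \<in> X" "v \<in> X"
    by (rule matchingE[OF assms(2) g])
  hence "(u, v) \<in> link (glue M N)"
    using g assms(3) matching_Union[OF assms(1)] unfolding link_glue Union_glue by simp
  then obtain h where h: "h \<in> glue M N" "u \<in> h" "v \<in> h" by (auto simp: link_def)
  moreover have "card h = 2"
    using h(1) assms(1) by (auto simp: matching_def)
  ultimately have "h = g" using uv by (auto simp: card_2_iff)
  thus "g \<in> glue M N" using h by simp
qed

lemma glue_eq_matchingI:
  assumes "matching A M" "finite M" "matching B N"
    and "matching (sym_diff A B) G"
    and "\<And>u v. {u, v} \<in> G \<Longrightarrow> (u, v) \<in> conn (M \<union> N)"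
  shows "glue M N = G"
  by (rule glue_eqI_conn[OF matching_glue[OF assms(1-3)] assms(4,5)])

lemma conn_image: "(u, v) \<in> conn M \<Longrightarrow> (f u, f v) \<in> conn ((`) f ` M)"
  unfolding conn_def
proof (induction rule: rtrancl_induct)
  case (step y z)
  have "(f y, f z) \<in> link ((`) f ` M)" using step(2) by (auto simp: link_def)
  with step show ?case by (auto intro: rtrancl.rtrancl_into_rtrancl)
qed simp

text \<open>Paths map to paths, and by the path criterion that determines the result; injectivity
  ensures that exactly the images of shared vertices vanish.\<close>

lemma glue_image:
  assumes "matching A M" "finite M" "matching B N" "inj_on f (A \<union> B)"
  shows "glue ((`) f ` M) ((`) f ` N) = (`) f ` glue M N"
proof (rule glue_eq_matchingI)
  show "matching (f ` A) ((`) f ` M)" "matching (f ` B) ((`) f ` N)"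
    using assms by (auto intro!: matching_image elim: inj_on_subset)
  show "finite ((`) f ` M)" using assms by simp
  have "sym_diff (f ` A) (f ` B) = f ` (sym_diff A B)"
    using assms(4) by (auto simp: inj_on_def)
  moreover have "inj_on f (sym_diff A B)"
    using assms(4) by (rule inj_on_subset) auto
  ultimately show "matching (sym_diff (f ` A) (f ` B)) ((`) f ` glue M N)"
    using matching_image[OF matching_glue[OF assms(1-3)]] by metis
  fix u v assume "{u, v} \<in> (`) f ` glue M N"
  then obtain h where h: "h \<in> glue M N" "{u, v} = f ` h" by blast
  then obtain x y where xy: "x \<in> h" "y \<in> h" "u = f x" "v = f y" by blast
  hence "(x, y) \<in> link (glue M N)" using h by (auto simp: link_def)
  hence "(x, y) \<in> conn (M \<union> N)" unfolding link_glue by blast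
  thus "(u, v) \<in> conn ((`) f ` M \<union> (`) f ` N)"
    using conn_image[of x y "M \<union> N" f] xy by (simp add: image_Un)
qed

text \<open>Three factors at once, so that a triple product can be computed from paths without
  knowing its intermediate product.\<close>

lemma glue_glue_eq_matchingI:
  assumes M: "matching A M" "finite A" and N: "matching B N" "finite B" and L: "matching C L"
    and ABC: "A \<inter> B \<inter> C = {}"
    and G: "matching (sym_diff (sym_diff A B) C) G"
    and conn: "\<And>u v. {u, v} \<in> G \<Longrightarrow> (u, v) \<in> conn (M \<union> N \<union> L)"
  shows "glue (glue M N) L = G"
proof (rule glue_eqI_conn[OF _ G])
  note MN = matching_glue[OF M(1) matching_finite[OF M] N(1)]
  have "finite (glue M N)"
    by (rule matching_finite[OF MN]) (use M N in auto)
  from matching_glue[OF MN this L]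
  show "matching (sym_diff (sym_diff A B) C) (glue (glue M N) L)" .
  fix u v assume uv: "{u, v} \<in> G"
  hence "u \<notin> A \<inter> B" "v \<notin> A \<inter> B"
    using matching_subset[OF G uv] ABC by blast+
  moreover have "A \<inter> B \<inter> C = {}" by (rule ABC)
  ultimately show "(u, v) \<in> conn (glue M N \<union> L)"
    using conn_glue[of M N L u v] conn[OF uv]
      matching_Union[OF M(1)] matching_Union[OF N(1)] matching_Union[OF L]
    by (simp add: Un_ac)
qed

section \<open>Counting matchings\<close>

lemma dfact_nonpos: "k \<le> 0 \<Longrightarrow> dfact k = 1"
  by (simp add: dfact.simps)

lemma dfact_pos: "k > 0 \<Longrightarrow> dfact k = nat k * dfact (k - 2)"
  by (simp add: dfact.simps)

lemma dfact_gt_0: "dfact k > 0"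
proof (induction k rule: dfact.induct)
  case (1 k)
  thus ?case by (cases "k \<le> 0") (auto simp: dfact_nonpos dfact_pos)
qed

lemma dfact_step: "k \<ge> 2 \<Longrightarrow> dfact (int k - 1) = (k - 1) * dfact (int (k - 2) - 1)"
  by (subst dfact_pos) (auto simp: nat_diff_distrib of_nat_diff)

lemma finite_matchings: "finite S \<Longrightarrow> finite {M. matching S M}"
  by (rule finite_subset[of _ "Pow (Pow S)"]) (auto dest: matching_subset)

lemma card_UN_const:
  assumes "finite I" "\<And>i. i \<in> I \<Longrightarrow> finite (F i)" "\<And>i. i \<in> I \<Longrightarrow> card (F i) = c"
    and "\<And>i j. i \<in> I \<Longrightarrow> j \<in> I \<Longrightarrow> i \<noteq> j \<Longrightarrow> F i \<inter> F j = {}"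
  shows "card (\<Union>i\<in>I. F i) = card I * c"
  using assms by (subst card_UN_disjoint) auto

text \<open>A matching glued to \<open>G\<close> by the edge \<open>{p, p'}\<close> is determined by the partner of \<open>p\<close>.\<close>

lemma card_glue_edge_fibre:
  assumes B: "finite B" and p: "p \<in> B" "p' \<in> B" "p \<noteq> p'" and G: "matching (B - {p, p'}) G"
  shows "card {N. matching B N \<and> glue {{p, p'}} N = G} = card B - 1"
proof -
  have "\<forall>u\<in>B - {p, p'}. \<exists>v. {u, v} \<in> G \<and> u \<noteq> v \<and> v \<in> B - {p, p'}"
    by (meson G matching_partner)
  then obtain w where w: "\<And>u. u \<in> B - {p, p'} \<Longrightarrow> {u, w u} \<in> G"
      "\<And>u. u \<in> B - {p, p'} \<Longrightarrow> u \<noteq> w u" "\<And>u. u \<in> B - {p, p'} \<Longrightarrow> w u \<in> B - {p, p'}"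
    by (metis bchoice)
  \<comment> \<open>\<open>w\<close> is the partner map of \<open>G\<close>. To give
    \<open>p\<close> the partner \<open>u\<close>, the block of \<open>u\<close> in \<open>G\<close>
    is cut and its other end \<open>w u\<close> is handed to \<open>p'\<close>; for
    \<open>u = p'\<close> the edge itself is added.\<close>
  define F where "F u = (if u = p' then insert {p, p'} G
    else {{p, u}, {p', w u}} \<union> (G - {{u, w u}}))" for u
  have F: "matching B (F u) \<and> {p, u} \<in> F u \<and> glue {{p, p'}} (F u) = G" if u: "u \<in> B - {p}" for u
  proof (cases "u = p'")
    case True
    have "matching ({p, p'} \<union> (B - {p, p'})) ({{p, p'}} \<union> G)"
      by (rule matching_disjoint_Un[OF matching_single[OF p(3)] G]) auto
    moreover have "{p, p'} \<union> (B - {p, p'}) = B" using p by auto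
    ultimately have m: "matching B (insert {p, p'} G)" by simp
    have "{p, p'} \<notin> G" using matching_subset[OF G] by blast
    thus ?thesis using True m glue_edge_remove[OF m, of p p'] by (simp add: F_def)
  next
    case False
    hence u': "u \<in> B - {p, p'}" using u by blast
    note w = w[OF u']
    have d: "p \<noteq> u" "p \<noteq> w u" "p' \<noteq> u" "p' \<noteq> w u" using w u' by auto
    have "matching ({p, u} \<union> {p', w u}) ({{p, u}} \<union> {{p', w u}})"
      by (rule matching_disjoint_Un[OF matching_single matching_single]) (use w d p in auto)
    hence "matching (({p, u} \<union> {p', w u}) \<union> (B - {p, p'} - {u, w u}))
        (({{p, u}} \<union> {{p', w u}}) \<union> (G - {{u, w u}}))"
      by (rule matching_disjoint_Un) (use matching_Diff[OF G, of "{{u, w u}}"] w d p in auto)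
    moreover have "({p, u} \<union> {p', w u}) \<union> (B - {p, p'} - {u, w u}) = B" using w p u' by auto
    ultimately have m: "matching B (F u)" using False by (simp add: F_def insert_commute)
    have pu: "{p, u} \<in> F u" "{p', w u} \<in> F u" using False by (auto simp: F_def)
    have "glue {{p, p'}} (F u) = insert {u, w u} (F u - {{p, u}, {p', w u}})"
      by (rule glue_edge_join(1)[OF m pu]) (use p False in auto)
    moreover have "{p, u} \<notin> G" "{p', w u} \<notin> G"
      using matching_subset[OF G] by blast+
    ultimately have "glue {{p, p'}} (F u) = G"
      using False w by (auto simp: F_def)
    thus ?thesis using m pu by simp
  qed
  have "bij_betw F (B - {p}) {N. matching B N \<and> glue {{p, p'}} N = G}"
  proof (rule bij_betwI')
    fix u v assume uv: "u \<in> B - {p}" "v \<in> B - {p}"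
    show "F u = F v \<longleftrightarrow> u = v"
      using F[OF uv(1)] F[OF uv(2)] matching_eq_pair by metis
  next
    fix u assume "u \<in> B - {p}"
    thus "F u \<in> {N. matching B N \<and> glue {{p, p'}} N = G}" using F by simp
  next
    fix N assume "N \<in> {N. matching B N \<and> glue {{p, p'}} N = G}"
    hence N: "matching B N" "glue {{p, p'}} N = G" by auto
    obtain u where u: "{p, u} \<in> N" "p \<noteq> u" "u \<in> B" by (rule matching_partner[OF N(1) p(1)])
    have "N = F u"
    proof (cases "u = p'")
      case True
      thus ?thesis using glue_edge_remove[OF N(1)] u N by (auto simp: F_def)
    next
      case False
      obtain v where v: "{p', v} \<in> N" "p' \<noteq> v" "v \<in> B" by (rule matching_partner[OF N(1) p(2)])
      note j = glue_edge_join[OF N(1) u(1) v(1) p(3) False]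
      have "{u, v} \<in> G" using j N by simp
      hence v_eq: "v = w u" using w(1)[OF j(3)] matching_eq_pair[OF G] by metis
      have "{u, v} \<notin> N" using matching_disjoint[OF N(1) _ u(1), of "{u, v}" u] j by auto
      hence "N = {{p, u}, {p', v}} \<union> (G - {{u, v}})" using j N u v by auto
      thus ?thesis using False v_eq by (simp add: F_def)
    qed
    thus "\<exists>u\<in>B - {p}. N = F u" using u by blast
  qed
  hence "card {N. matching B N \<and> glue {{p, p'}} N = G} = card (B - {p})"
    by (metis bij_betw_same_card)
  thus ?thesis using p B by simp
qed

text \<open>Gluing a fixed edge sends matchings of \<open>S\<close> to matchings of
  \<open>S - {p, p'}\<close> with fibres of size \<open>card S - 1\<close>, which is the recursion
  of the double factorial.\<close>

lemma card_matchings: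
  assumes "finite S" "even (card S)"
  shows "card {M. matching S M} = dfact (int (card S) - 1)"
  using assms
proof (induction "card S" arbitrary: S rule: less_induct)
  case less
  show ?case
  proof (cases "S = {}")
    case True
    hence *: "{M. matching S M} = {{}}" by auto
    show ?thesis unfolding * using True by (simp add: dfact_nonpos)
  next
    case False
    then obtain p where p: "p \<in> S" by blast
    have "S \<noteq> {p}" using less.prems by auto
    then obtain p' where p': "p' \<in> S" "p \<noteq> p'" using p by blast
    let ?T = "S - {p, p'}"
    have c: "card S = Suc (Suc (card ?T))"
      using p p' less.prems by (metis card.remove card_Diff_insert finite_Diff insert_iff
        Diff_insert Diff_insert2 insert_Diff_single DiffI singletonD)
    have "{M. matching S M}
        = (\<Union>G\<in>{G. matching ?T G}. {M. matching S M \<and> glue {{p, p'}} M = G})"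
    proof -
      have "matching ?T (glue {{p, p'}} M)" if "matching S M" for M
      proof -
        have "sym_diff {p, p'} S = ?T" using p p' by blast
        thus ?thesis using matching_glue_edge[OF that, of "{p, p'}"] p' by simp
      qed
      thus ?thesis by auto
    qed
    also have "card \<dots> = card {G. matching ?T G} * (card S - 1)"
    proof (rule card_UN_const)
      show "finite {G. matching ?T G}" using finite_matchings[of ?T] less.prems by simp
      show "finite {M. matching S M \<and> glue {{p, p'}} M = G}" for G
        using finite_matchings[OF less.prems(1)] by (rule rev_finite_subset) blast
    qed (use less.prems p p' in \<open>auto simp: card_glue_edge_fibre\<close>)
    also have "card {G. matching ?T G} = dfact (int (card ?T) - 1)"
      using less.hyps[of ?T] c less.prems by simp
    finally show ?thesis using c dfact_step[of "card S"] by simp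
  qed
qed

text \<open>A block of \<open>R\<close> with one end in \<open>B\<close> contributes a factor 1, a
  block inside \<open>B\<close> lowers the number of points by two and contributes one step of the
  double factorial; the product telescopes. Each block must meet \<open>B\<close>, for otherwise it
  would survive in the result and the fibre size would depend on whether \<open>G\<close> contains
  it.\<close>

lemma card_glue_fibre:
  assumes "matching A R" "finite R" "finite B" "\<And>e. e \<in> R \<Longrightarrow> e \<inter> B \<noteq> {}"
    and "matching (sym_diff A B) G"
  shows "card {N. matching B N \<and> glue R N = G} * dfact (int (card (sym_diff A B)) - 1)
    = dfact (int (card B) - 1)"
  using assms(2,1,3,4,5)
proof (induction arbitrary: A B G)
  case empty
  have "{N. matching B N \<and> glue {} N = G} = {G}"
    using empty glue_disjoint[of "{}" "{}" B] by auto
  thus ?case using empty by simp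
next
  case (insert e R)
  note i = matching_insertD[OF insert.prems(1) insert.hyps(2)]
  let ?B = "sym_diff e B"
  let ?F = "{N'. matching ?B N' \<and> glue R N' = G}"
  have fin_e: "finite e" using i(1) by (metis card.infinite zero_neq_numeral)
  have AB: "sym_diff (A - e) ?B = sym_diff A B" using i(2) by blast
  have edges: "d \<inter> ?B \<noteq> {}" if "d \<in> R" for d
  proof -
    have "d \<inter> e = {}" using matching_subset[OF i(3) that] by blast
    thus ?thesis using insert.prems(3)[of d] that by blast
  qed
  have IH: "card ?F * dfact (int (card (sym_diff A B)) - 1) = dfact (int (card ?B) - 1)"
    using insert.IH[OF i(3) _ edges, of G] insert.prems fin_e unfolding AB by simp
  have "{N. matching B N \<and> glue (insert e R) N = G}
      = (\<Union>N'\<in>?F. {N. matching B N \<and> glue {e} N = N'})"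
    using glue_insert[OF insert.prems(1) insert.hyps(2)] matching_glue_edge[OF _ i(1)]
    by auto
  \<comment> \<open>The common fibre size \<open>c\<close> is 1 if \<open>e\<close> has one end in
    \<open>B\<close>, gluing then being an invertible renaming, and \<open>card B - 1\<close> if
    both ends lie in \<open>B\<close>.\<close>
  moreover obtain c where c: "\<And>N'. N' \<in> ?F \<Longrightarrow> card {N. matching B N \<and> glue {e} N = N'} = c"
    "c * dfact (int (card ?B) - 1) = dfact (int (card B) - 1)"
  proof -
    note obtain_c = that
    have one: thesis if e: "e = {p, p'}" "p \<in> B" "p' \<notin> B" for p p'
    proof -
      let ?t = "transpose p p'"
      have tB: "?t ` B = ?B" using e by (auto simp: transpose_def image_iff)
      have tt: "(`) ?t ` (`) ?t ` N = N" for N :: "'a set set"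
        by (simp add: image_image)
      have "card {N. matching B N \<and> glue {e} N = N'} = 1" if N': "N' \<in> ?F" for N'
      proof -
        have "matching (?t ` ?B) ((`) ?t ` N')"
          using N' by (intro matching_image) auto
        hence "matching B ((`) ?t ` N')" by (simp add: tB[symmetric] image_image)
        hence "{N. matching B N \<and> glue {e} N = N'} = {(`) ?t ` N'}"
          using glue_edge_transpose[OF _ e(2,3)] tt e(1) by (auto simp: image_image)
        thus ?thesis by simp
      qed
      moreover have "card ?B = card B" using tB by (metis card_image inj_on_transpose)
      ultimately show thesis by (intro obtain_c[of 1]) simp_all
    qed
    obtain p p' where pp: "e = {p, p'}" "p \<noteq> p'" using i(1) by (auto simp: card_2_iff)
    consider "p \<in> B" "p' \<notin> B" | "p \<notin> B" "p' \<in> B" | "p \<in> B" "p' \<in> B"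
      using insert.prems(3)[of e] pp by blast
    thus thesis
    proof cases
      case 1 thus thesis using one pp by blast
    next
      case 2 thus thesis using one[of p' p] pp by blast
    next
      case 3
      have B': "?B = B - {p, p'}" using 3 pp by blast
      have "e \<subseteq> B" using 3 pp by blast
      hence "card ?B = card B - 2" "card B \<ge> 2"
        using B' pp i(1) fin_e insert.prems(2) card_Diff_subset[of e B] card_mono[of B e] by auto
      hence "(card B - 1) * dfact (int (card ?B) - 1) = dfact (int (card B) - 1)"
        using dfact_step[of "card B"] by simp
      moreover have "card {N. matching B N \<and> glue {e} N = N'} = card B - 1" if "N' \<in> ?F" for N'
        unfolding pp(1) by (rule card_glue_edge_fibre) (use that B' 3 pp insert.prems in auto)
      ultimately show thesis by (intro obtain_c)
    qed
  qed
  moreover have "card (\<Union>N'\<in>?F. {N. matching B N \<and> glue {e} N = N'}) = card ?F * c"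
  proof (rule card_UN_const)
    have "finite ?B" using insert.prems(2) fin_e by simp
    from finite_matchings[OF this] show "finite ?F" by (rule rev_finite_subset) blast
    show "finite {N. matching B N \<and> glue {e} N = N'}" for N'
      using finite_matchings[OF insert.prems(2)] by (rule rev_finite_subset) blast
  qed (use c(1) in blast)+
  ultimately have "card {N. matching B N \<and> glue (insert e R) N = G} * dfact (int (card (sym_diff A B)) - 1)
      = c * (card ?F * dfact (int (card (sym_diff A B)) - 1))"
    by (simp only: mult_ac)
  thus ?case by (simp only: IH c(2))
qed

text \<open>With no block inside \<open>Y\<close>, the points of \<open>Y\<close> have distinct
  partners in \<open>X\<close>. Choosing these accounts for the factorial and the binomial, and what
  is left of \<open>X\<close> is matched freely. The induction fixes the partner \<open>u\<close> of
  one point \<open>y\<close>.\<close>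

lemma card_matchings_avoiding:
  assumes "finite Y" "finite X" "X \<inter> Y = {}" "card Y \<le> card X" "even (card X + card Y)"
  shows "card {M. matching (X \<union> Y) M \<and> (\<forall>e\<in>M. \<not> e \<subseteq> Y)}
    = fact (card Y) * (card X choose card Y) * dfact (int (card X) - int (card Y) - 1)"
  using assms
proof (induction Y arbitrary: X)
  case empty
  have "{M. matching X M \<and> (\<forall>e\<in>M. e \<noteq> {})} = {M. matching X M}"
    by (auto elim: matchingE)
  thus ?case using empty by (simp add: card_matchings)
next
  case (insert y Y)
  let ?k = "card Y" and ?l = "card X - 1"
  let ?S = "{M. matching (X \<union> insert y Y) M \<and> (\<forall>e\<in>M. \<not> e \<subseteq> insert y Y)}"
  let ?S' = "\<lambda>u. {M. matching (X - {u} \<union> Y) M \<and> (\<forall>e\<in>M. \<not> e \<subseteq> Y)}"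
  let ?c = "fact ?k * (?l choose ?k) * dfact (int ?l - int ?k - 1)"
  have X: "card X = Suc ?l" "?k \<le> ?l" using insert by auto
  have yX: "y \<notin> X" using insert.prems by blast
  have S'_card: "card {M \<in> ?S. {y, u} \<in> M} = ?c" if u: "u \<in> X" for u
  proof -
    have uY: "u \<noteq> y" "u \<notin> Y" using u insert by auto
    have bij: "bij_betw (insert {y, u}) (?S' u) {M \<in> ?S. {y, u} \<in> M}"
    proof (rule bij_betwI')
      fix M N assume *: "M \<in> ?S' u" "N \<in> ?S' u"
      have "{y, u} \<notin> M" "{y, u} \<notin> N"
        using matching_subset[of "X - {u} \<union> Y"] * uY by auto
      thus "insert {y, u} M = insert {y, u} N \<longleftrightarrow> M = N" by (metis insert_ident)
    next
      fix M assume M: "M \<in> ?S' u"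
      have "matching ({y, u} \<union> (X - {u} \<union> Y)) ({{y, u}} \<union> M)"
        by (rule matching_disjoint_Un[OF matching_single]) (use M uY yX insert.hyps in auto)
      moreover have "{y, u} \<union> (X - {u} \<union> Y) = X \<union> insert y Y" using u by blast
      moreover have "\<not> e \<subseteq> insert y Y" if "e \<in> M" for e
      proof -
        have "\<not> e \<subseteq> Y" "y \<notin> e"
          using that M matching_subset[of "X - {u} \<union> Y" M e] yX insert.hyps by auto
        thus ?thesis by blast
      qed
      ultimately show "insert {y, u} M \<in> {M \<in> ?S. {y, u} \<in> M}"
        using uY by auto
    next
      fix M assume M: "M \<in> {M \<in> ?S. {y, u} \<in> M}"
      have "matching (X \<union> insert y Y - {y, u}) (M - {{y, u}})"
        using M matching_Diff[of "X \<union> insert y Y" M "{{y, u}}"] by auto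
      moreover have "X \<union> insert y Y - {y, u} = X - {u} \<union> Y"
        using uY yX insert.hyps by blast
      ultimately have "M - {{y, u}} \<in> ?S' u" using M by auto
      moreover have "M = insert {y, u} (M - {{y, u}})" using M by blast
      ultimately show "\<exists>N\<in>?S' u. M = insert {y, u} N" by blast
    qed
    have "(X - {u}) \<inter> Y = {}" using insert.prems by blast
    hence "card (?S' u) = ?c"
      using insert.IH[of "X - {u}"] insert.prems X insert.hyps u by (simp add: card_Diff_singleton)
    thus ?thesis by (simp only: bij_betw_same_card[OF bij])
  qed
  have "?S = (\<Union>u\<in>X. {M \<in> ?S. {y, u} \<in> M})"
  proof (intro equalityI subsetI)
    fix M assume M: "M \<in> ?S"
    then obtain u where "{y, u} \<in> M" "u \<in> X \<union> insert y Y"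
      using matching_partner[of "X \<union> insert y Y" M y] by blast
    moreover from this have "u \<in> X" using M by auto
    ultimately show "M \<in> (\<Union>u\<in>X. {M \<in> ?S. {y, u} \<in> M})" using M by blast
  qed blast
  moreover have "card (\<Union>u\<in>X. {M \<in> ?S. {y, u} \<in> M}) = card X * ?c"
  proof (rule card_UN_const)
    show "finite {M \<in> ?S. {y, u} \<in> M}" for u
    proof -
      have "finite (X \<union> insert y Y)" using insert by simp
      from finite_matchings[OF this] show ?thesis by (rule rev_finite_subset) blast
    qed
    fix u v :: 'a assume "u \<noteq> v"
    hence "\<not> ({y, u} \<in> M \<and> {y, v} \<in> M)" if "M \<in> ?S" for M
      using that matching_eq_pair[of "X \<union> insert y Y" M y u v] by auto
    thus "{M \<in> ?S. {y, u} \<in> M} \<inter> {M \<in> ?S. {y, v} \<in> M} = {}" by blast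
  next
    show "finite X" by fact
    show "card {M \<in> ?S. {y, u} \<in> M} = ?c" if "u \<in> X" for u using S'_card[OF that] .
  qed
  ultimately have "card ?S = card X * ?c" by (simp only:)
  hence "card ?S = Suc ?l * ?c" using X by simp
  \<comment> \<open>Regrouped for the absorption identity
    \<open>Suc l * (l choose k) = Suc k * (Suc l choose Suc k)\<close>.\<close>
  also have "\<dots> = (Suc ?l * (?l choose ?k)) * (fact ?k * dfact (int ?l - int ?k - 1))"
    by (simp only: mult_ac)
  also have "\<dots> = fact (Suc ?k) * (Suc ?l choose Suc ?k) * dfact (int ?l - int ?k - 1)"
    by (simp only: Suc_times_binomial_eq fact_Suc of_nat_id mult_ac)
  finally have "card ?S = fact (Suc ?k) * (Suc ?l choose Suc ?k) * dfact (int ?l - int ?k - 1)" .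
  moreover have "card X = Suc ?l" "card (insert y Y) = Suc ?k" using X insert.hyps by simp_all
  moreover have "int (Suc ?l) - int (Suc ?k) - 1 = int ?l - int ?k - 1" by simp
  ultimately show ?case by metis
qed

section \<open>Products of Brauer partitions\<close>

definition pts :: "nat \<Rightarrow> nat \<Rightarrow> vertex set" where
  "pts m n = Up ` {1..m} \<union> Lo ` {1..n}"

lemma finite_pts [simp]: "finite (pts m n)"
  by (simp add: pts_def)

lemma card_pts: "card (pts m n) = m + n"
  unfolding pts_def
  by (subst card_Un_disjoint) (auto simp: card_image inj_on_def)

lemma brauer_iff: "\<alpha> \<in> brauer m n \<longleftrightarrow> matching (pts m n) \<alpha>"
  by (simp add: brauer_def matching_def pts_def)

lemma brauerD: "\<alpha> \<in> brauer m n \<Longrightarrow> matching (pts m n) \<alpha>"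
  by (simp add: brauer_iff)

lemma brauer_finite: "\<alpha> \<in> brauer m n \<Longrightarrow> finite \<alpha>"
  by (meson brauerD finite_pts matching_finite)

lemma finite_brauer: "finite (brauer m n)"
proof -
  have "brauer m n = {M. matching (pts m n) M}" using brauer_iff by blast
  thus ?thesis using finite_matchings[OF finite_pts, of m n] by simp
qed

definition mid_lower :: "brauer_partition \<Rightarrow> brauer_partition" where
  "mid_lower \<alpha> = (`) lower_to_mid ` \<alpha>"

definition mid_upper :: "brauer_partition \<Rightarrow> brauer_partition" where
  "mid_upper \<alpha> = (`) upper_to_mid ` \<alpha>"

lemma image_lower_pts: "lower_to_mid ` pts m n = Up ` {1..m} \<union> Mid ` {1..n}"
  by (simp add: pts_def image_Un image_image)

lemma image_upper_pts: "upper_to_mid ` pts m n = Mid ` {1..m} \<union> Lo ` {1..n}"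
  by (simp add: pts_def image_Un image_image)

lemma inj_on_lower: "inj_on lower_to_mid (pts m n)"
  by (auto simp: inj_on_def pts_def)

lemma inj_on_upper: "inj_on upper_to_mid (pts m n)"
  by (auto simp: inj_on_def pts_def)

lemma matching_mid_lower:
  "\<alpha> \<in> brauer m n \<Longrightarrow> matching (Up ` {1..m} \<union> Mid ` {1..n}) (mid_lower \<alpha>)"
  using matching_image[OF brauerD inj_on_lower, of \<alpha> m n]
  by (simp add: mid_lower_def image_lower_pts)

lemma matching_mid_upper:
  "\<alpha> \<in> brauer m n \<Longrightarrow> matching (Mid ` {1..m} \<union> Lo ` {1..n}) (mid_upper \<alpha>)"
  using matching_image[OF brauerD inj_on_upper, of \<alpha> m n]
  by (simp add: mid_upper_def image_upper_pts)

lemma finite_mid_lower: "\<alpha> \<in> brauer m n \<Longrightarrow> finite (mid_lower \<alpha>)"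
  by (simp add: mid_lower_def brauer_finite)

lemma sym_diff_mid:
  "sym_diff (Up ` {1..m} \<union> Mid ` {1..n}) (Mid ` {1..n} \<union> Lo ` {1..k}) = pts m k"
  by (auto simp: pts_def)

text \<open>After the renamings the factors share precisely the doubly primed points, so discarding
  those is the same as taking the symmetric difference.\<close>

lemma bprod_eq_glue:
  assumes "\<alpha> \<in> brauer m n" "\<beta> \<in> brauer n k"
  shows "bprod \<alpha> \<beta> = glue (mid_lower \<alpha>) (mid_upper \<beta>)"
proof -
  note U = matching_Union[OF matching_mid_lower[OF assms(1)]]
    matching_Union[OF matching_mid_upper[OF assms(2)]]
  have "\<Union>(product_edges \<alpha> \<beta>) - range Mid = sym_diff (\<Union>(mid_lower \<alpha>)) (\<Union>(mid_upper \<beta>))"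
    unfolding U product_edges_def Union_Un_distrib mid_lower_def[symmetric] mid_upper_def[symmetric]
    by auto
  moreover have "product_connected \<alpha> \<beta> = conn (mid_lower \<alpha> \<union> mid_upper \<beta>)"
    by (simp add: product_connected_def conn_def link_def product_edges_def
        mid_lower_def mid_upper_def)
  ultimately show ?thesis by (simp add: bprod_def glue_def)
qed

lemma bprod_closed [intro, simp]:
  assumes "\<alpha> \<in> brauer m n" "\<beta> \<in> brauer n k"
  shows "bprod \<alpha> \<beta> \<in> brauer m k"
  unfolding brauer_iff bprod_eq_glue[OF assms]
  using matching_glue[OF matching_mid_lower[OF assms(1)] finite_mid_lower[OF assms(1)]
    matching_mid_upper[OF assms(2)]]
  by (simp only: sym_diff_mid)

lemma conn_mid_lower:
  "{u, v} \<in> \<alpha> \<Longrightarrow> (lower_to_mid u, lower_to_mid v) \<in> conn (mid_lower \<alpha> \<union> M)"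
  unfolding mid_lower_def by (rule conn_edge[of "lower_to_mid ` {u, v}"]) blast+

lemma conn_mid_upper:
  "{u, v} \<in> \<beta> \<Longrightarrow> (upper_to_mid u, upper_to_mid v) \<in> conn (M \<union> mid_upper \<beta>)"
  unfolding mid_upper_def by (rule conn_edge[of "upper_to_mid ` {u, v}"]) blast+

lemma bprod_eqI:
  assumes "\<alpha> \<in> brauer m n" "\<beta> \<in> brauer n k" "\<gamma> \<in> brauer m k"
    and "\<And>u v. {u, v} \<in> \<gamma> \<Longrightarrow> (u, v) \<in> conn (mid_lower \<alpha> \<union> mid_upper \<beta>)"
  shows "bprod \<alpha> \<beta> = \<gamma>"
  unfolding bprod_eq_glue[OF assms(1,2)]
  by (rule glue_eq_matchingI[OF matching_mid_lower[OF assms(1)] finite_mid_lower[OF assms(1)]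
    matching_mid_upper[OF assms(2)]])
    (use assms in \<open>auto simp only: sym_diff_mid brauer_iff\<close>)

text \<open>The triple products live on four rows of points; \<open>place i j \<alpha>\<close> is a copy of \<open>\<alpha>\<close>
  between the rows \<open>i\<close> and \<open>j\<close>.\<close>

primrec layer :: "nat \<Rightarrow> nat \<Rightarrow> nat \<Rightarrow> vertex \<Rightarrow> nat \<times> nat" where
  "layer i j k (Up x) = (i, x)"
| "layer i j k (Mid x) = (j, x)"
| "layer i j k (Lo x) = (k, x)"

definition place :: "nat \<Rightarrow> nat \<Rightarrow> brauer_partition \<Rightarrow> (nat \<times> nat) set set" where
  "place i k \<alpha> = (`) (layer i k k) ` \<alpha>"

lemma layer_pts: "layer i j k ` pts m n = {i} \<times> {1..m} \<union> {k} \<times> {1..n}"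
  by (auto simp: pts_def image_Un image_image)

lemma inj_on_layer: "i \<noteq> k \<Longrightarrow> inj_on (layer i j k) (pts m n)"
  by (auto simp: inj_on_def pts_def)

lemma layer_cong: "u \<in> pts m n \<Longrightarrow> layer i j k u = layer i l k u"
  by (auto simp: pts_def)

text \<open>Brauer partitions contain no \<open>Mid\<close> points, so the row reserved for these
  can be chosen to suit a product graph.\<close>

lemma place_eq:
  assumes "\<alpha> \<in> brauer m n"
  shows "place i k \<alpha> = (`) (layer i j k) ` \<alpha>"
  unfolding place_def
  by (intro image_cong refl layer_cong) (use matching_subset[OF brauerD[OF assms]] in blast)

lemma matching_place:
  "\<alpha> \<in> brauer m n \<Longrightarrow> i \<noteq> k \<Longrightarrow> matching ({i} \<times> {1..m} \<union> {k} \<times> {1..n}) (place i k \<alpha>)"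
  using matching_image[OF brauerD inj_on_layer, of \<alpha> m n i k k]
  by (simp add: place_def layer_pts)

text \<open>The middle points of the product graph go to row \<open>i\<close>. Distinct rows make
  this an injective renaming, under which gluing is invariant.\<close>

lemma place_bprod:
  assumes "\<alpha> \<in> brauer m n" "\<beta> \<in> brauer n k" "h \<noteq> i" "i \<noteq> j" "h \<noteq> j"
  shows "place h j (bprod \<alpha> \<beta>) = glue (place h i \<alpha>) (place i j \<beta>)"
proof -
  let ?f = "layer h i j"
  have "inj_on ?f ((Up ` {1..m} \<union> Mid ` {1..n}) \<union> (Mid ` {1..n} \<union> Lo ` {1..k}))"
    using assms(3-5) by (auto simp: inj_on_def)
  hence "glue ((`) ?f ` mid_lower \<alpha>) ((`) ?f ` mid_upper \<beta>) = (`) ?f ` bprod \<alpha> \<beta>"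
    unfolding bprod_eq_glue[OF assms(1,2)]
    by (rule glue_image[OF matching_mid_lower[OF assms(1)] finite_mid_lower[OF assms(1)]
      matching_mid_upper[OF assms(2)]])
  moreover have "?f (lower_to_mid u) = layer h i i u" "?f (upper_to_mid u) = layer i i j u" for u
    by (cases u; simp)+
  ultimately show ?thesis
    using place_eq[OF bprod_closed[OF assms(1,2)], of h j i] place_eq[OF assms(1), of h i i]
      place_eq[OF assms(2), of i j i]
    by (simp add: mid_lower_def mid_upper_def image_image)
qed

lemma place_inject:
  assumes "place i k \<alpha> = place i k \<beta>" "\<alpha> \<in> brauer m n" "\<beta> \<in> brauer m n" "i \<noteq> k"
  shows "\<alpha> = \<beta>"
proof -
  have "inj_on ((`) (layer i k k)) (Pow (pts m n))"
    by (rule inj_on_image_Pow[OF inj_on_layer[OF assms(4)]])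
  moreover have "\<alpha> \<subseteq> Pow (pts m n)" "\<beta> \<subseteq> Pow (pts m n)"
    using matching_subset[OF brauerD] assms(2,3) by blast+
  ultimately show ?thesis
    using assms(1) unfolding place_def by (metis inj_on_image_eq_iff)
qed

text \<open>On four rows the consecutive copies overlap in one row each, and these rows differ, so
  no point lies in all three copies and gluing is associative.\<close>

lemma bprod_assoc:
  assumes "\<alpha> \<in> brauer k l" "\<beta> \<in> brauer l m" "\<gamma> \<in> brauer m n"
  shows "bprod (bprod \<alpha> \<beta>) \<gamma> = bprod \<alpha> (bprod \<beta> \<gamma>)"
proof (rule place_inject[of 0 3])
  have "glue (glue (place 0 1 \<alpha>) (place 1 2 \<beta>)) (place 2 3 \<gamma>)
      = glue (place 0 1 \<alpha>) (glue (place 1 2 \<beta>) (place 2 3 \<gamma>))"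
    using assms[THEN matching_place, of 0 1] assms[THEN matching_place, of 1 2]
      assms[THEN matching_place, of 2 3]
    by (intro glue_assoc) (auto simp: matching_Union)
  thus "place 0 3 (bprod (bprod \<alpha> \<beta>) \<gamma>) = place 0 3 (bprod \<alpha> (bprod \<beta> \<gamma>))"
    using place_bprod[OF bprod_closed[OF assms(1,2)] assms(3), of 0 2 3]
      place_bprod[OF assms(1) bprod_closed[OF assms(2,3)], of 0 1 3]
      place_bprod[OF assms(1,2), of 0 1 2] place_bprod[OF assms(2,3), of 1 2 3]
    by simp
qed (use assms in auto)

section \<open>Identity, involution and the law that the star of an element is a generalised
  inverse\<close>

definition bid :: "nat \<Rightarrow> brauer_partition" where
  "bid n = (\<lambda>i. {Up i, Lo i}) ` {1..n}"

lemma bid_closed [simp]: "bid n \<in> brauer n n"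
  unfolding brauer_iff by (rule matchingI) (auto simp: bid_def pts_def)

lemma bprod_bid_left [simp]:
  assumes "\<alpha> \<in> brauer m n"
  shows "bprod (bid m) \<alpha> = \<alpha>"
proof (rule bprod_eqI[OF bid_closed assms assms])
  let ?C = "conn (mid_lower (bid m) \<union> mid_upper \<alpha>)"
  fix u v assume uv: "{u, v} \<in> \<alpha>"
  have "(w, upper_to_mid w) \<in> ?C" if "w \<in> pts m n" for w
    using that conn_mid_lower[of "Up i" "Lo i" "bid m" for i]
    by (auto simp: pts_def bid_def)
  thus "(u, v) \<in> ?C"
    using conn_mid_upper[OF uv] matching_subset[OF brauerD[OF assms] uv]
    by (meson conn_sym conn_trans insert_subset)
qed

lemma flip_flip [simp]: "flip_vertex (flip_vertex u) = u"
  by (cases u) auto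

lemma inj_on_flip: "inj_on flip_vertex S"
  by (metis flip_flip inj_onI)

lemma bstar_bstar [simp]: "bstar (bstar \<alpha>) = \<alpha>"
  by (simp add: bstar_def image_image)

lemma flip_pts: "flip_vertex ` pts m n = pts n m"
  by (auto simp: pts_def image_Un image_image)

lemma bstar_closed [intro, simp]: "\<alpha> \<in> brauer m n \<Longrightarrow> bstar \<alpha> \<in> brauer n m"
  using matching_image[OF brauerD inj_on_flip, of \<alpha> m n]
  by (simp add: brauer_iff bstar_def flip_pts)

lemma bstar_bid [simp]: "bstar (bid n) = bid n"
  by (simp add: bstar_def bid_def image_image insert_commute)

lemma bstar_bprod:
  assumes "\<alpha> \<in> brauer m n" "\<beta> \<in> brauer n k"
  shows "bstar (bprod \<alpha> \<beta>) = bprod (bstar \<beta>) (bstar \<alpha>)"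
proof -
  have "flip_vertex (lower_to_mid u) = upper_to_mid (flip_vertex u)"
    "flip_vertex (upper_to_mid u) = lower_to_mid (flip_vertex u)" for u
    by (cases u; simp)+
  hence *: "(`) flip_vertex ` mid_lower \<alpha> = mid_upper (bstar \<alpha>)"
    "(`) flip_vertex ` mid_upper \<beta> = mid_lower (bstar \<beta>)"
    by (simp_all add: mid_lower_def mid_upper_def bstar_def image_image)
  have "bstar (bprod \<alpha> \<beta>) = (`) flip_vertex ` glue (mid_lower \<alpha>) (mid_upper \<beta>)"
    by (simp only: bstar_def bprod_eq_glue[OF assms])
  also have "\<dots> = glue ((`) flip_vertex ` mid_lower \<alpha>) ((`) flip_vertex ` mid_upper \<beta>)"
    by (rule glue_image[OF matching_mid_lower[OF assms(1)] finite_mid_lower[OF assms(1)]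
      matching_mid_upper[OF assms(2)] inj_on_flip, symmetric])
  also have "\<dots> = glue (mid_lower (bstar \<beta>)) (mid_upper (bstar \<alpha>))"
    unfolding * by (rule glue_commute)
  also have "\<dots> = bprod (bstar \<beta>) (bstar \<alpha>)"
    by (rule bprod_eq_glue[OF bstar_closed[OF assms(2)] bstar_closed[OF assms(1)], symmetric])
  finally show ?thesis .
qed

lemma bprod_bid_right [simp]:
  assumes "\<alpha> \<in> brauer m n"
  shows "bprod \<alpha> (bid n) = \<alpha>"
  using bstar_bprod[OF assms bid_closed] bprod_bid_left[OF bstar_closed[OF assms]]
  by (metis bstar_bid bstar_bstar)

lemma conn_place:
  "{u, v} \<in> \<alpha> \<Longrightarrow> place i k \<alpha> \<subseteq> M \<Longrightarrow> (layer i k k u, layer i k k v) \<in> conn M"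
  unfolding place_def by (rule conn_edge[of "layer i k k ` {u, v}"]) blast+

text \<open>A block in the upper row lives in the first copy, one in the lower row in the last; a
  transversal is recovered by walking down, back up and down again through the three copies.\<close>

lemma bprod_bstar_bprod:
  assumes "\<alpha> \<in> brauer m n"
  shows "bprod (bprod \<alpha> (bstar \<alpha>)) \<alpha> = \<alpha>"
proof (rule place_inject[of 0 3])
  note \<alpha>' = bstar_closed[OF assms]
  let ?M = "place 0 1 \<alpha> \<union> place 1 2 (bstar \<alpha>) \<union> place 2 3 \<alpha>"
  \<comment> \<open>Each block yields an edge in each of the three copies. The middle copy is
    reflected, so there the upper point sits in row 2 and the lower one in row 1.\<close>
  have c: "(layer 0 1 1 u, layer 0 1 1 v) \<in> conn ?M"
    "(layer 2 1 1 u, layer 2 1 1 v) \<in> conn ?M"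
    "(layer 2 3 3 u, layer 2 3 3 v) \<in> conn ?M" if "{u, v} \<in> \<alpha>" for u v
  proof -
    show "(layer 0 1 1 u, layer 0 1 1 v) \<in> conn ?M"
      by (rule conn_place[OF that]) blast
    show "(layer 2 3 3 u, layer 2 3 3 v) \<in> conn ?M"
      by (rule conn_place[OF that]) blast
    have "{flip_vertex u, flip_vertex v} \<in> bstar \<alpha>"
      using imageI[OF that, of "(`) flip_vertex"] by (simp add: bstar_def)
    hence "(layer 1 2 2 (flip_vertex u), layer 1 2 2 (flip_vertex v)) \<in> conn ?M"
      by (rule conn_place) blast
    moreover have "layer 1 2 2 (flip_vertex w) = layer 2 1 1 w" if "w \<in> pts m n" for w
      using that by (auto simp: pts_def)
    moreover have "u \<in> pts m n" "v \<in> pts m n"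
      using matching_subset[OF brauerD[OF assms] that] by auto
    ultimately show "(layer 2 1 1 u, layer 2 1 1 v) \<in> conn ?M" by simp
  qed
  have zigzag: "(a, b) \<in> conn ?M \<Longrightarrow> (c, b) \<in> conn ?M \<Longrightarrow> (c, d) \<in> conn ?M \<Longrightarrow> (a, d) \<in> conn ?M"
    "(b, a) \<in> conn ?M \<Longrightarrow> (b, c) \<in> conn ?M \<Longrightarrow> (d, c) \<in> conn ?M \<Longrightarrow> (d, a) \<in> conn ?M"
    for a b c d
    by (meson conn_sym conn_trans)+
  have "place 0 3 (bprod (bprod \<alpha> (bstar \<alpha>)) \<alpha>)
      = glue (glue (place 0 1 \<alpha>) (place 1 2 (bstar \<alpha>))) (place 2 3 \<alpha>)"
    using assms \<alpha>' by (simp add: place_bprod[of _ m n _ n 0 2 3] place_bprod[of _ m n _ m 0 1 2]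
      place_bprod[of _ m m _ n 0 2 3])
  also have "\<dots> = place 0 3 \<alpha>"
  proof (rule glue_glue_eq_matchingI[OF matching_place[OF assms] _ matching_place[OF \<alpha>'] _
      matching_place[OF assms]])
    have "sym_diff (sym_diff ({0} \<times> {1..m} \<union> {1} \<times> {1..n}) ({1} \<times> {1..n} \<union> {2} \<times> {1..m}))
        ({2} \<times> {1..m} \<union> {3} \<times> {1..n}) = {0} \<times> {1..m} \<union> {3::nat} \<times> {1..n}"
      by auto
    thus "matching (sym_diff (sym_diff ({0} \<times> {1..m} \<union> {1} \<times> {1..n})
        ({1} \<times> {1..n} \<union> {2} \<times> {1..m})) ({2} \<times> {1..m} \<union> {3} \<times> {1..n})) (place 0 3 \<alpha>)"
      using matching_place[OF assms, of 0 3] by simp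
    fix x y assume "{x, y} \<in> place 0 3 \<alpha>"
    then obtain e where e: "e \<in> \<alpha>" "{x, y} = layer 0 3 3 ` e" by (auto simp: place_def)
    then obtain u v where uv: "e = {u, v}" "u \<in> pts m n" "v \<in> pts m n"
      using matchingE[OF brauerD[OF assms]] by metis
    have step: "(layer 0 3 3 u, layer 0 3 3 v) \<in> conn ?M" if "{u, v} \<in> \<alpha>" for u v
    proof -
      have "u \<in> pts m n" "v \<in> pts m n"
        using matching_subset[OF brauerD[OF assms] that] by auto
      then consider (UU) i j where "u = Up i" "v = Up j" | (UL) i j where "u = Up i" "v = Lo j"
        | (LU) i j where "u = Lo i" "v = Up j" | (LL) i j where "u = Lo i" "v = Lo j"
        unfolding pts_def by blast
      thus ?thesis
      proof cases
        case UU thus ?thesis using c(1)[OF that] by simp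
      next
        case UL
        note c = c[OF that, unfolded UL layer.simps]
        show ?thesis unfolding UL layer.simps by (rule zigzag(1)[OF c])
      next
        case LU
        note c = c[OF that, unfolded LU layer.simps]
        show ?thesis unfolding LU layer.simps by (rule zigzag(2)[OF c])
      next
        case LL thus ?thesis using c(3)[OF that] by simp
      qed
    qed
    from e uv have "x = layer 0 3 3 u \<and> y = layer 0 3 3 v \<or> x = layer 0 3 3 v \<and> y = layer 0 3 3 u"
      by (auto simp: doubleton_eq_iff)
    thus "(x, y) \<in> conn ?M"
      using step[of u v] conn_sym[OF step[of u v]] e uv by auto
  qed auto
  finally show "place 0 3 (bprod (bprod \<alpha> (bstar \<alpha>)) \<alpha>) = place 0 3 \<alpha>" .
qed (use assms in auto)

section \<open>Isometries\<close>

lemma bprod_memI: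
  assumes "\<alpha> \<in> brauer m n" "\<beta> \<in> brauer n k" "u \<in> pts m k" "v \<in> pts m k" "u \<noteq> v"
    and "(u, v) \<in> conn (mid_lower \<alpha> \<union> mid_upper \<beta>)"
  shows "{u, v} \<in> bprod \<alpha> \<beta>"
proof -
  have "(u, v) \<in> link (bprod \<alpha> \<beta>)"
    unfolding bprod_eq_glue[OF assms(1,2)] link_glue
      matching_Union[OF matching_mid_lower[OF assms(1)]]
      matching_Union[OF matching_mid_upper[OF assms(2)]] sym_diff_mid
    using assms by simp
  then obtain h where h: "h \<in> bprod \<alpha> \<beta>" "u \<in> h" "v \<in> h" by (auto simp: link_def)
  hence "card h = 2"
    using brauerD[OF bprod_closed[OF assms(1,2)]] by (auto simp: matching_def)
  hence "h = {u, v}" using h assms(5) by (auto simp: card_2_iff)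
  thus ?thesis using h by simp
qed

text \<open>The left invertible elements, \<open>bstar a\<close> always being available as left
  inverse. In diagrams: no block lies in the lower row, so every lower point is on a
  transversal.\<close>

definition isometries :: "nat \<Rightarrow> nat \<Rightarrow> brauer_partition set" where
  "isometries k q = {a \<in> brauer k q. bprod (bstar a) a = bid q}"

lemma isometriesD:
  assumes "a \<in> isometries k q"
  shows "a \<in> brauer k q" "bprod (bstar a) a = bid q"
  using assms by (auto simp: isometries_def)

text \<open>From \<open>a (bstar a) a = a\<close>, any left inverse \<open>x\<close> gives
  \<open>(bstar a) a = x a (bstar a) a = x a\<close>.\<close>

lemma isometriesI:
  assumes "x \<in> brauer q k" "a \<in> brauer k q" "bprod x a = bid q"
  shows "a \<in> isometries k q"
proof -
  have s: "bprod (bstar a) a \<in> brauer q q"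
    by (rule bprod_closed[OF bstar_closed[OF assms(2)] assms(2)])
  have "bprod (bstar a) a = bprod (bprod x a) (bprod (bstar a) a)"
    using assms(3) s by simp
  also have "\<dots> = bprod x (bprod a (bprod (bstar a) a))"
    by (rule bprod_assoc[OF assms(1,2) s])
  also have "bprod a (bprod (bstar a) a) = a"
    using bprod_assoc[OF assms(2) bstar_closed[OF assms(2)] assms(2)]
      bprod_bstar_bprod[OF assms(2)] by simp
  finally show ?thesis using assms by (simp add: isometries_def)
qed

lemma isometry_block:
  assumes "a \<in> brauer k q" "\<And>e. e \<in> a \<Longrightarrow> \<not> e \<subseteq> Lo ` {1..q}" "i \<in> {1..q}"
  obtains j where "j \<in> {1..k}" "{Up j, Lo i} \<in> a"
proof -
  have "Lo i \<in> pts k q" using assms(3) by (simp add: pts_def)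
  then obtain w where w: "{Lo i, w} \<in> a" "w \<in> pts k q"
    using matching_partner[OF brauerD[OF assms(1)]] by metis
  hence "w \<notin> Lo ` {1..q}" using assms(2)[OF w(1)] assms(3) by blast
  then obtain j where "w = Up j" "j \<in> {1..k}" using w(2) by (auto simp: pts_def)
  thus thesis using that w by (simp add: insert_commute)
qed

text \<open>A block in the lower row of \<open>a\<close> would survive in the product, while all
  blocks of the identity are transversals. Conversely each lower point \<open>i\<close> is joined to
  some upper point \<open>j\<close>, and the path through \<open>Mid j\<close> connects
  \<open>Up i\<close> with \<open>Lo i\<close>.\<close>

lemma isometries_iff:
  assumes a: "a \<in> brauer k q"
  shows "a \<in> isometries k q \<longleftrightarrow> (\<forall>e\<in>a. \<not> e \<subseteq> Lo ` {1..q})"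
proof
  assume "a \<in> isometries k q"
  hence 1: "bprod (bstar a) a = bid q" by (rule isometriesD)
  show "\<forall>e\<in>a. \<not> e \<subseteq> Lo ` {1..q}"
  proof (intro ballI notI)
    fix e assume e: "e \<in> a" "e \<subseteq> Lo ` {1..q}"
    obtain u v where uv: "e = {u, v}" "u \<noteq> v" by (rule matchingE[OF brauerD[OF a] e(1)])
    then obtain i j where ij: "u = Lo i" "v = Lo j" "i \<in> {1..q}" "j \<in> {1..q}" using e(2) by blast
    have "(Lo i, Lo j) \<in> conn (mid_lower (bstar a) \<union> mid_upper a)"
      using conn_mid_upper[of u v a] e(1) uv ij by simp
    hence "{Lo i, Lo j} \<in> bid q"
      unfolding 1[symmetric]
      by (intro bprod_memI[OF bstar_closed[OF a] a]) (use uv ij in \<open>auto simp: pts_def\<close>)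
    thus False by (auto simp: bid_def doubleton_eq_iff)
  qed
next
  assume *: "\<forall>e\<in>a. \<not> e \<subseteq> Lo ` {1..q}"
  have "bprod (bstar a) a = bid q"
  proof (rule bprod_eqI[OF bstar_closed[OF a] a bid_closed])
    let ?M = "mid_lower (bstar a) \<union> mid_upper a"
    fix u v assume "{u, v} \<in> bid q"
    then obtain i where i: "i \<in> {1..q}" "{u, v} = {Up i, Lo i}" by (auto simp: bid_def)
    obtain j where j: "{Up j, Lo i} \<in> a" using isometry_block[OF a _ i(1)] * by metis
    have "{Lo j, Up i} \<in> bstar a"
      using imageI[OF j, of "(`) flip_vertex"] by (simp add: bstar_def)
    from conn_sym[OF conn_mid_lower[OF this]] conn_mid_upper[OF j]
    have "(Up i, Mid j) \<in> conn ?M" "(Mid j, Lo i) \<in> conn ?M" by simp_all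
    hence "(Up i, Lo i) \<in> conn ?M" by (rule conn_trans)
    thus "(u, v) \<in> conn ?M" using i(2) by (auto simp: doubleton_eq_iff dest: conn_sym)
  qed
  thus "a \<in> isometries k q" using a by (simp add: isometries_def)
qed

lemma isometries_partner:
  assumes "a \<in> isometries k q"
  obtains f where "f ` {1..q} \<subseteq> {1..k}" "inj_on f {1..q}" "\<And>i. i \<in> {1..q} \<Longrightarrow> {Up (f i), Lo i} \<in> a"
proof -
  note a = isometriesD(1)[OF assms]
  have "\<forall>i\<in>{1..q}. \<exists>j. j \<in> {1..k} \<and> {Up j, Lo i} \<in> a"
    using isometry_block[OF a] assms isometries_iff[OF a] by metis
  then obtain f where f: "\<And>i. i \<in> {1..q} \<Longrightarrow> f i \<in> {1..k} \<and> {Up (f i), Lo i} \<in> a"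
    by (metis bchoice)
  have "inj_on f {1..q}"
  proof (rule inj_onI)
    fix i j assume "i \<in> {1..q}" "j \<in> {1..q}" "f i = f j"
    hence "{Up (f i), Lo i} \<in> a" "{Up (f i), Lo j} \<in> a" using f by metis+
    from matching_eq_pair[OF brauerD[OF a] this] show "i = j" by simp
  qed
  thus thesis using that f by blast
qed

lemma isometries_le: "a \<in> isometries k q \<Longrightarrow> q \<le> k"
  by (elim isometries_partner) (metis card_inj_on_le card_atLeastAtMost diff_Suc_1 finite_atLeastAtMost)

lemma card_isometries:
  assumes "q \<le> k" "even (k + q)"
  shows "card (isometries k q) = fact q * (k choose q) * dfact (int k - int q - 1)"
proof -
  have "isometries k q = {M. matching (Up ` {1..k} \<union> Lo ` {1..q}) M \<and> (\<forall>e\<in>M. \<not> e \<subseteq> Lo ` {1..q})}"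
    using isometries_iff isometriesD(1) unfolding brauer_iff pts_def by blast
  moreover have "card (Up ` {1..k}) = k" "card (Lo ` {1..q}) = q"
    by (simp_all add: card_image inj_on_def)
  moreover have "(Up ` {1..k}) \<inter> (Lo ` {1..q}) = {}" by blast
  ultimately show ?thesis
    using card_matchings_avoiding[of "Lo ` {1..q}" "Up ` {1..k}"] assms by simp
qed

text \<open>The hypothesis says that no block of \<open>\<rho>\<close> lies in its upper row, so
  after renaming each block meets the middle row, as the fibre count for gluing requires. The
  unknown factor has \<open>m + q\<close> points and the product \<open>r + q\<close>, whence the
  two double factorials.\<close>

lemma card_bprod_fibre:
  assumes \<rho>: "bstar \<rho> \<in> isometries m r" and b: "b \<in> brauer r q"
  shows "card {z \<in> brauer m q. bprod \<rho> z = b} * dfact (int r + int q - 1)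
    = dfact (int m + int q - 1)"
proof -
  have \<rho>': "\<rho> \<in> brauer r m" using bstar_closed[OF isometriesD(1)[OF \<rho>]] by simp
  let ?B = "Mid ` {1..m} \<union> Lo ` {1..q}"
  let ?F = "{N. matching ?B N \<and> glue (mid_lower \<rho>) N = b}"
  have cB: "card ?B = m + q"
    by (subst card_Un_disjoint) (auto simp: card_image inj_on_def)
  have "card ?F * dfact (int (card (sym_diff (Up ` {1..r} \<union> Mid ` {1..m}) ?B)) - 1)
      = dfact (int (card ?B) - 1)"
  proof (rule card_glue_fibre[OF matching_mid_lower[OF \<rho>'] finite_mid_lower[OF \<rho>']])
    show "matching (sym_diff (Up ` {1..r} \<union> Mid ` {1..m}) ?B) b"
      unfolding sym_diff_mid using brauerD[OF b] .
    fix e assume "e \<in> mid_lower \<rho>"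
    then obtain d where d: "d \<in> \<rho>" "e = lower_to_mid ` d" by (auto simp: mid_lower_def)
    have "flip_vertex ` d \<in> bstar \<rho>" using d(1) by (simp add: bstar_def)
    hence nd: "\<not> flip_vertex ` d \<subseteq> Lo ` {1..r}"
      using \<rho> isometries_iff[OF isometriesD(1)[OF \<rho>]] by blast
    have dp: "d \<subseteq> pts r m" by (rule matching_subset[OF brauerD[OF \<rho>'] d(1)])
    obtain u where u: "u \<in> d" "flip_vertex u \<notin> Lo ` {1..r}" using nd by blast
    then obtain j where "u = Lo j" "j \<in> {1..m}" using dp by (auto simp: pts_def)
    hence "Mid j \<in> e \<inter> ?B" using u d by force
    thus "e \<inter> ?B \<noteq> {}" by blast
  qed simp
  moreover have "bij_betw mid_upper {z \<in> brauer m q. bprod \<rho> z = b} ?F"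
  proof (rule bij_betwI')
    fix y z assume yz: "y \<in> {z \<in> brauer m q. bprod \<rho> z = b}" "z \<in> {z \<in> brauer m q. bprod \<rho> z = b}"
    have "inj_on ((`) upper_to_mid) (Pow (pts m q))"
      by (rule inj_on_image_Pow[OF inj_on_upper])
    moreover have "y \<subseteq> Pow (pts m q)" "z \<subseteq> Pow (pts m q)"
      using yz matching_subset[OF brauerD] by blast+
    ultimately show "mid_upper y = mid_upper z \<longleftrightarrow> y = z"
      unfolding mid_upper_def by (metis inj_on_image_eq_iff)
  next
    fix z assume "z \<in> {z \<in> brauer m q. bprod \<rho> z = b}"
    thus "mid_upper z \<in> ?F"
      using matching_mid_upper bprod_eq_glue[OF \<rho>'] by auto
  next
    fix N assume N: "N \<in> ?F"
    \<comment> \<open>\<open>g\<close> undoes \<open>upper_to_mid\<close> on \<open>?B\<close>, so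
      that a factor is recovered from a matching of the renamed points.\<close>
    define g where "g = (\<lambda>v. case v of Mid i \<Rightarrow> Up i | Lo i \<Rightarrow> Lo i | Up i \<Rightarrow> Mid i)"
    have gB: "g ` ?B = pts m q" by (auto simp: g_def pts_def image_Un image_image)
    have "inj_on g ?B" by (auto simp: g_def inj_on_def)
    hence z: "(`) g ` N \<in> brauer m q"
      using matching_image[of ?B N g, unfolded gB] N unfolding brauer_iff by blast
    have ug: "upper_to_mid (g v) = v" if "v \<in> ?B" for v using that by (auto simp: g_def)
    have "upper_to_mid ` g ` e = e" if "e \<in> N" for e
    proof -
      have "e \<subseteq> ?B" using matching_subset[of ?B N e] N that by blast
      hence "(\<lambda>v. upper_to_mid (g v)) ` e = (\<lambda>v. v) ` e"
        by (intro image_cong refl ug) blast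
      thus ?thesis by (simp add: image_image)
    qed
    hence "(\<lambda>e. upper_to_mid ` g ` e) ` N = (\<lambda>e. e) ` N" by (intro image_cong refl)
    hence N_eq: "mid_upper ((`) g ` N) = N" by (simp add: mid_upper_def image_image)
    hence "bprod \<rho> ((`) g ` N) = b"
      using N bprod_eq_glue[OF \<rho>' z] by simp
    thus "\<exists>z\<in>{z \<in> brauer m q. bprod \<rho> z = b}. N = mid_upper z"
      using z N_eq by (intro bexI[of _ "(`) g ` N"]) simp_all
  qed
  ultimately show ?thesis
    unfolding sym_diff_mid card_pts cB by (simp add: bij_betw_same_card)
qed

text \<open>The lower point \<open>i\<close> is joined to the upper point \<open>\<pi> i\<close>,
  and not conversely, so that products correspond to \<open>\<pi> \<circ> \<rho>\<close> in this
  order, as in \<open>sym_group\<close>.\<close>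

definition perm_part :: "nat \<Rightarrow> (nat \<Rightarrow> nat) \<Rightarrow> brauer_partition" where
  "perm_part q \<pi> = (\<lambda>i. {Up (\<pi> i), Lo i}) ` {1..q}"

lemma perm_part_brauer:
  assumes "\<pi> permutes {1..q}"
  shows "perm_part q \<pi> \<in> brauer q q"
  unfolding brauer_iff
proof (rule matchingI)
  fix e assume "e \<in> perm_part q \<pi>"
  then obtain i where i: "i \<in> {1..q}" "e = {Up (\<pi> i), Lo i}" by (auto simp: perm_part_def)
  moreover have "\<pi> i \<in> {1..q}" using i assms by (metis permutes_in_image)
  ultimately show "\<exists>u v. e = {u, v} \<and> u \<noteq> v \<and> u \<in> pts q q \<and> v \<in> pts q q"
    by (intro exI[of _ "Up (\<pi> i)"] exI[of _ "Lo i"]) (simp add: pts_def)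
next
  fix u assume "u \<in> pts q q"
  then consider (Up) i where "u = Up i" "i \<in> {1..q}" | (Lo) i where "u = Lo i" "i \<in> {1..q}"
    by (auto simp: pts_def)
  thus "\<exists>e\<in>perm_part q \<pi>. u \<in> e"
  proof cases
    case Up
    then obtain j where "j \<in> {1..q}" "i = \<pi> j" using permutes_image[OF assms] by blast
    thus ?thesis using Up by (auto simp: perm_part_def)
  next
    case Lo thus ?thesis by (auto simp: perm_part_def)
  qed
next
  fix e e' u assume "e \<in> perm_part q \<pi>" "e' \<in> perm_part q \<pi>" "u \<in> e" "u \<in> e'"
  thus "e = e'" using permutes_inj[OF assms] by (auto simp: perm_part_def inj_eq)
qed

lemma perm_part_isometry:
  assumes "\<pi> permutes {1..q}"
  shows "perm_part q \<pi> \<in> isometries q q"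
  unfolding isometries_iff[OF perm_part_brauer[OF assms]] by (auto simp: perm_part_def)

lemma bprod_perm_part:
  assumes "\<pi> permutes {1..q}" "\<rho> permutes {1..q}"
  shows "bprod (perm_part q \<pi>) (perm_part q \<rho>) = perm_part q (\<pi> \<circ> \<rho>)"
proof (rule bprod_eqI[OF perm_part_brauer[OF assms(1)] perm_part_brauer[OF assms(2)]
    perm_part_brauer[OF permutes_compose[OF assms(2,1)]]])
  let ?M = "mid_lower (perm_part q \<pi>) \<union> mid_upper (perm_part q \<rho>)"
  fix u v assume "{u, v} \<in> perm_part q (\<pi> \<circ> \<rho>)"
  then obtain i where i: "i \<in> {1..q}" "{u, v} = {Up (\<pi> (\<rho> i)), Lo i}"
    by (auto simp: perm_part_def)
  have "{Up (\<rho> i), Lo i} \<in> perm_part q \<rho>" using i(1) by (auto simp: perm_part_def)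
  from conn_mid_upper[OF this] have 2: "(Mid (\<rho> i), Lo i) \<in> conn ?M" by simp
  have "\<rho> i \<in> {1..q}" using i(1) assms(2) by (metis permutes_in_image)
  hence "{Up (\<pi> (\<rho> i)), Lo (\<rho> i)} \<in> perm_part q \<pi>" unfolding perm_part_def by blast
  from conn_mid_lower[OF this] have "(Up (\<pi> (\<rho> i)), Mid (\<rho> i)) \<in> conn ?M" by simp
  from conn_trans[OF this 2] show "(u, v) \<in> conn ?M"
    using i(2) by (auto simp: doubleton_eq_iff dest: conn_sym)
qed

lemma perm_part_id: "perm_part q id = bid q"
  by (simp add: perm_part_def bid_def)

lemma bij_betw_perm_part: "bij_betw (perm_part q) {\<pi>. \<pi> permutes {1..q}} (isometries q q)"
proof (rule bij_betwI')
  fix \<pi> \<rho> assume *: "\<pi> \<in> {\<pi>. \<pi> permutes {1..q}}" "\<rho> \<in> {\<pi>. \<pi> permutes {1..q}}"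
  have "\<pi> i = \<rho> i" if "perm_part q \<pi> = perm_part q \<rho>" for i
  proof (cases "i \<in> {1..q}")
    case True
    hence "{Up (\<pi> i), Lo i} \<in> perm_part q \<rho>"
      unfolding that[symmetric] by (auto simp: perm_part_def)
    then obtain j where "{Up (\<pi> i), Lo i} = {Up (\<rho> j), Lo j}" unfolding perm_part_def by blast
    thus ?thesis by (auto simp: doubleton_eq_iff)
  next
    case False thus ?thesis using * by (simp add: permutes_def)
  qed
  thus "perm_part q \<pi> = perm_part q \<rho> \<longleftrightarrow> \<pi> = \<rho>" by blast
next
  fix \<pi> assume "\<pi> \<in> {\<pi>. \<pi> permutes {1..q}}"
  thus "perm_part q \<pi> \<in> isometries q q" using perm_part_isometry by blast
next
  fix g assume g: "g \<in> isometries q q"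
  obtain f where f: "f ` {1..q} \<subseteq> {1..q}" "inj_on f {1..q}"
      "\<And>i. i \<in> {1..q} \<Longrightarrow> {Up (f i), Lo i} \<in> g"
    using isometries_partner[OF g] by blast
  \<comment> \<open>\<open>f\<close> is controlled on \<open>{1..q}\<close> only; being the identity
    elsewhere is what \<open>permutes\<close> demands.\<close>
  define \<pi> where "\<pi> i = (if i \<in> {1..q} then f i else i)" for i
  have "bij_betw f {1..q} {1..q}"
    using f by (simp add: bij_betw_def endo_inj_surj)
  hence "bij_betw \<pi> {1..q} {1..q}"
    by (subst bij_betw_cong[of _ _ f]) (auto simp: \<pi>_def)
  hence \<pi>: "\<pi> permutes {1..q}"
    by (rule bij_imp_permutes) (auto simp: \<pi>_def)
  have "perm_part q \<pi> \<subseteq> g" using f(3) by (auto simp: perm_part_def \<pi>_def)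
  hence "perm_part q \<pi> = g"
    using brauerD[OF perm_part_brauer[OF \<pi>]] brauerD[OF isometriesD(1)[OF g]] matching_eqI by metis
  thus "\<exists>\<pi>\<in>{\<pi>. \<pi> permutes {1..q}}. g = perm_part q \<pi>" using \<pi> by blast
qed

lemma card_isometries_square: "card (isometries q q) = fact q"
  using bij_betw_same_card[OF bij_betw_perm_part, of q] card_permutations[of "{1..q}" q] by simp

lemma bid_isometry [simp]: "bid q \<in> isometries q q"
  by (simp add: isometries_def bprod_bid_left[OF bid_closed])

text \<open>Isometries with equally many upper and lower points are permutations, where a one-sided
  inverse is two-sided.\<close>

lemma isometry_square:
  assumes g: "g \<in> isometries q q"
  shows "bprod g (bstar g) = bid q" "bstar g \<in> isometries q q"
proof -
  note gB = isometriesD(1)[OF g] and gg = isometriesD(2)[OF g]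
  obtain \<pi> where \<pi>: "\<pi> permutes {1..q}" "g = perm_part q \<pi>"
    using g bij_betw_perm_part[of q] unfolding bij_betw_def by blast
  let ?h = "perm_part q (inv_into UNIV \<pi>)"
  have h: "?h \<in> brauer q q" by (rule perm_part_brauer[OF permutes_inv[OF \<pi>(1)]])
  have gh: "bprod g ?h = bid q"
    using bprod_perm_part[OF \<pi>(1) permutes_inv[OF \<pi>(1)]] \<pi>
    by (simp add: permutes_inv_o perm_part_id)
  have "bstar g = bprod (bstar g) (bprod g ?h)" using gh gB by (simp add: bprod_bid_right[of _ q q])
  also have "\<dots> = ?h" using bprod_assoc[OF bstar_closed[OF gB] gB h] gg h by simp
  finally show "bprod g (bstar g) = bid q" using gh by simp
  thus "bstar g \<in> isometries q q" using gB by (simp add: isometries_def)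
qed

section \<open>Factorisation through the rank\<close>

lemma flip_in_range [simp]: "flip_vertex u \<in> range Lo \<longleftrightarrow> u \<in> range Up"
  "flip_vertex u \<in> range Up \<longleftrightarrow> u \<in> range Lo"
  by (cases u; auto)+

lemma transversals_subset: "transversals \<alpha> \<subseteq> \<alpha>"
  by (auto simp: transversals_def)

lemma transversals_bstar: "transversals (bstar \<alpha>) = (`) flip_vertex ` transversals \<alpha>"
proof -
  have "flip_vertex ` A \<inter> range Up = flip_vertex ` (A \<inter> range Lo)"
    "flip_vertex ` A \<inter> range Lo = flip_vertex ` (A \<inter> range Up)" for A
    using flip_in_range by blast+
  hence "flip_vertex ` A \<inter> range Up \<noteq> {} \<longleftrightarrow> A \<inter> range Lo \<noteq> {}"
    "flip_vertex ` A \<inter> range Lo \<noteq> {} \<longleftrightarrow> A \<inter> range Up \<noteq> {}" for A by simp_all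
  moreover have "transversals (bstar \<alpha>) = (`) flip_vertex ` {A \<in> \<alpha>.
      flip_vertex ` A \<inter> range Up \<noteq> {} \<and> flip_vertex ` A \<inter> range Lo \<noteq> {}}"
    unfolding transversals_def bstar_def by blast
  ultimately show ?thesis by (simp add: transversals_def conj_commute)
qed

text \<open>The setting is closed under the involution, which swaps \<open>x\<close> with
  \<open>y\<close>. Whatever is shown for \<open>tau\<close> therefore holds for the other factor of
  \<open>\<sigma>\<close>, built from \<open>bstar \<sigma>\<close>.\<close>

locale transversal_enum =
  fixes n m r :: nat and \<sigma> :: brauer_partition and x y :: "nat \<Rightarrow> nat"
  assumes \<sigma>: "\<sigma> \<in> brauer n m"
    and enum: "bij_betw (\<lambda>i. {Up (x i), Lo (y i)}) {1..r} (transversals \<sigma>)"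
begin

lemma transversal: "i \<in> {1..r} \<Longrightarrow> {Up (x i), Lo (y i)} \<in> \<sigma>"
  using enum transversals_subset unfolding bij_betw_def by blast

lemma bounds: "i \<in> {1..r} \<Longrightarrow> x i \<in> {1..n}" "i \<in> {1..r} \<Longrightarrow> y i \<in> {1..m}"
  using matching_subset[OF brauerD[OF \<sigma>] transversal[of i]] by (auto simp: pts_def)

lemma x_inj: "i \<in> {1..r} \<Longrightarrow> j \<in> {1..r} \<Longrightarrow> x i = x j \<Longrightarrow> i = j"
proof -
  assume *: "i \<in> {1..r}" "j \<in> {1..r}" "x i = x j"
  have "{Up (x i), Lo (y i)} = {Up (x j), Lo (y j)}"
    by (rule matching_disjoint[OF brauerD[OF \<sigma>] transversal[OF *(1)] transversal[OF *(2)], of "Up (x i)"])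
      (simp_all add: *(3))
  thus "i = j" using bij_betw_imp_inj_on[OF enum] * by (metis (mono_tags, lifting) inj_onD)
qed

lemma upper_nontransversal_subset:
  "e \<in> upper_nontransversals \<sigma> \<Longrightarrow> e \<in> \<sigma>" "e \<in> upper_nontransversals \<sigma> \<Longrightarrow> e \<subseteq> Up ` {1..n}"
proof -
  show 1: "e \<in> \<sigma>" if "e \<in> upper_nontransversals \<sigma>" for e
    using that by (simp add: upper_nontransversals_def)
  assume e: "e \<in> upper_nontransversals \<sigma>"
  show "e \<subseteq> Up ` {1..n}"
  proof
    fix u assume "u \<in> e"
    hence "u \<in> pts n m" "u \<in> range Up"
      using matching_subset[OF brauerD[OF \<sigma>] 1[OF e]] e by (auto simp: upper_nontransversals_def)
    thus "u \<in> Up ` {1..n}" by (auto simp: pts_def)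
  qed
qed

lemma tau_cases:
  assumes "e \<in> tau r x \<sigma>"
  obtains i where "i \<in> {1..r}" "e = {Up i, Lo (x i)}"
  | d where "d \<in> upper_nontransversals \<sigma>" "e = flip_vertex ` d"
  using assms unfolding tau_def by blast

lemma tau_transversal: "i \<in> {1..r} \<Longrightarrow> {Up i, Lo (x i)} \<in> tau r x \<sigma>"
  unfolding tau_def by blast

lemma tau_nontransversal: "d \<in> upper_nontransversals \<sigma> \<Longrightarrow> flip_vertex ` d \<in> tau r x \<sigma>"
  unfolding tau_def by blast

lemma upper_cases:
  assumes "k \<in> {1..n}"
  obtains i where "i \<in> {1..r}" "k = x i" | d where "d \<in> upper_nontransversals \<sigma>" "Up k \<in> d"
proof -
  have "Up k \<in> pts n m" using assms by (simp add: pts_def)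
  then obtain e where e: "e \<in> \<sigma>" "Up k \<in> e" using matching_Union[OF brauerD[OF \<sigma>]] by blast
  show thesis
  proof (cases "e \<in> transversals \<sigma>")
    case True
    then obtain i where "i \<in> {1..r}" "e = {Up (x i), Lo (y i)}"
      using enum unfolding bij_betw_def by blast
    thus thesis using that(1) e by auto
  next
    case False
    have "e \<subseteq> range Up \<union> range Lo"
      using matching_subset[OF brauerD[OF \<sigma>] e(1)] unfolding pts_def by blast
    hence "e \<subseteq> range Up" using False e by (auto simp: transversals_def)
    thus thesis using that(2) e by (auto simp: upper_nontransversals_def)
  qed
qed

lemma tau_brauer: "tau r x \<sigma> \<in> brauer r n"
  unfolding brauer_iff
proof (rule matchingI)
  fix e assume "e \<in> tau r x \<sigma>"
  thus "\<exists>u v. e = {u, v} \<and> u \<noteq> v \<and> u \<in> pts r n \<and> v \<in> pts r n"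
  proof (cases rule: tau_cases)
    case (1 i)
    thus ?thesis using bounds(1)[OF 1(1)]
      by (intro exI[of _ "Up i"] exI[of _ "Lo (x i)"]) (simp add: pts_def)
  next
    case (2 d)
    obtain u v where uv: "d = {u, v}" "u \<noteq> v"
      by (rule matchingE[OF brauerD[OF \<sigma>] upper_nontransversal_subset(1)[OF 2(1)]])
    then obtain i j where "u = Up i" "v = Up j" "i \<in> {1..n}" "j \<in> {1..n}"
      using upper_nontransversal_subset(2)[OF 2(1)] by blast
    thus ?thesis using uv 2(2)
      by (intro exI[of _ "Lo i"] exI[of _ "Lo j"]) (simp add: pts_def)
  qed
next
  fix u assume "u \<in> pts r n"
  then consider (Up) i where "u = Up i" "i \<in> {1..r}" | (Lo) k where "u = Lo k" "k \<in> {1..n}"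
    by (auto simp: pts_def)
  thus "\<exists>e\<in>tau r x \<sigma>. u \<in> e"
  proof cases
    case Up thus ?thesis by (intro bexI[OF _ tau_transversal[of i]]) simp_all
  next
    case Lo
    show ?thesis using Lo(2)
    proof (cases rule: upper_cases)
      case (1 i) thus ?thesis using Lo(1) by (intro bexI[OF _ tau_transversal[of i]]) simp_all
    next
      case (2 d)
      hence "Lo k \<in> flip_vertex ` d" by (metis flip_vertex.simps(1) imageI)
      thus ?thesis using Lo(1) by (intro bexI[OF _ tau_nontransversal[OF 2(1)]]) simp_all
    qed
  qed
next
  \<comment> \<open>A transversal block and a copied upper block of \<open>\<sigma>\<close> could
    meet only in \<open>x i\<close>, but the block of \<open>\<sigma>\<close> at \<open>x i\<close>
    also contains the lower point \<open>y i\<close>.\<close>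
  have mixed: False if h: "i \<in> {1..r}" "d \<in> upper_nontransversals \<sigma>"
    "u \<in> {Up i, Lo (x i)}" "u \<in> flip_vertex ` d" for u i d
  proof -
    have d: "d \<in> \<sigma>" "d \<subseteq> range Up"
      using h(2) by (auto simp: upper_nontransversals_def)
    obtain v where "v \<in> d" "u = flip_vertex v" using h(4) by blast
    hence "Up (x i) \<in> d" using d(2) h(3) by auto
    hence "d = {Up (x i), Lo (y i)}"
      by (rule matching_disjoint[OF brauerD[OF \<sigma>] d(1) transversal[OF h(1)]]) simp
    hence "Lo (y i) \<in> d" by simp
    hence "Lo (y i) \<in> range Up" using d(2) by (rule rev_subsetD)
    thus False by auto
  qed
  fix e e' u assume *: "e \<in> tau r x \<sigma>" "e' \<in> tau r x \<sigma>" "u \<in> e" "u \<in> e'"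
  from *(1) show "e = e'"
  proof (cases rule: tau_cases)
    case (1 i)
    from *(2) show ?thesis
    proof (cases rule: tau_cases)
      case j: (1 j)
      have "u = Up i \<or> u = Lo (x i)" "u = Up j \<or> u = Lo (x j)"
        using * 1(2) j(2) by simp_all
      hence "i = j \<or> x i = x j" by auto
      hence "i = j" using x_inj[OF 1(1) j(1)] by blast
      thus ?thesis using 1 j by simp
    next
      case (2 d)
      have False by (rule mixed[OF 1(1) 2(1), of u]) (use * 1(2) 2(2) in simp_all)
      thus ?thesis ..
    qed
  next
    case d: (2 d)
    from *(2) show ?thesis
    proof (cases rule: tau_cases)
      case (1 i)
      have False by (rule mixed[OF 1(1) d(1), of u]) (use * 1(2) d(2) in simp_all)
      thus ?thesis ..
    next
      case d': (2 d')
      obtain v v' where "v \<in> d" "u = flip_vertex v" "v' \<in> d'" "u = flip_vertex v'"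
        using d d' * by blast
      hence v: "v \<in> d" "v \<in> d'" by (metis flip_flip)+
      have "d = d'"
        by (rule matching_disjoint[OF brauerD[OF \<sigma>] upper_nontransversal_subset(1)[OF d(1)]
          upper_nontransversal_subset(1)[OF d'(1)] v])
      thus ?thesis using d d' by simp
    qed
  qed
qed

lemma tau_isometry: "bstar (tau r x \<sigma>) \<in> isometries n r"
  unfolding isometries_iff[OF bstar_closed[OF tau_brauer]]
proof
  fix e assume "e \<in> bstar (tau r x \<sigma>)"
  then obtain d where d: "d \<in> tau r x \<sigma>" "e = flip_vertex ` d" by (auto simp: bstar_def)
  from d(1) show "\<not> e \<subseteq> Lo ` {1..r}"
  proof (cases rule: tau_cases)
    case (1 i) thus ?thesis using d by auto
  next
    case (2 f)
    hence "e = f" using d by (simp add: image_image)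
    moreover have "f \<subseteq> range Up" using 2 by (auto simp: upper_nontransversals_def)
    moreover have "f \<noteq> {}"
      using upper_nontransversal_subset(1)[OF 2(1)] brauerD[OF \<sigma>] by (auto simp: matching_def)
    ultimately show ?thesis by auto
  qed
qed

lemma transversal_enum_bstar: "transversal_enum m n r (bstar \<sigma>) y x"
proof
  show "bstar \<sigma> \<in> brauer m n" using \<sigma> by blast
  have "bij_betw ((`) flip_vertex) (transversals \<sigma>) ((`) flip_vertex ` transversals \<sigma>)"
    by (intro inj_on_imp_bij_betw inj_onI) (metis image_inv_f_f inj_image_eq_iff inj_on_flip)
  from bij_betw_trans[OF enum this]
  show "bij_betw (\<lambda>i. {Up (y i), Lo (x i)}) {1..r} (transversals (bstar \<sigma>))"
    by (simp add: transversals_bstar comp_def insert_commute)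
qed

text \<open>The middle point \<open>i\<close> links \<open>x i\<close> to \<open>y i\<close>; the
  upper nontransversals of \<open>\<sigma>\<close> are contributed by the first factor and the lower
  ones by the second.\<close>

lemma tau_factor: "bprod (bstar (tau r x \<sigma>)) (tau r y (bstar \<sigma>)) = \<sigma>"
proof -
  interpret s: transversal_enum m n r "bstar \<sigma>" y x by (rule transversal_enum_bstar)
  let ?a = "bstar (tau r x \<sigma>)" and ?b = "tau r y (bstar \<sigma>)"
  show ?thesis
  proof (rule bprod_eqI[OF bstar_closed[OF tau_brauer] s.tau_brauer \<sigma>])
    let ?M = "mid_lower ?a \<union> mid_upper ?b"
    fix u v assume uv: "{u, v} \<in> \<sigma>"
    have tr: "(Up (x i), Lo (y i)) \<in> conn ?M" if i: "i \<in> {1..r}" for i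
    proof -
      have "flip_vertex ` {Up i, Lo (x i)} \<in> ?a"
        using tau_transversal[OF i] unfolding bstar_def by (rule imageI)
      hence "{Lo i, Up (x i)} \<in> ?a" by simp
      moreover have "{Up i, Lo (y i)} \<in> ?b" by (rule s.tau_transversal[OF i])
      ultimately have "(Up (x i), Mid i) \<in> conn ?M" "(Mid i, Lo (y i)) \<in> conn ?M"
        using conn_sym[OF conn_mid_lower] conn_mid_upper by force+
      thus ?thesis by (rule conn_trans)
    qed
    have uv_pts: "u \<in> pts n m" "v \<in> pts n m"
      using matching_subset[OF brauerD[OF \<sigma>] uv] by auto
    have "u \<in> range Up \<or> u \<in> range Lo" "v \<in> range Up \<or> v \<in> range Lo"
      using uv_pts unfolding pts_def by blast+
    moreover have "{u, v} \<in> transversals \<sigma>"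
      if "{u, v} \<inter> range Up \<noteq> {}" "{u, v} \<inter> range Lo \<noteq> {}"
      using uv that by (simp add: transversals_def)
    ultimately consider (T) "{u, v} \<in> transversals \<sigma>"
      | (U) "{u, v} \<subseteq> range Up" | (L) "{u, v} \<subseteq> range Lo"
      by blast
    thus "(u, v) \<in> conn ?M"
    proof cases
      case T
      then obtain i where "i \<in> {1..r}" "{u, v} = {Up (x i), Lo (y i)}"
        using enum unfolding bij_betw_def by blast
      thus ?thesis using tr by (auto simp: doubleton_eq_iff dest: conn_sym)
    next
      case U
      hence "flip_vertex ` {u, v} \<in> tau r x \<sigma>"
        using uv unfolding tau_def upper_nontransversals_def by blast
      hence "flip_vertex ` flip_vertex ` {u, v} \<in> ?a" unfolding bstar_def by blast
      hence "{u, v} \<in> ?a" by (simp add: image_image)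
      from conn_mid_lower[OF this] show ?thesis using U by auto
    next
      case L
      have "flip_vertex ` {u, v} \<in> bstar \<sigma>" using uv unfolding bstar_def by blast
      moreover have "flip_vertex ` {u, v} \<subseteq> range Up" using L by auto
      ultimately have "flip_vertex ` flip_vertex ` {u, v} \<in> ?b"
        unfolding tau_def upper_nontransversals_def by blast
      hence "{u, v} \<in> ?b" by (simp add: image_image)
      from conn_mid_upper[OF this] show ?thesis using L by auto
    qed
  qed
qed

end

lemma transversal_enum_exists:
  assumes \<sigma>: "\<sigma> \<in> brauer n m"
  obtains x y where "transversal_enum n m (brank \<sigma>) \<sigma> x y"
proof -
  have "finite (transversals \<sigma>)"
    using brauer_finite[OF \<sigma>] transversals_subset by (rule rev_finite_subset)
  then obtain h where h: "bij_betw h {1..brank \<sigma>} (transversals \<sigma>)"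
    unfolding brank_def using ex_bij_betw_nat_finite_1 by blast
  have "\<exists>a b. h i = {Up a, Lo b}" if "i \<in> {1..brank \<sigma>}" for i
  proof -
    have t: "h i \<in> transversals \<sigma>" using h that by (auto simp: bij_betw_def)
    then obtain a b where "Up a \<in> h i" "Lo b \<in> h i" "h i \<in> \<sigma>" by (auto simp: transversals_def)
    moreover from this obtain u v where "h i = {u, v}" by (metis matchingE brauerD[OF \<sigma>])
    ultimately show ?thesis by auto
  qed
  then obtain x y where "\<And>i. i \<in> {1..brank \<sigma>} \<Longrightarrow> h i = {Up (x i), Lo (y i)}" by metis
  hence "bij_betw (\<lambda>i. {Up (x i), Lo (y i)}) {1..brank \<sigma>} (transversals \<sigma>)"
    using h by (subst bij_betw_cong[of _ _ h]) auto
  thus thesis using that \<sigma> by (simp add: transversal_enum_def)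
qed

text \<open>The construction of \<open>tau\<close> is applied to \<open>\<alpha>\<close> itself and
  to its reflection.\<close>

lemma brauer_factor:
  assumes "\<alpha> \<in> brauer m n"
  obtains a c where "a \<in> isometries m (brank \<alpha>)" "c \<in> isometries n (brank \<alpha>)"
    "\<alpha> = bprod a (bstar c)"
proof -
  obtain x y where "transversal_enum m n (brank \<alpha>) \<alpha> x y"
    by (rule transversal_enum_exists[OF assms])
  then interpret transversal_enum m n "brank \<alpha>" \<alpha> x y .
  interpret s: transversal_enum n m "brank \<alpha>" "bstar \<alpha>" y x by (rule transversal_enum_bstar)
  show thesis
    by (rule that[OF tau_isometry s.tau_isometry]) (simp add: tau_factor)
qed

section \<open>Green's relations of a sandwich semigroup\<close>

notation bprod (infixl "\<odot>" 70)

text \<open>Domain and codomain can be read off a Brauer partition, so that composability is a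
  side condition the simplifier can discharge.\<close>

definition bdom :: "brauer_partition \<Rightarrow> nat" where
  "bdom \<alpha> = card {i. Up i \<in> \<Union>\<alpha>}"

definition bcod :: "brauer_partition \<Rightarrow> nat" where
  "bcod \<alpha> = card {i. Lo i \<in> \<Union>\<alpha>}"

definition barr :: "brauer_partition \<Rightarrow> bool" where
  "barr \<alpha> \<longleftrightarrow> \<alpha> \<in> brauer (bdom \<alpha>) (bcod \<alpha>)"

lemma brauer_iff_barr: "\<alpha> \<in> brauer m n \<longleftrightarrow> barr \<alpha> \<and> bdom \<alpha> = m \<and> bcod \<alpha> = n"
proof -
  have "bdom \<alpha> = m \<and> bcod \<alpha> = n" if "\<alpha> \<in> brauer m n"
  proof -
    have "\<Union>\<alpha> = pts m n" using that brauerD matching_Union by blast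
    hence "{i. Up i \<in> \<Union>\<alpha>} = {1..m}" "{i. Lo i \<in> \<Union>\<alpha>} = {1..n}" by (auto simp: pts_def)
    thus ?thesis by (simp add: bdom_def bcod_def)
  qed
  thus ?thesis by (auto simp: barr_def)
qed

lemma barr_bprod:
  assumes "barr \<alpha>" "barr \<beta>" "bcod \<alpha> = bdom \<beta>"
  shows "barr (\<alpha> \<odot> \<beta>)" "bdom (\<alpha> \<odot> \<beta>) = bdom \<alpha>" "bcod (\<alpha> \<odot> \<beta>) = bcod \<beta>"
  using bprod_closed[of \<alpha> "bdom \<alpha>" "bcod \<alpha>" \<beta> "bcod \<beta>"] assms
  by (auto simp: brauer_iff_barr)

lemma barr_bstar:
  assumes "barr \<alpha>"
  shows "barr (bstar \<alpha>)" "bdom (bstar \<alpha>) = bcod \<alpha>" "bcod (bstar \<alpha>) = bdom \<alpha>"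
  using bstar_closed[of \<alpha> "bdom \<alpha>" "bcod \<alpha>"] assms by (auto simp: brauer_iff_barr)

lemma barr_bid: "barr (bid n)" "bdom (bid n) = n" "bcod (bid n) = n"
  using bid_closed[of n] by (auto simp: brauer_iff_barr)

lemma barr_assoc:
  assumes "barr \<alpha>" "barr \<beta>" "barr \<gamma>" "bcod \<alpha> = bdom \<beta>" "bcod \<beta> = bdom \<gamma>"
  shows "\<alpha> \<odot> \<beta> \<odot> \<gamma> = \<alpha> \<odot> (\<beta> \<odot> \<gamma>)"
  using bprod_assoc[of \<alpha> "bdom \<alpha>" "bcod \<alpha>" \<beta> "bcod \<beta>" \<gamma> "bcod \<gamma>"] assms
  by (auto simp: brauer_iff_barr)

lemma barr_bid_left: "barr \<alpha> \<Longrightarrow> bdom \<alpha> = n \<Longrightarrow> bid n \<odot> \<alpha> = \<alpha>"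
  using bprod_bid_left[of \<alpha> n "bcod \<alpha>"] by (simp add: brauer_iff_barr)

lemma barr_bid_right: "barr \<alpha> \<Longrightarrow> bcod \<alpha> = n \<Longrightarrow> \<alpha> \<odot> bid n = \<alpha>"
  using bprod_bid_right[of \<alpha> "bdom \<alpha>" n] by (simp add: brauer_iff_barr)

lemma barr_bstar_bprod:
  "barr \<alpha> \<Longrightarrow> barr \<beta> \<Longrightarrow> bcod \<alpha> = bdom \<beta> \<Longrightarrow> bstar (\<alpha> \<odot> \<beta>) = bstar \<beta> \<odot> bstar \<alpha>"
  using bstar_bprod[of \<alpha> "bdom \<alpha>" "bcod \<alpha>" \<beta> "bcod \<beta>"] by (simp add: brauer_iff_barr)

lemmas barr_simps = brauer_iff_barr barr_bprod barr_bstar barr_bid barr_assoc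
  barr_bid_left barr_bid_right barr_bstar_bprod bstar_bstar bstar_bid

lemma isom:
  assumes "a \<in> isometries k q"
  shows "barr a" "bdom a = k" "bcod a = q" "bstar a \<odot> a = bid q"
    and "barr z \<Longrightarrow> bdom z = q \<Longrightarrow> bstar a \<odot> (a \<odot> z) = z"
proof -
  show *: "barr a" "bdom a = k" "bcod a = q" "bstar a \<odot> a = bid q"
    using isometriesD[OF assms] by (auto simp: brauer_iff_barr)
  show "bstar a \<odot> (a \<odot> z) = z" if "barr z" "bdom z = q"
    using barr_assoc[of "bstar a" a z] that * by (simp add: barr_simps)
qed

lemma unit:
  assumes "g \<in> isometries q q"
  shows "g \<odot> bstar g = bid q"
    and "barr z \<Longrightarrow> bdom z = q \<Longrightarrow> g \<odot> (bstar g \<odot> z) = z"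
  using isometry_square[OF assms] isom(5)[OF isometry_square(2)[OF assms]] by simp_all

lemma isometries_leftI:
  "barr x \<Longrightarrow> barr a \<Longrightarrow> bdom a = k \<Longrightarrow> bcod a = q \<Longrightarrow> bdom x = q \<Longrightarrow> bcod x = k \<Longrightarrow> x \<odot> a = bid q
    \<Longrightarrow> a \<in> isometries k q"
  by (rule isometriesI[of x]) (simp_all add: brauer_iff_barr)

lemma isometries_bprod:
  assumes a: "a \<in> isometries k l" and b: "b \<in> isometries l q"
  shows "a \<odot> b \<in> isometries k q"
  by (rule isometries_leftI[of "bstar b \<odot> bstar a"]) (simp_all add: barr_simps isom[OF a] isom[OF b])

section \<open>Green's relations as mutual divisibility\<close>

lemma greenR_iff:
  assumes "semigroup_on S f"
  shows "(a, b) \<in> greenR S f \<longleftrightarrow>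
    a \<in> S \<and> b \<in> S \<and> (a = b \<or> (\<exists>c\<in>S. \<exists>d\<in>S. a = f b c \<and> b = f a d))" (is "_ \<longleftrightarrow> ?R")
proof
  assume "(a, b) \<in> greenR S f"
  hence *: "a \<in> S" "b \<in> S" "right_ideal S f a = right_ideal S f b" by (auto simp: greenR_def)
  have "a \<in> right_ideal S f b" "b \<in> right_ideal S f a"
    using *(3) by (auto simp: right_ideal_def)
  thus ?R using * by (auto simp: right_ideal_def)
next
  have sub: "right_ideal S f b \<subseteq> right_ideal S f a" if "a \<in> S" "d \<in> S" "b = f a d" for a b d
  proof -
    have "f b c \<in> right_ideal S f a" if "c \<in> S" for c
    proof -
      have "f b c = f a (f d c)" "f d c \<in> S"
        using assms \<open>a \<in> S\<close> \<open>d \<in> S\<close> \<open>b = f a d\<close> that by (simp_all add: semigroup_on_def)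
      thus ?thesis by (simp add: right_ideal_def)
    qed
    moreover have "b \<in> right_ideal S f a" using that by (simp add: right_ideal_def)
    ultimately show ?thesis by (auto simp: right_ideal_def[of S f b])
  qed
  assume R: ?R
  have "right_ideal S f a = right_ideal S f b"
  proof (cases "a = b")
    case False
    then obtain c d where "c \<in> S" "d \<in> S" "a = f b c" "b = f a d" using R by blast
    thus ?thesis using R sub by (intro equalityI) blast+
  qed simp
  thus "(a, b) \<in> greenR S f" using R by (simp add: greenR_def)
qed

lemma greenL_iff:
  assumes "semigroup_on S f"
  shows "(a, b) \<in> greenL S f \<longleftrightarrow>
    a \<in> S \<and> b \<in> S \<and> (a = b \<or> (\<exists>c\<in>S. \<exists>d\<in>S. a = f c b \<and> b = f d a))"
proof -
  have "semigroup_on S (\<lambda>x y. f y x)" using assms by (auto simp: semigroup_on_def)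
  from greenR_iff[OF this, of a b] show ?thesis
    by (simp add: greenR_def greenL_def right_ideal_def left_ideal_def)
qed

text \<open>All that is kept of the sandwich element is its factorisation. The conditions are
  symmetric under exchanging \<open>m\<close> with \<open>n\<close> and \<open>\<kappa>\<close> with
  \<open>\<tau>\<close>, and identities satisfy them, so dual statements and the Brauer monoid
  itself are instances.\<close>

locale sandwich_pair =
  fixes m n r :: nat and \<kappa> \<tau> \<sigma> :: brauer_partition
  assumes \<kappa>: "bstar \<kappa> \<in> isometries m r" and \<tau>: "bstar \<tau> \<in> isometries n r"
    and \<sigma>_eq: "\<sigma> = bstar \<tau> \<odot> \<kappa>"
begin

lemma arr_simps:
  "barr \<kappa>" "bdom \<kappa> = r" "bcod \<kappa> = m" "barr \<tau>" "bdom \<tau> = r" "bcod \<tau> = n"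
  "\<kappa> \<odot> bstar \<kappa> = bid r" "\<tau> \<odot> bstar \<tau> = bid r"
  "barr z \<Longrightarrow> bdom z = r \<Longrightarrow> \<kappa> \<odot> (bstar \<kappa> \<odot> z) = z"
  "barr z \<Longrightarrow> bdom z = r \<Longrightarrow> \<tau> \<odot> (bstar \<tau> \<odot> z) = z"
proof -
  have "barr \<kappa> \<and> bdom \<kappa> = r \<and> bcod \<kappa> = m \<and> barr \<tau> \<and> bdom \<tau> = r \<and> bcod \<tau> = n"
    using isom(1-3)[OF \<kappa>] isom(1-3)[OF \<tau>] barr_bstar[of "bstar \<kappa>"] barr_bstar[of "bstar \<tau>"] by simp
  thus "barr \<kappa>" "bdom \<kappa> = r" "bcod \<kappa> = m" "barr \<tau>" "bdom \<tau> = r" "bcod \<tau> = n" by auto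
qed (use isom(4,5)[OF \<kappa>] isom(4,5)[OF \<tau>] in simp_all)

lemmas cat = barr_simps arr_simps \<sigma>_eq

abbreviation B where "B \<equiv> brauer m n"

abbreviation op (infixl "\<star>" 70) where "op \<equiv> sandwich \<sigma>"

lemma dual: "sandwich_pair n m r \<tau> \<kappa> (bstar \<sigma>)"
  by unfold_locales (use \<kappa> \<tau> in \<open>simp_all add: cat\<close>)

lemma semigroup: "semigroup_on B (\<star>)"
  by (auto simp: semigroup_on_def sandwich_def cat)

text \<open>These turn out to be the left factors of regular elements of rank \<open>q\<close>:
  multiplication by \<open>\<kappa>\<close> must not destroy any of the \<open>q\<close>
  transversals. \<open>lower\<close> plays the same role for right factors.\<close>

definition upper :: "nat \<Rightarrow> brauer_partition set" where
  "upper q = {a \<in> brauer m q. \<kappa> \<odot> a \<in> isometries r q}"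

definition lower :: "nat \<Rightarrow> brauer_partition set" where
  "lower q = {c \<in> brauer n q. \<tau> \<odot> c \<in> isometries r q}"

text \<open>Once \<open>\<kappa> \<odot> a\<close> is left invertible,
  \<open>bstar (\<kappa> \<odot> a) \<odot> \<kappa>\<close> is a left inverse of
  \<open>a\<close>.\<close>

lemma upperD:
  assumes "a \<in> upper q"
  shows "\<kappa> \<odot> a \<in> isometries r q" "a \<in> isometries m q"
proof -
  show 1: "\<kappa> \<odot> a \<in> isometries r q" using assms by (simp add: upper_def)
  have "barr a" "bdom a = m" "bcod a = q" using assms by (auto simp: upper_def brauer_iff_barr)
  thus "a \<in> isometries m q"
    using isom(4)[OF 1] by (intro isometries_leftI[of "bstar (\<kappa> \<odot> a) \<odot> \<kappa>"]) (simp_all add: cat)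
qed

lemma upperI:
  "barr x \<Longrightarrow> bdom x = q \<Longrightarrow> bcod x = r \<Longrightarrow> barr a \<Longrightarrow> bdom a = m \<Longrightarrow> bcod a = q
    \<Longrightarrow> x \<odot> (\<kappa> \<odot> a) = bid q \<Longrightarrow> a \<in> upper q"
  by (auto simp: upper_def cat intro!: isometries_leftI[of x])

lemma upper_unit:
  assumes "a \<in> upper q" "g \<in> isometries q q"
  shows "a \<odot> g \<in> upper q"
proof -
  have "\<kappa> \<odot> (a \<odot> g) = \<kappa> \<odot> a \<odot> g"
    using isom[OF upperD(2)[OF assms(1)]] isom[OF assms(2)] by (simp add: cat)
  thus ?thesis
    using isometries_bprod[OF upperD(1)[OF assms(1)] assms(2)]
      isom[OF upperD(2)[OF assms(1)]] isom[OF assms(2)]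
    by (simp add: upper_def cat)
qed

end

lemma (in sandwich_pair) dual_upper: "sandwich_pair.upper n r \<tau> q = lower q"
  by (simp add: sandwich_pair.upper_def[OF dual] lower_def)

lemma (in sandwich_pair) dual_lower: "sandwich_pair.lower m r \<kappa> q = upper q"
  by (simp add: sandwich_pair.lower_def[OF dual] upper_def)

context sandwich_pair
begin

lemmas lowerD = sandwich_pair.upperD[OF dual, unfolded dual_upper]
lemmas lowerI = sandwich_pair.upperI[OF dual, unfolded dual_upper]
lemmas lower_unit = sandwich_pair.upper_unit[OF dual, unfolded dual_upper]

text \<open>Two factorisations of one element, through \<open>q\<close> and through its rank
  \<open>p\<close>, yield isometries between \<open>p\<close> and \<open>q\<close> in both
  directions, and each direction bounds one number by the other.\<close>

lemma brank_bprod_bstar: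
  assumes a: "a \<in> isometries m q" and c: "c \<in> isometries n q"
  shows "brank (a \<odot> bstar c) = q"
proof -
  let ?\<alpha> = "a \<odot> bstar c"
  define p where "p = brank ?\<alpha>"
  have "?\<alpha> \<in> brauer m n" using isom[OF a] isom[OF c] by (simp add: cat)
  then obtain a' c' where a': "a' \<in> isometries m p" and c': "c' \<in> isometries n p"
    and eq: "?\<alpha> = a' \<odot> bstar c'"
    unfolding p_def by (rule brauer_factor)
  note s = isom[OF a] isom[OF c] isom[OF a'] isom[OF c']
  have "(bstar a \<odot> a') \<odot> (bstar c' \<odot> c) = bstar a \<odot> (a' \<odot> bstar c') \<odot> c"
    by (simp add: cat s)
  also have "\<dots> = bid q" unfolding eq[symmetric] by (simp add: cat s)
  finally have "bstar c' \<odot> c \<in> isometries p q"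
    by (intro isometries_leftI[of "bstar a \<odot> a'"]) (simp_all add: cat s)
  hence 1: "q \<le> p" by (rule isometries_le)
  have "(bstar a' \<odot> a) \<odot> (bstar c \<odot> c') = bstar a' \<odot> ?\<alpha> \<odot> c'"
    by (simp add: cat s)
  also have "\<dots> = bid p" unfolding eq by (simp add: cat s)
  finally have "bstar c \<odot> c' \<in> isometries q p"
    by (intro isometries_leftI[of "bstar a' \<odot> a"]) (simp_all add: cat s)
  hence "p \<le> q" by (rule isometries_le)
  thus ?thesis using 1 unfolding p_def by simp
qed

text \<open>Related elements have left factors that differ by an invertible change, and this change
  can be moved into the right factor. So the left factor may be kept fixed, while regularity leaves
  the right one free within \<open>lower q\<close>.\<close>

lemma greenR_class:
  assumes a: "a \<in> upper q" and c: "c \<in> lower q"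
  shows "greenR B (\<star>) `` {a \<odot> bstar c} = (\<lambda>d. a \<odot> bstar d) ` lower q"
proof (intro equalityI subsetI)
  fix \<beta> assume "\<beta> \<in> greenR B (\<star>) `` {a \<odot> bstar c}"
  hence R: "(a \<odot> bstar c, \<beta>) \<in> greenR B (\<star>)" by simp
  note s = isom[OF upperD(2)[OF a]] isom[OF lowerD(2)[OF c]]
  show "\<beta> \<in> (\<lambda>d. a \<odot> bstar d) ` lower q"
  proof (cases "a \<odot> bstar c = \<beta>")
    case True thus ?thesis using c by blast
  next
    case False
    with R obtain \<gamma> \<delta> where \<gamma>\<delta>: "\<beta> \<in> B" "\<gamma> \<in> B" "\<delta> \<in> B"
      "a \<odot> bstar c = \<beta> \<star> \<gamma>" "\<beta> = a \<odot> bstar c \<star> \<delta>"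
      unfolding greenR_iff[OF semigroup] by blast
    obtain p b d where b: "b \<in> isometries m p" and d: "d \<in> isometries n p"
      and \<beta>: "\<beta> = b \<odot> bstar d"
      using brauer_factor[OF \<gamma>\<delta>(1)] by metis
    have arr: "barr \<gamma>" "bdom \<gamma> = m" "bcod \<gamma> = n" "barr \<delta>" "bdom \<delta> = m" "bcod \<delta> = n"
      using \<gamma>\<delta>(2,3) by (auto simp: brauer_iff_barr)
    note s = s isom[OF b] isom[OF d] arr
    \<comment> \<open>\<open>h\<close> and \<open>h'\<close> carry the left factors into each other,
      \<open>b = a \<odot> h\<close> and \<open>a = b \<odot> h'\<close>. Both are left invertible,
      which forces \<open>p = q\<close>.\<close>
    define h where "h = bstar c \<odot> \<sigma> \<odot> \<delta> \<odot> d"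
    define h' where "h' = bstar d \<odot> \<sigma> \<odot> \<gamma> \<odot> c"
    have h_arr: "barr h" "bdom h = q" "bcod h = p" "barr h'" "bdom h' = p" "bcod h' = q"
      by (simp_all add: h_def h'_def cat s)
    have "b = b \<odot> bstar d \<odot> d" by (simp add: cat s)
    also have "\<dots> = a \<odot> h" unfolding \<beta>[symmetric] \<gamma>\<delta>(5) by (simp add: h_def sandwich_def cat s)
    finally have b_eq: "b = a \<odot> h" .
    have "a = a \<odot> bstar c \<odot> c" by (simp add: cat s)
    also have "\<dots> = b \<odot> h'" unfolding \<gamma>\<delta>(4) \<beta> by (simp add: h'_def sandwich_def cat s)
    finally have a_eq: "a = b \<odot> h'" .
    have "(bstar b \<odot> a) \<odot> h = bstar b \<odot> (a \<odot> h)" by (simp add: cat s h_arr)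
    also have "\<dots> = bid p" unfolding b_eq[symmetric] by (simp add: s)
    finally have h: "h \<in> isometries q p"
      by (intro isometries_leftI[of "bstar b \<odot> a"]) (simp_all add: cat s h_arr)
    have "(bstar a \<odot> b) \<odot> h' = bstar a \<odot> (b \<odot> h')" by (simp add: cat s h_arr)
    also have "\<dots> = bid q" unfolding a_eq[symmetric] by (simp add: s)
    finally have "h' \<in> isometries p q"
      by (intro isometries_leftI[of "bstar a \<odot> b"]) (simp_all add: cat s h_arr)
    hence "p = q" using h isometries_le by (metis le_antisym)
    note s = s[unfolded this] and h_arr = h_arr[unfolded this] and h = h[unfolded this]
    \<comment> \<open>\<open>h\<close> is moved over to the right factor, so that
      \<open>\<beta>\<close> acquires the left factor \<open>a\<close>.\<close>
    define e where "e = d \<odot> bstar h"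
    have e_arr: "barr e" "bdom e = n" "bcod e = q" by (simp_all add: e_def cat s h_arr)
    have \<beta>_eq: "\<beta> = a \<odot> bstar e"
      unfolding \<beta> b_eq by (simp add: e_def cat s h_arr)
    \<comment> \<open>Cancelling \<open>a\<close> and \<open>c\<close> from
      \<open>a \<odot> bstar c = \<beta> \<star> \<gamma>\<close> and reflecting exhibits a left
      inverse of \<open>\<tau> \<odot> e\<close>.\<close>
    have "bstar e \<odot> \<sigma> \<odot> \<gamma> \<odot> c = bstar a \<odot> (a \<odot> bstar e \<star> \<gamma>) \<odot> c"
      by (simp add: sandwich_def cat s e_arr)
    also have "\<dots> = bid q" unfolding \<beta>_eq[symmetric] \<gamma>\<delta>(4)[symmetric] by (simp add: cat s)
    finally have "bstar (bstar e \<odot> \<sigma> \<odot> \<gamma> \<odot> c) = bid q" by simp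
    hence "e \<in> lower q"
      by (intro lowerI[of "bstar (\<kappa> \<odot> \<gamma> \<odot> c)"]) (simp_all add: cat s e_arr)
    thus ?thesis using \<beta>_eq by blast
  qed
next
  fix \<beta> assume "\<beta> \<in> (\<lambda>d. a \<odot> bstar d) ` lower q"
  then obtain d where d: "d \<in> lower q" and \<beta>: "\<beta> = a \<odot> bstar d" by blast
  \<comment> \<open>The multiplier starts with \<open>bstar \<kappa>\<close> to cancel the
    \<open>\<kappa>\<close> in \<open>\<sigma>\<close>; then \<open>bstar (\<tau> \<odot> c)\<close>
    meets \<open>\<tau> \<odot> c\<close> and disappears as well.\<close>
  have step: "a \<odot> bstar d = a \<odot> bstar c \<star> (bstar \<kappa> \<odot> (\<tau> \<odot> c) \<odot> bstar d)"
    "bstar \<kappa> \<odot> (\<tau> \<odot> c) \<odot> bstar d \<in> B" "a \<odot> bstar d \<in> B"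
    if c: "c \<in> lower q" and d: "d \<in> lower q" for c d
  proof -
    note s = isom[OF upperD(2)[OF a]] isom[OF lowerD(2)[OF c]] isom[OF lowerD(2)[OF d]]
    have "a \<odot> bstar c \<star> (bstar \<kappa> \<odot> (\<tau> \<odot> c) \<odot> bstar d)
        = a \<odot> ((bstar (\<tau> \<odot> c) \<odot> (\<tau> \<odot> c)) \<odot> bstar d)"
      by (simp add: sandwich_def cat s)
    also have "\<dots> = a \<odot> bstar d"
      unfolding isom(4)[OF lowerD(1)[OF c]] by (simp add: cat s)
    finally show "a \<odot> bstar d = a \<odot> bstar c \<star> (bstar \<kappa> \<odot> (\<tau> \<odot> c) \<odot> bstar d)" ..
    show "bstar \<kappa> \<odot> (\<tau> \<odot> c) \<odot> bstar d \<in> B" "a \<odot> bstar d \<in> B" by (simp_all add: cat s)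
  qed
  have "(a \<odot> bstar c, a \<odot> bstar d) \<in> greenR B (\<star>)"
    unfolding greenR_iff[OF semigroup] using step[OF c d] step[OF d c] by blast
  thus "\<beta> \<in> greenR B (\<star>) `` {a \<odot> bstar c}" using \<beta> by simp
qed

text \<open>\<open>bstar\<close> is an anti-isomorphism onto the sandwich semigroup of
  \<open>bstar \<sigma>\<close>, so the left relation here is the right relation there.\<close>

lemma greenL_iff_dual:
  assumes "\<alpha> \<in> B" "\<beta> \<in> B"
  shows "(\<alpha>, \<beta>) \<in> greenL B (\<star>)
    \<longleftrightarrow> (bstar \<alpha>, bstar \<beta>) \<in> greenR (brauer n m) (sandwich (bstar \<sigma>))"
proof -
  have op: "\<gamma> \<star> \<delta> = bstar (sandwich (bstar \<sigma>) (bstar \<delta>) (bstar \<gamma>))"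
    if "\<gamma> \<in> B" "\<delta> \<in> B" for \<gamma> \<delta>
    using that by (simp add: sandwich_def cat)
  have star_inj: "bstar x = bstar y \<longleftrightarrow> x = y" for x y by (metis bstar_bstar)
  have B_dual: "brauer n m = bstar ` B" by (force simp: image_iff intro: bstar_closed)
  show ?thesis
    unfolding greenL_iff[OF semigroup] greenR_iff[OF sandwich_pair.semigroup[OF dual]]
    using assms op star_inj unfolding B_dual
    by (simp add: image_iff star_inj bex_simps) (metis bstar_bstar)
qed

lemma greenL_class:
  assumes a: "a \<in> upper q" and c: "c \<in> lower q"
  shows "greenL B (\<star>) `` {a \<odot> bstar c} = (\<lambda>b. b \<odot> bstar c) ` upper q"
proof -
  have ac: "bstar (b \<odot> bstar c) = c \<odot> bstar b" "b \<odot> bstar c \<in> B" if "b \<in> upper q" for b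
    using isom[OF upperD(2)[OF that]] isom[OF lowerD(2)[OF c]] by (simp_all add: cat)
  have R: "greenR (brauer n m) (sandwich (bstar \<sigma>)) `` {c \<odot> bstar a} = (\<lambda>b. c \<odot> bstar b) ` upper q"
    using sandwich_pair.greenR_class[OF dual, unfolded dual_upper dual_lower, OF c a] .
  show ?thesis
  proof (intro equalityI subsetI)
    fix \<beta> assume "\<beta> \<in> greenL B (\<star>) `` {a \<odot> bstar c}"
    hence L: "(a \<odot> bstar c, \<beta>) \<in> greenL B (\<star>)" by simp
    hence "\<beta> \<in> B" by (simp add: greenL_def)
    with L have "bstar \<beta> \<in> (\<lambda>b. c \<odot> bstar b) ` upper q"
      using greenL_iff_dual[OF ac(2)[OF a]] ac(1)[OF a] R by auto
    then obtain b where "b \<in> upper q" "bstar \<beta> = c \<odot> bstar b" by blast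
    thus "\<beta> \<in> (\<lambda>b. b \<odot> bstar c) ` upper q"
      using ac(1) by (metis bstar_bstar image_eqI)
  next
    fix \<beta> assume "\<beta> \<in> (\<lambda>b. b \<odot> bstar c) ` upper q"
    then obtain b where b: "b \<in> upper q" "\<beta> = b \<odot> bstar c" by blast
    hence "(bstar (a \<odot> bstar c), bstar \<beta>) \<in> greenR (brauer n m) (sandwich (bstar \<sigma>))"
      using R ac(1) a by auto
    thus "\<beta> \<in> greenL B (\<star>) `` {a \<odot> bstar c}"
      using greenL_iff_dual[OF ac(2)[OF a] ac(2)[OF b(1)]] b(2) by simp
  qed
qed

text \<open>Cancelling \<open>a\<close> on the left and \<open>bstar c\<close> on the right turns
  the equation for an inverse \<open>\<beta>\<close> into \<open>bstar c \<odot> \<sigma> \<odot>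
  \<beta> \<odot> \<sigma> \<odot> a = bid q\<close>. This provides a left inverse of
  \<open>\<kappa> \<odot> a\<close> and, reflected, one of \<open>\<tau> \<odot> c\<close>.\<close>

lemma regular_iff:
  assumes a: "a \<in> isometries m q" and c: "c \<in> isometries n q"
  shows "a \<odot> bstar c \<in> regular_elements B (\<star>) \<longleftrightarrow> a \<in> upper q \<and> c \<in> lower q"
proof
  note s = isom[OF a] isom[OF c]
  assume "a \<odot> bstar c \<in> regular_elements B (\<star>)"
  then obtain \<beta> where \<beta>: "\<beta> \<in> B" "a \<odot> bstar c \<star> \<beta> \<star> (a \<odot> bstar c) = a \<odot> bstar c"
    by (auto simp: regular_elements_def)
  have arr: "barr \<beta>" "bdom \<beta> = m" "bcod \<beta> = n" using \<beta>(1) by (auto simp: brauer_iff_barr)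
  have "bstar c \<odot> \<sigma> \<odot> \<beta> \<odot> \<sigma> \<odot> a = bstar a \<odot> (a \<odot> bstar c \<star> \<beta> \<star> (a \<odot> bstar c)) \<odot> c"
    by (simp add: sandwich_def cat s arr)
  also have "\<dots> = bid q" unfolding \<beta>(2) by (simp add: cat s)
  finally have *: "bstar c \<odot> \<sigma> \<odot> \<beta> \<odot> \<sigma> \<odot> a = bid q" .
  show "a \<in> upper q \<and> c \<in> lower q"
  proof
    show "a \<in> upper q"
      using * by (intro upperI[of "bstar c \<odot> \<sigma> \<odot> \<beta> \<odot> bstar \<tau>"]) (simp_all add: cat s arr)
    have "bstar (bstar c \<odot> \<sigma> \<odot> \<beta> \<odot> \<sigma> \<odot> a) = bid q" unfolding * by simp
    thus "c \<in> lower q"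
      by (intro lowerI[of "bstar (\<kappa> \<odot> \<beta> \<odot> \<sigma> \<odot> a)"]) (simp_all add: cat s arr)
  qed
next
  note s = isom[OF a] isom[OF c]
  assume "a \<in> upper q \<and> c \<in> lower q"
  hence u: "a \<in> upper q" "c \<in> lower q" by auto
  note s' = isom[OF upperD(1)[OF u(1)]] isom[OF lowerD(1)[OF u(2)]]
  \<comment> \<open>The outer \<open>bstar \<kappa>\<close> and \<open>\<tau>\<close> cancel against
    the two copies of \<open>\<sigma>\<close>; what remains between \<open>a\<close> and
    \<open>bstar c\<close> is a pair of identities from the two isometries.\<close>
  let ?\<beta> = "bstar \<kappa> \<odot> (\<tau> \<odot> c) \<odot> (bstar (\<kappa> \<odot> a) \<odot> \<tau>)"
  have "a \<odot> bstar c \<star> ?\<beta> \<star> (a \<odot> bstar c)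
      = a \<odot> (bstar (\<tau> \<odot> c) \<odot> (\<tau> \<odot> c)) \<odot> (bstar (\<kappa> \<odot> a) \<odot> (\<kappa> \<odot> a)) \<odot> bstar c"
    by (simp add: sandwich_def cat s)
  also have "\<dots> = a \<odot> bstar c" unfolding s'(4) s'(9) by (simp add: cat s)
  finally have "a \<odot> bstar c \<star> ?\<beta> \<star> (a \<odot> bstar c) = a \<odot> bstar c" .
  moreover have "?\<beta> \<in> B" "a \<odot> bstar c \<in> B" by (simp_all add: cat s)
  ultimately show "a \<odot> bstar c \<in> regular_elements B (\<star>)"
    unfolding regular_elements_def by blast
qed

lemma regular_elementE:
  assumes "\<alpha> \<in> regular_elements B (\<star>)"
  obtains a c where "a \<in> upper (brank \<alpha>)" "c \<in> lower (brank \<alpha>)" "\<alpha> = a \<odot> bstar c"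
proof -
  have "\<alpha> \<in> B" using assms by (simp add: regular_elements_def)
  then obtain a c where "a \<in> isometries m (brank \<alpha>)" "c \<in> isometries n (brank \<alpha>)"
    "\<alpha> = a \<odot> bstar c"
    by (rule brauer_factor)
  thus thesis using that assms regular_iff by metis
qed

end

section \<open>Coordinates on a regular class\<close>

lemma classes_in_eq:
  assumes "X \<subseteq> S" "\<And>s. s \<in> S \<Longrightarrow> s \<in> K `` {s}" "\<And>\<alpha>. \<alpha> \<in> X \<Longrightarrow> K `` {\<alpha>} \<subseteq> X"
  shows "classes_in S K X = (\<lambda>\<alpha>. K `` {\<alpha>}) ` X"
proof (intro equalityI subsetI)
  fix C assume "C \<in> classes_in S K X"
  then obtain s where s: "s \<in> S" "C = K `` {s}" "C \<subseteq> X"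
    by (auto simp: classes_in_def quotient_def)
  thus "C \<in> (\<lambda>\<alpha>. K `` {\<alpha>}) ` X" using assms(2) by blast
next
  fix C assume "C \<in> (\<lambda>\<alpha>. K `` {\<alpha>}) ` X"
  thus "C \<in> classes_in S K X"
    using assms(1,3) unfolding classes_in_def quotient_def by blast
qed

text \<open>\<open>f\<close> is a complete invariant of the classes inside \<open>X\<close>, so they
  correspond to its values.\<close>

lemma card_classes_in:
  assumes "X \<subseteq> S" "\<And>s. s \<in> S \<Longrightarrow> s \<in> K `` {s}"
    and K: "\<And>\<alpha>. \<alpha> \<in> X \<Longrightarrow> K `` {\<alpha>} = {\<beta> \<in> X. f \<beta> = f \<alpha>}"
  shows "card (classes_in S K X) = card (f ` X)"
proof -
  have "classes_in S K X = (\<lambda>\<alpha>. K `` {\<alpha>}) ` X"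
    by (rule classes_in_eq) (use assms in auto)
  also have "\<dots> = (\<lambda>y. {\<beta> \<in> X. f \<beta> = y}) ` f ` X"
    unfolding image_image by (rule image_cong[OF refl K])
  also have "card \<dots> = card (f ` X)"
    by (rule card_image) (auto simp: inj_on_def)
  finally show ?thesis .
qed

text \<open>The units act from the right, and freely because every \<open>t\<close> has a left
  inverse; one point per orbit gives unique factorisations.\<close>

lemma orbit_representatives:
  obtains T where "T \<subseteq> isometries r q"
    "bij_betw (\<lambda>(t, g). t \<odot> g) (T \<times> isometries q q) (isometries r q)"
proof -
  let ?G = "isometries q q"
  define orb where "orb b = (\<lambda>g. b \<odot> g) ` ?G" for b
  \<comment> \<open>The choice looks only at the set \<open>orb b\<close>, so \<open>rep\<close> is
    constant on orbits.\<close>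
  define rep where "rep b = (SOME b'. b' \<in> orb b)" for b
  have rep: "rep b \<in> orb b" for b
    unfolding rep_def by (rule someI[of _ "b \<odot> bid q"]) (auto simp: orb_def)
  have orb_eq: "orb (b \<odot> g) = orb b" if b: "b \<in> isometries r q" and g: "g \<in> ?G" for b g
  proof -
    have "b \<odot> g \<odot> h \<in> orb b" if "h \<in> ?G" for h
      using that isometries_bprod[OF g that] isom[OF b] isom[OF g] isom[OF that]
      by (auto simp: orb_def barr_simps)
    moreover have "b \<odot> h \<in> orb (b \<odot> g)" if h: "h \<in> ?G" for h
    proof -
      have "b \<odot> h = b \<odot> g \<odot> (bstar g \<odot> h)"
        using isom[OF b] isom[OF g] isom[OF h] unit[OF g] by (simp add: barr_simps)
      thus ?thesis
        using isometries_bprod[OF isometry_square(2)[OF g] h] by (auto simp: orb_def)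
    qed
    ultimately show ?thesis unfolding orb_def[of "b \<odot> g"] orb_def[of b] by (auto simp: orb_def)
  qed
  define T where "T = rep ` isometries r q"
  have T_sub: "T \<subseteq> isometries r q"
  proof
    fix t assume "t \<in> T"
    then obtain b where "b \<in> isometries r q" "t \<in> orb b" using rep by (auto simp: T_def)
    thus "t \<in> isometries r q" using isometries_bprod by (auto simp: orb_def)
  qed
  have rep_rep: "rep t = t" if "t \<in> T" for t
  proof -
    obtain b where b: "b \<in> isometries r q" "t = rep b" using \<open>t \<in> T\<close> by (auto simp: T_def)
    then obtain g where "g \<in> ?G" "t = b \<odot> g" using rep[of b] by (auto simp: orb_def)
    hence "orb t = orb b" using orb_eq b by simp
    thus ?thesis unfolding b(2) rep_def by simp
  qed
  have inj: "t = t' \<and> g = g'"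
    if "t \<in> T" "t' \<in> T" "g \<in> ?G" "g' \<in> ?G" "t \<odot> g = t' \<odot> g'" for t t' g g'
  proof -
    have t: "t \<in> isometries r q" "t' \<in> isometries r q" using that T_sub by auto
    have "orb t = orb t'" using orb_eq t that by metis
    hence tt: "t = t'" using rep_rep that(1,2) by (metis rep_def)
    have "g = bstar t \<odot> (t \<odot> g)" using isom[OF t(1)] isom[OF that(3)] by simp
    also have "\<dots> = g'" unfolding that(5) unfolding tt using isom[OF t(2)] isom[OF that(4)] by simp
    finally show ?thesis using tt by simp
  qed
  have surj: "\<exists>t\<in>T. \<exists>g\<in>?G. b = t \<odot> g" if b: "b \<in> isometries r q" for b
  proof -
    obtain g where g: "g \<in> ?G" "rep b = b \<odot> g" using rep[of b] by (auto simp: orb_def)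
    have "b = rep b \<odot> bstar g"
      unfolding g(2) using isom[OF b] isom[OF g(1)] unit[OF g(1)] by (simp add: barr_simps)
    thus ?thesis using isometry_square(2)[OF g(1)] b by (auto simp: T_def)
  qed
  have "bij_betw (\<lambda>(t, g). t \<odot> g) (T \<times> ?G) (isometries r q)"
    unfolding bij_betw_def
  proof
    show "inj_on (\<lambda>(t, g). t \<odot> g) (T \<times> ?G)" using inj by (auto simp: inj_on_def)
    show "(\<lambda>(t, g). t \<odot> g) ` (T \<times> ?G) = isometries r q"
    proof (intro equalityI subsetI)
      fix b assume "b \<in> isometries r q"
      then obtain t g where "t \<in> T" "g \<in> ?G" "b = t \<odot> g" using surj by blast
      thus "b \<in> (\<lambda>(t, g). t \<odot> g) ` (T \<times> ?G)" by force
    next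
      fix b assume "b \<in> (\<lambda>(t, g). t \<odot> g) ` (T \<times> ?G)"
      thus "b \<in> isometries r q" using T_sub isometries_bprod by auto
    qed
  qed
  with T_sub show thesis by (rule that)
qed

section \<open>Transport of group structure and comparison with the symmetric group\<close>

lemma group_on_isoI:
  assumes G: "group G" and bij: "bij_betw \<phi> C (carrier G)"
    and closed: "\<And>x y. x \<in> C \<Longrightarrow> y \<in> C \<Longrightarrow> f x y \<in> C"
    and hom: "\<And>x y. x \<in> C \<Longrightarrow> y \<in> C \<Longrightarrow> \<phi> (f x y) = \<phi> x \<otimes>\<^bsub>G\<^esub> \<phi> y"
  shows "group_on_iso C f G"
proof -
  interpret G: group G by (rule G)
  define \<psi> where "\<psi> = inv_into C \<phi>"
  let ?H = "\<lparr>carrier = C, mult = f, one = \<psi> \<one>\<^bsub>G\<^esub>\<rparr>"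
  have \<psi>: "\<psi> g \<in> C" "\<phi> (\<psi> g) = g" if "g \<in> carrier G" for g
    using bij that by (auto simp: \<psi>_def bij_betw_def inv_into_into f_inv_into_f)
  have \<phi>: "\<phi> x \<in> carrier G" if "x \<in> C" for x
    using bij that by (auto simp: bij_betw_def)
  have inj: "x = y" if "x \<in> C" "y \<in> C" "\<phi> x = \<phi> y" for x y
    using bij that by (auto simp: bij_betw_def inj_on_def)
  have "group ?H"
  proof (rule groupI)
    fix x y z assume "x \<in> carrier ?H" "y \<in> carrier ?H" "z \<in> carrier ?H"
    thus "x \<otimes>\<^bsub>?H\<^esub> y \<otimes>\<^bsub>?H\<^esub> z = x \<otimes>\<^bsub>?H\<^esub> (y \<otimes>\<^bsub>?H\<^esub> z)"
      using closed hom \<phi> by (intro inj) (simp_all add: G.m_assoc)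
  next
    fix x assume "x \<in> carrier ?H"
    thus "\<one>\<^bsub>?H\<^esub> \<otimes>\<^bsub>?H\<^esub> x = x"
      using closed hom \<phi> \<psi> by (intro inj) simp_all
  next
    fix x assume x: "x \<in> carrier ?H"
    hence i: "inv\<^bsub>G\<^esub> \<phi> x \<in> carrier G" using \<phi> by simp
    have "f (\<psi> (inv\<^bsub>G\<^esub> \<phi> x)) x = \<psi> \<one>\<^bsub>G\<^esub>"
      using x closed hom \<phi> \<psi>[OF i] \<psi>[OF G.one_closed] by (intro inj) simp_all
    thus "\<exists>y\<in>carrier ?H. y \<otimes>\<^bsub>?H\<^esub> x = \<one>\<^bsub>?H\<^esub>" using \<psi>(1)[OF i] by auto
  qed (use closed \<psi> in simp_all)
  moreover have "\<phi> \<in> iso ?H G" using bij hom \<phi> by (simp add: iso_def hom_def Pi_def)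
  ultimately show ?thesis unfolding group_on_iso_def is_iso_def by blast
qed

text \<open>Needed to pass from \<open>bprod\<close> to the sandwich operation with an identity in
  the middle: their agreement is established on \<open>brauer r r\<close>, not for arbitrary sets of
  sets.\<close>

lemma is_group_on_cong:
  assumes "\<And>x y. x \<in> C \<Longrightarrow> y \<in> C \<Longrightarrow> f x y = g x y"
  shows "is_group_on C f \<longleftrightarrow> is_group_on C g"
proof -
  have *: "group \<lparr>carrier = C, mult = g, one = e\<rparr>"
    if eq: "\<And>x y. x \<in> C \<Longrightarrow> y \<in> C \<Longrightarrow> f x y = g x y" and G: "group \<lparr>carrier = C, mult = f, one = e\<rparr>"
    for f g e
  proof -
    interpret G: group "\<lparr>carrier = C, mult = f, one = e\<rparr>" by (rule G)
    show ?thesis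
      using G.m_closed G.m_assoc G.one_closed G.l_one G.l_inv_ex
      by (intro groupI) (simp_all add: eq[symmetric])
  qed
  show ?thesis
    unfolding is_group_on_def using *[of f g] *[of g f] assms by metis
qed

definition perm_of :: "nat \<Rightarrow> brauer_partition \<Rightarrow> nat \<Rightarrow> nat" where
  "perm_of q = inv_into {\<pi>. \<pi> permutes {1..q}} (perm_part q)"

lemma bij_betw_perm_of: "bij_betw (perm_of q) (isometries q q) (carrier (sym_group q))"
  unfolding perm_of_def sym_group_def using bij_betw_inv_into[OF bij_betw_perm_part] by simp

lemma perm_of_bprod:
  assumes "g \<in> isometries q q" "h \<in> isometries q q"
  shows "perm_of q (g \<odot> h) = perm_of q g \<otimes>\<^bsub>sym_group q\<^esub> perm_of q h"
proof -
  have p: "perm_of q g permutes {1..q}" "perm_part q (perm_of q g) = g" if "g \<in> isometries q q" for g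
    using that bij_betw_perm_of[of q] bij_betw_inv_into_right[OF bij_betw_perm_part, of g q]
    by (auto simp: bij_betw_def sym_group_def perm_of_def)
  have "g \<odot> h = perm_part q (perm_of q g \<circ> perm_of q h)"
    using bprod_perm_part[OF p(1)[OF assms(1)] p(1)[OF assms(2)]] p(2) assms by simp
  thus ?thesis
    using bij_betw_inv_into_left[OF bij_betw_perm_part, of "perm_of q g \<circ> perm_of q h" q]
      permutes_compose[OF p(1)[OF assms(2)] p(1)[OF assms(1)]]
    by (simp add: perm_of_def sym_group_def)
qed

text \<open>After multiplication by \<open>\<kappa>\<close> and \<open>\<tau>\<close> both kinds of
  factors lie in \<open>isometries r q\<close>, so one \<open>T\<close> normalises both. It is kept
  when the sandwich is replaced by the identity, which makes coordinates in the two semigroups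
  directly comparable.\<close>

locale coordinates = sandwich_pair m n r \<kappa> \<tau> \<sigma>
  for m n r :: nat and \<kappa> \<tau> \<sigma> :: brauer_partition +
  fixes q :: nat and T :: "brauer_partition set"
  assumes T_sub: "T \<subseteq> isometries r q"
    and T_bij: "bij_betw (\<lambda>(t, g). t \<odot> g) (T \<times> isometries q q) (isometries r q)"
begin

abbreviation G where "G \<equiv> isometries q q"

definition rows :: "brauer_partition set" where
  "rows = {a \<in> brauer m q. \<kappa> \<odot> a \<in> T}"

definition cols :: "brauer_partition set" where
  "cols = {c \<in> brauer n q. \<tau> \<odot> c \<in> T}"

definition D :: "brauer_partition set" where
  "D = {\<alpha> \<in> regular_elements B (\<star>). brank \<alpha> = q}"

definition coord :: "brauer_partition \<times> brauer_partition \<times> brauer_partition \<Rightarrow> brauer_partition" where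
  "coord = (\<lambda>(a, c, g). a \<odot> g \<odot> bstar c)"

lemma dual_coordinates: "coordinates n m r \<tau> \<kappa> (bstar \<sigma>) q T"
  using dual T_sub T_bij by (simp add: coordinates_def coordinates_axioms_def)

lemma T_unique:
  "t \<in> T \<Longrightarrow> t' \<in> T \<Longrightarrow> g \<in> G \<Longrightarrow> g' \<in> G \<Longrightarrow> t \<odot> g = t' \<odot> g' \<Longrightarrow> t = t' \<and> g = g'"
  using bij_betw_imp_inj_on[OF T_bij] by (auto simp: inj_on_def)

lemma rows_upper: "a \<in> rows \<Longrightarrow> a \<in> upper q"
  using T_sub by (auto simp: rows_def upper_def)

text \<open>With \<open>\<kappa> \<odot> b = t \<odot> g\<close> and \<open>t\<close> in
  \<open>T\<close>, correcting \<open>b\<close> by \<open>bstar g\<close> normalises it.\<close>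

lemma upper_decomp:
  assumes b: "b \<in> upper q"
  obtains a g where "a \<in> rows" "g \<in> G" "b = a \<odot> g"
proof -
  note s = isom[OF upperD(2)[OF b]]
  have "\<kappa> \<odot> b \<in> (\<lambda>(t, g). t \<odot> g) ` (T \<times> G)"
    using upperD(1)[OF b] T_bij by (simp add: bij_betw_def)
  then obtain t g where tg: "t \<in> T" "g \<in> G" "\<kappa> \<odot> b = t \<odot> g" by auto
  have t: "t \<in> isometries r q" using tg(1) T_sub by blast
  note s = s isom[OF tg(2)] unit[OF tg(2)] isom[OF t]
  have "\<kappa> \<odot> (b \<odot> bstar g) = (\<kappa> \<odot> b) \<odot> bstar g" by (simp add: cat s)
  also have "\<dots> = t" unfolding tg(3) by (simp add: cat s)
  finally have "b \<odot> bstar g \<in> rows" using tg(1) by (simp add: rows_def cat s)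
  moreover have "b = b \<odot> bstar g \<odot> g" by (simp add: cat s)
  ultimately show thesis using that tg(2) by blast
qed

end

context coordinates
begin

lemma dual_rows: "coordinates.rows n \<tau> q T = cols"
  by (simp add: coordinates.rows_def[OF dual_coordinates] cols_def)

lemmas cols_lower = coordinates.rows_upper[OF dual_coordinates, unfolded dual_rows dual_upper]
lemmas lower_decomp = coordinates.upper_decomp[OF dual_coordinates, unfolded dual_rows dual_upper]

lemma D_eq: "D = {a \<odot> bstar c |a c. a \<in> upper q \<and> c \<in> lower q}"
proof (intro equalityI subsetI)
  fix \<alpha> assume "\<alpha> \<in> D"
  hence "\<alpha> \<in> regular_elements B (\<star>)" "brank \<alpha> = q" by (auto simp: D_def)
  then obtain a c where "a \<in> upper q" "c \<in> lower q" "\<alpha> = a \<odot> bstar c"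
    using regular_elementE by metis
  thus "\<alpha> \<in> {a \<odot> bstar c |a c. a \<in> upper q \<and> c \<in> lower q}" by blast
next
  fix \<alpha> assume "\<alpha> \<in> {a \<odot> bstar c |a c. a \<in> upper q \<and> c \<in> lower q}"
  then obtain a c where ac: "a \<in> upper q" "c \<in> lower q" "\<alpha> = a \<odot> bstar c" by blast
  show "\<alpha> \<in> D"
    using regular_iff[OF upperD(2)[OF ac(1)] lowerD(2)[OF ac(2)]]
      brank_bprod_bstar[OF upperD(2)[OF ac(1)] lowerD(2)[OF ac(2)]] ac
    by (simp add: D_def)
qed

lemma D_sub: "D \<subseteq> B"
  by (auto simp: D_def regular_elements_def)

text \<open>The unit can be pushed into either factor. The first form leaves the row visible, for
  the right relation; the second leaves the column visible, for the left one.\<close>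

lemma coord_unit:
  assumes "a \<in> upper q" "c \<in> lower q" "g \<in> G"
  shows "coord (a, c, g) = a \<odot> bstar (c \<odot> bstar g)" "coord (a, c, g) = (a \<odot> g) \<odot> bstar c"
  using isom[OF upperD(2)[OF assms(1)]] isom[OF lowerD(2)[OF assms(2)]] isom[OF assms(3)]
  by (simp_all add: coord_def cat)

lemma bij_betw_coord: "bij_betw coord (rows \<times> cols \<times> G) D"
  unfolding bij_betw_def
proof
  show "inj_on coord (rows \<times> cols \<times> G)"
  proof (rule inj_onI)
    fix z z' assume z: "z \<in> rows \<times> cols \<times> G" "z' \<in> rows \<times> cols \<times> G" "coord z = coord z'"
    obtain a c g a' c' g' where zz: "z = (a, c, g)" "z' = (a', c', g')"
      by (metis prod.exhaust)
    hence a: "a \<in> rows" and c: "c \<in> cols" and g: "g \<in> G"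
      and a': "a' \<in> rows" and c': "c' \<in> cols" and g': "g' \<in> G"
      and eq: "coord (a, c, g) = coord (a', c', g')"
      using z by simp_all
    note s = isom[OF upperD(2)[OF rows_upper[OF a]]] isom[OF upperD(2)[OF rows_upper[OF a']]]
      isom[OF lowerD(2)[OF cols_lower[OF c]]] isom[OF lowerD(2)[OF cols_lower[OF c']]]
      isom[OF g] isom[OF g'] unit[OF g] unit[OF g']
    \<comment> \<open>\<open>k\<close> is the unit relating the two left factors,
      \<open>a = a' \<odot> k\<close>. Since both are normalised by \<open>T\<close>, it must be
      trivial.\<close>
    define k where "k = g' \<odot> (bstar c' \<odot> c) \<odot> bstar g"
    have k_arr: "barr k" "bdom k = q" "bcod k = q" by (simp_all add: k_def cat s)
    have "a = coord (a, c, g) \<odot> c \<odot> bstar g" by (simp add: coord_def cat s)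
    also have "\<dots> = a' \<odot> k" unfolding eq by (simp add: coord_def k_def cat s)
    finally have a_eq: "a = a' \<odot> k" .
    have "(bstar a \<odot> a') \<odot> k = bstar a \<odot> (a' \<odot> k)" by (simp add: cat s k_arr)
    also have "\<dots> = bid q" unfolding a_eq[symmetric] by (simp add: s)
    finally have k: "k \<in> G"
      by (intro isometries_leftI[of "bstar a \<odot> a'"]) (simp_all add: cat s k_arr)
    have "(\<kappa> \<odot> a) \<odot> bid q = (\<kappa> \<odot> a') \<odot> k" unfolding a_eq by (simp add: cat s k_arr)
    hence "k = bid q"
      using T_unique[of "\<kappa> \<odot> a" "\<kappa> \<odot> a'" "bid q" k] a a' k by (simp add: rows_def)
    hence aa: "a = a'" using a_eq by (simp add: cat s)
    have "c \<odot> bstar g = bstar (bstar a \<odot> coord (a, c, g))" by (simp add: coord_def cat s)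
    also have "\<dots> = c' \<odot> bstar g'" unfolding eq unfolding aa by (simp add: coord_def cat s)
    finally have cg: "c \<odot> bstar g = c' \<odot> bstar g'" .
    have "(\<tau> \<odot> c) \<odot> bstar g = \<tau> \<odot> (c \<odot> bstar g)" by (simp add: cat s)
    also have "\<dots> = (\<tau> \<odot> c') \<odot> bstar g'" unfolding cg by (simp add: cat s)
    finally have "bstar g = bstar g'"
      using T_unique[of "\<tau> \<odot> c" "\<tau> \<odot> c'" "bstar g" "bstar g'"] c c' isometry_square(2)[OF g]
        isometry_square(2)[OF g'] by (simp add: cols_def)
    hence gg: "g = g'" by (metis bstar_bstar)
    have "c = c \<odot> bstar g \<odot> g" by (simp add: cat s)
    also have "\<dots> = c'" unfolding cg unfolding gg by (simp add: cat s)
    finally show "z = z'" using aa gg zz by simp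
  qed
  show "coord ` (rows \<times> cols \<times> G) = D"
  proof (intro equalityI subsetI)
    fix \<alpha> assume "\<alpha> \<in> coord ` (rows \<times> cols \<times> G)"
    then obtain a c g where *: "a \<in> rows" "c \<in> cols" "g \<in> G" "\<alpha> = coord (a, c, g)" by auto
    hence "\<alpha> = (a \<odot> g) \<odot> bstar c" using coord_unit(2) rows_upper cols_lower by simp
    moreover have "a \<odot> g \<in> upper q" using * upper_unit rows_upper by simp
    ultimately show "\<alpha> \<in> D" unfolding D_eq using cols_lower[OF *(2)] by blast
  next
    fix \<alpha> assume "\<alpha> \<in> D"
    then obtain b d where bd: "b \<in> upper q" "d \<in> lower q" "\<alpha> = b \<odot> bstar d" unfolding D_eq by blast
    obtain a g where a: "a \<in> rows" and g: "g \<in> G" and b_eq: "b = a \<odot> g"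
      by (rule upper_decomp[OF bd(1)])
    obtain c h where c: "c \<in> cols" and h: "h \<in> G" and d_eq: "d = c \<odot> h"
      by (rule lower_decomp[OF bd(2)])
    have "\<alpha> = coord (a, c, g \<odot> bstar h)"
      using isom[OF upperD(2)[OF rows_upper[OF a]]] isom[OF lowerD(2)[OF cols_lower[OF c]]]
        isom[OF g] isom[OF h]
      by (simp add: bd(3) b_eq d_eq coord_def cat)
    moreover have "g \<odot> bstar h \<in> G" by (rule isometries_bprod[OF g isometry_square(2)[OF h]])
    ultimately show "\<alpha> \<in> coord ` (rows \<times> cols \<times> G)" using a c by blast
  qed
qed

section \<open>Green's classes and products in coordinates\<close>

definition row :: "brauer_partition \<Rightarrow> brauer_partition" where
  "row \<alpha> = fst (inv_into (rows \<times> cols \<times> G) coord \<alpha>)"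

definition col :: "brauer_partition \<Rightarrow> brauer_partition" where
  "col \<alpha> = fst (snd (inv_into (rows \<times> cols \<times> G) coord \<alpha>))"

definition grp :: "brauer_partition \<Rightarrow> brauer_partition" where
  "grp \<alpha> = snd (snd (inv_into (rows \<times> cols \<times> G) coord \<alpha>))"

lemma coordsD:
  assumes "\<alpha> \<in> D"
  shows "row \<alpha> \<in> rows" "col \<alpha> \<in> cols" "grp \<alpha> \<in> G" "coord (row \<alpha>, col \<alpha>, grp \<alpha>) = \<alpha>"
proof -
  let ?i = "inv_into (rows \<times> cols \<times> G) coord \<alpha>"
  have i: "?i = (row \<alpha>, col \<alpha>, grp \<alpha>)" by (simp add: row_def col_def grp_def)
  have "?i \<in> rows \<times> cols \<times> G"
    by (rule inv_into_into) (use assms bij_betw_coord in \<open>simp add: bij_betw_def\<close>)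
  thus "row \<alpha> \<in> rows" "col \<alpha> \<in> cols" "grp \<alpha> \<in> G" unfolding i by auto
  show "coord (row \<alpha>, col \<alpha>, grp \<alpha>) = \<alpha>"
    unfolding i[symmetric] by (rule bij_betw_inv_into_right[OF bij_betw_coord assms])
qed

lemma coord_coords:
  assumes "a \<in> rows" "c \<in> cols" "g \<in> G"
  shows "coord (a, c, g) \<in> D" "row (coord (a, c, g)) = a" "col (coord (a, c, g)) = c"
    "grp (coord (a, c, g)) = g"
  using bij_betw_inv_into_left[OF bij_betw_coord, of "(a, c, g)"] bij_betw_apply[OF bij_betw_coord]
    assms by (auto simp: row_def col_def grp_def)

lemma D_cases:
  assumes "\<alpha> \<in> D"
  obtains a c g where "a \<in> rows" "c \<in> cols" "g \<in> G" "\<alpha> = coord (a, c, g)"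
  using coordsD[OF assms] that by metis

lemma R_class:
  assumes "\<alpha> \<in> D"
  shows "greenR B (\<star>) `` {\<alpha>} = {\<beta> \<in> D. row \<beta> = row \<alpha>}"
proof -
  obtain a c g where *: "a \<in> rows" "c \<in> cols" "g \<in> G" and \<alpha>: "\<alpha> = coord (a, c, g)"
    by (rule D_cases[OF assms])
  note a = rows_upper[OF *(1)] and c = cols_lower[OF *(2)]
  have "greenR B (\<star>) `` {\<alpha>} = (\<lambda>d. a \<odot> bstar d) ` lower q"
    unfolding \<alpha> coord_unit(1)[OF a c *(3)]
    by (rule greenR_class[OF a lower_unit[OF c isometry_square(2)[OF *(3)]]])
  also have "\<dots> = {\<beta> \<in> D. row \<beta> = a}"
  proof (intro equalityI subsetI)
    fix \<beta> assume "\<beta> \<in> (\<lambda>d. a \<odot> bstar d) ` lower q"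
    then obtain d where d: "d \<in> lower q" "\<beta> = a \<odot> bstar d" by blast
    obtain c' h where c': "c' \<in> cols" and h: "h \<in> G" and d_eq: "d = c' \<odot> h"
      by (rule lower_decomp[OF d(1)])
    have "\<beta> = coord (a, c', bstar h)"
      unfolding d(2) d_eq using coord_unit(1)[OF a cols_lower[OF c'] isometry_square(2)[OF h]] by simp
    thus "\<beta> \<in> {\<beta> \<in> D. row \<beta> = a}"
      using coord_coords[OF *(1) c' isometry_square(2)[OF h]] by simp
  next
    fix \<beta> assume "\<beta> \<in> {\<beta> \<in> D. row \<beta> = a}"
    hence \<beta>: "\<beta> \<in> D" "row \<beta> = a" by auto
    obtain b c' g' where b: "b \<in> rows" "c' \<in> cols" "g' \<in> G" "\<beta> = coord (b, c', g')"
      by (rule D_cases[OF \<beta>(1)])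
    hence "\<beta> = a \<odot> bstar (c' \<odot> bstar g')"
      using \<beta>(2) coord_coords(2)[OF b(1-3)] coord_unit(1)[OF rows_upper cols_lower] by simp
    thus "\<beta> \<in> (\<lambda>d. a \<odot> bstar d) ` lower q"
      using lower_unit[OF cols_lower[OF b(2)] isometry_square(2)[OF b(3)]] by blast
  qed
  finally show ?thesis using coord_coords(2)[OF *] \<alpha> by simp
qed

lemma L_class:
  assumes "\<alpha> \<in> D"
  shows "greenL B (\<star>) `` {\<alpha>} = {\<beta> \<in> D. col \<beta> = col \<alpha>}"
proof -
  obtain a c g where *: "a \<in> rows" "c \<in> cols" "g \<in> G" and \<alpha>: "\<alpha> = coord (a, c, g)"
    by (rule D_cases[OF assms])
  note a = rows_upper[OF *(1)] and c = cols_lower[OF *(2)]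
  have "greenL B (\<star>) `` {\<alpha>} = (\<lambda>b. b \<odot> bstar c) ` upper q"
    unfolding \<alpha> coord_unit(2)[OF a c *(3)]
    by (rule greenL_class[OF upper_unit[OF a *(3)] c])
  also have "\<dots> = {\<beta> \<in> D. col \<beta> = c}"
  proof (intro equalityI subsetI)
    fix \<beta> assume "\<beta> \<in> (\<lambda>b. b \<odot> bstar c) ` upper q"
    then obtain b where b: "b \<in> upper q" "\<beta> = b \<odot> bstar c" by blast
    obtain a' h where a': "a' \<in> rows" and h: "h \<in> G" and b_eq: "b = a' \<odot> h"
      by (rule upper_decomp[OF b(1)])
    have "\<beta> = coord (a', c, h)"
      unfolding b(2) b_eq using coord_unit(2)[OF rows_upper[OF a'] c h] by simp
    thus "\<beta> \<in> {\<beta> \<in> D. col \<beta> = c}" using coord_coords[OF a' *(2) h] by simp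
  next
    fix \<beta> assume "\<beta> \<in> {\<beta> \<in> D. col \<beta> = c}"
    hence \<beta>: "\<beta> \<in> D" "col \<beta> = c" by auto
    obtain b c' g' where b: "b \<in> rows" "c' \<in> cols" "g' \<in> G" "\<beta> = coord (b, c', g')"
      by (rule D_cases[OF \<beta>(1)])
    hence "\<beta> = b \<odot> g' \<odot> bstar c"
      using \<beta>(2) coord_coords(3)[OF b(1-3)] coord_unit(2)[OF rows_upper cols_lower] by simp
    thus "\<beta> \<in> (\<lambda>b. b \<odot> bstar c) ` upper q"
      using upper_unit[OF rows_upper[OF b(1)] b(3)] by blast
  qed
  finally show ?thesis using coord_coords(3)[OF *] \<alpha> by simp
qed

lemma H_class:
  assumes "\<alpha> \<in> D"
  shows "greenH B (\<star>) `` {\<alpha>} = {\<beta> \<in> D. (row \<beta>, col \<beta>) = (row \<alpha>, col \<alpha>)}"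
proof -
  have "greenH B (\<star>) `` {\<alpha>} = greenR B (\<star>) `` {\<alpha>} \<inter> greenL B (\<star>) `` {\<alpha>}"
    unfolding greenH_def by blast
  thus ?thesis unfolding R_class[OF assms] L_class[OF assms] by auto
qed

lemma D_class:
  assumes \<alpha>: "\<alpha> \<in> D"
  shows "greenD B (\<star>) `` {\<alpha>} = D"
proof -
  have "greenD B (\<star>) `` {\<alpha>} = greenL B (\<star>) `` (greenR B (\<star>) `` {\<alpha>})"
    unfolding greenD_def by (rule relcomp_Image)
  also have "\<dots> = (\<Union>\<gamma>\<in>{\<gamma> \<in> D. row \<gamma> = row \<alpha>}. greenL B (\<star>) `` {\<gamma>})"
    unfolding R_class[OF \<alpha>] by blast
  also have "\<dots> = (\<Union>\<gamma>\<in>{\<gamma> \<in> D. row \<gamma> = row \<alpha>}. {\<beta> \<in> D. col \<beta> = col \<gamma>})"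
    by (intro SUP_cong refl L_class) blast
  also have "\<dots> = D"
  proof (intro equalityI subsetI)
    fix \<beta> assume \<beta>: "\<beta> \<in> D"
    \<comment> \<open>The intermediate element takes the row of \<open>\<alpha>\<close> and the
      column of \<open>\<beta>\<close>; any unit would do, and the identity is taken.\<close>
    note c = coord_coords[OF coordsD(1)[OF \<alpha>] coordsD(2)[OF \<beta>] bid_isometry]
    show "\<beta> \<in> (\<Union>\<gamma>\<in>{\<gamma> \<in> D. row \<gamma> = row \<alpha>}. {\<beta> \<in> D. col \<beta> = col \<gamma>})"
      using c \<beta> by (intro UN_I[of "coord (row \<alpha>, col \<beta>, bid q)"]) simp_all
  qed blast
  finally show ?thesis .
qed

text \<open>This is multiplication in a Rees matrix semigroup, with an entry that depends on
  \<open>\<tau> \<odot> c\<close> and \<open>\<kappa> \<odot> a'\<close> alone. The entry need not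
  be a unit, so the right-hand side is a formal use of \<open>coord\<close> that may leave
  \<open>D\<close>.\<close>

lemma coord_mult:
  assumes a: "a \<in> rows" and c: "c \<in> cols" and g: "g \<in> G"
    and a': "a' \<in> rows" and c': "c' \<in> cols" and g': "g' \<in> G"
  shows "coord (a, c, g) \<star> coord (a', c', g')
    = coord (a, c', g \<odot> (bstar (\<tau> \<odot> c) \<odot> (\<kappa> \<odot> a')) \<odot> g')"
  using isom[OF upperD(2)[OF rows_upper[OF a]]] isom[OF upperD(2)[OF rows_upper[OF a']]]
      isom[OF lowerD(2)[OF cols_lower[OF c]]] isom[OF lowerD(2)[OF cols_lower[OF c']]]
      isom[OF g] isom[OF g']
  by (simp add: coord_def sandwich_def cat)

text \<open>Inside the class, products act on the group coordinate as \<open>g p g'\<close>, and the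
  shift of \<open>g\<close> to \<open>g p\<close> turns this into multiplication in
  \<open>G\<close>.\<close>

lemma H_class_group:
  assumes \<alpha>: "\<alpha> \<in> D" and p: "bstar (\<tau> \<odot> col \<alpha>) \<odot> (\<kappa> \<odot> row \<alpha>) \<in> G"
  shows "group_on_iso (greenH B (\<star>) `` {\<alpha>}) (\<star>) (sym_group q)"
proof (rule group_on_isoI)
  let ?p = "bstar (\<tau> \<odot> col \<alpha>) \<odot> (\<kappa> \<odot> row \<alpha>)" and ?H = "greenH B (\<star>) `` {\<alpha>}"
  note \<alpha>c = coordsD[OF \<alpha>]
  show "group (sym_group q)" by (rule sym_group_is_group)
  have H: "\<beta> \<in> ?H \<longleftrightarrow> (\<exists>g\<in>G. \<beta> = coord (row \<alpha>, col \<alpha>, g))" for \<beta>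
    unfolding H_class[OF \<alpha>] using coordsD[of \<beta>] coord_coords[OF \<alpha>c(1,2)] by auto metis
  have grp: "grp \<beta> \<in> G" "\<beta> = coord (row \<alpha>, col \<alpha>, grp \<beta>)" if "\<beta> \<in> ?H" for \<beta>
    using that coord_coords[OF \<alpha>c(1,2)] unfolding H by auto
  have "bij_betw (\<lambda>\<beta>. grp \<beta> \<odot> ?p) ?H G"
  proof (rule bij_betwI')
    fix x y assume xy: "x \<in> ?H" "y \<in> ?H"
    show "grp x \<odot> ?p = grp y \<odot> ?p \<longleftrightarrow> x = y"
    proof
      assume eq: "grp x \<odot> ?p = grp y \<odot> ?p"
      have "grp z \<odot> ?p \<odot> bstar ?p = grp z" if "z \<in> ?H" for z
        using barr_assoc[of "grp z" ?p "bstar ?p"] unit(1)[OF p] isom[OF p] isom[OF grp(1)[OF that]]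
          barr_bstar[of ?p] by (simp add: barr_bid_right)
      hence "grp x = grp y" using eq xy by metis
      thus "x = y" using grp(2) xy by metis
    qed simp
  next
    fix x assume "x \<in> ?H"
    thus "grp x \<odot> ?p \<in> G" using isometries_bprod[OF grp(1) p] by blast
  next
    fix h assume h: "h \<in> G"
    let ?g = "h \<odot> bstar ?p"
    have g: "?g \<in> G" by (rule isometries_bprod[OF h isometry_square(2)[OF p]])
    have "?g \<odot> ?p = h"
      using barr_assoc[of h "bstar ?p" ?p] isom[OF p] isom[OF h] barr_bstar[of ?p]
      by (simp add: barr_bid_right)
    hence "h = grp (coord (row \<alpha>, col \<alpha>, ?g)) \<odot> ?p" using coord_coords(4)[OF \<alpha>c(1,2) g] by simp
    thus "\<exists>x\<in>?H. h = grp x \<odot> ?p" using H g by blast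
  qed
  thus "bij_betw (\<lambda>\<beta>. perm_of q (grp \<beta> \<odot> ?p)) ?H (carrier (sym_group q))"
    using bij_betw_trans[OF _ bij_betw_perm_of] by (simp add: comp_def)
  fix x y assume xy: "x \<in> ?H" "y \<in> ?H"
  note gx = grp(1)[OF xy(1)] and gy = grp(1)[OF xy(2)]
  have gpg: "grp x \<odot> ?p \<odot> grp y \<in> G" by (rule isometries_bprod[OF isometries_bprod[OF gx p] gy])
  have m: "x \<star> y = coord (row \<alpha>, col \<alpha>, grp x \<odot> ?p \<odot> grp y)"
    using coord_mult[OF \<alpha>c(1,2) gx \<alpha>c(1,2) gy] grp(2)[OF xy(1)] grp(2)[OF xy(2)] by simp
  show "x \<star> y \<in> ?H" unfolding H m using gpg by blast
  have "grp (x \<star> y) \<odot> ?p = (grp x \<odot> ?p) \<odot> (grp y \<odot> ?p)"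
    unfolding m coord_coords(4)[OF \<alpha>c(1,2) gpg]
    using isom[OF gx] isom[OF gy] isom[OF p] isom[OF isometries_bprod[OF gx p]]
    by (intro barr_assoc) simp_all
  thus "perm_of q (grp (x \<star> y) \<odot> ?p)
      = perm_of q (grp x \<odot> ?p) \<otimes>\<^bsub>sym_group q\<^esub> perm_of q (grp y \<odot> ?p)"
    using perm_of_bprod[OF isometries_bprod[OF gx p] isometries_bprod[OF gy p]] by simp
qed

text \<open>An idempotent in the class gives \<open>g p g = g\<close> with \<open>g\<close> a unit,
  so \<open>p\<close> is the inverse of \<open>g\<close>.\<close>

lemma H_class_is_group_iff:
  assumes \<alpha>: "\<alpha> \<in> D"
  shows "is_group_on (greenH B (\<star>) `` {\<alpha>}) (\<star>) \<longleftrightarrow> bstar (\<tau> \<odot> col \<alpha>) \<odot> (\<kappa> \<odot> row \<alpha>) \<in> G"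
proof
  let ?p = "bstar (\<tau> \<odot> col \<alpha>) \<odot> (\<kappa> \<odot> row \<alpha>)" and ?H = "greenH B (\<star>) `` {\<alpha>}"
  assume "is_group_on ?H (\<star>)"
  then obtain e where e: "group \<lparr>carrier = ?H, mult = (\<star>), one = e\<rparr>" by (auto simp: is_group_on_def)
  interpret E: group "\<lparr>carrier = ?H, mult = (\<star>), one = e\<rparr>" by (rule e)
  have eH: "e \<in> D" "row e = row \<alpha>" "col e = col \<alpha>"
    using E.one_closed unfolding H_class[OF \<alpha>] by simp_all
  note c = coordsD[OF eH(1), unfolded eH(2,3)]
  note s = isom[OF upperD(2)[OF rows_upper[OF c(1)]]] isom[OF lowerD(2)[OF cols_lower[OF c(2)]]]
    isom[OF c(3)] unit[OF c(3)]
  have p_arr: "barr ?p" "bdom ?p = q" "bcod ?p = q" by (simp_all add: cat s)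
  have "e = e \<star> e" using E.l_one[of e] E.one_closed by simp
  also have "\<dots> = coord (row \<alpha>, col \<alpha>, grp e \<odot> ?p \<odot> grp e)"
    using coord_mult[OF c(1-3) c(1-3)] c(4) by simp
  finally have "bstar (row \<alpha>) \<odot> e \<odot> col \<alpha>
    = bstar (row \<alpha>) \<odot> coord (row \<alpha>, col \<alpha>, grp e \<odot> ?p \<odot> grp e) \<odot> col \<alpha>" by simp
  \<comment> \<open>The third entry is extracted by compression between the two isometries, because
    uniqueness of coordinates applies only to units and \<open>p\<close> is not yet known to be
    one.\<close>
  moreover have "bstar (row \<alpha>) \<odot> coord (row \<alpha>, col \<alpha>, h) \<odot> col \<alpha> = h"
    if "barr h" "bdom h = q" "bcod h = q" for h
    using that by (simp add: coord_def cat s)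
  ultimately have gpg: "grp e \<odot> ?p \<odot> grp e = grp e"
    using c(4) by (metis barr_bprod p_arr s(11-13))
  have "?p = bstar (grp e) \<odot> (grp e \<odot> ?p \<odot> grp e) \<odot> bstar (grp e)"
    using p_arr by (simp add: barr_simps s del: barr_bstar_bprod)
  also have "\<dots> = bstar (grp e)" unfolding gpg by (simp add: cat s)
  finally show "?p \<in> G" using isometry_square(2)[OF c(3)] by simp
next
  assume "bstar (\<tau> \<odot> col \<alpha>) \<odot> (\<kappa> \<odot> row \<alpha>) \<in> G"
  from H_class_group[OF \<alpha> this] show "is_group_on (greenH B (\<star>) `` {\<alpha>}) (\<star>)"
    by (auto simp: group_on_iso_def is_group_on_def)
qed

lemma card_H_class:
  assumes \<alpha>: "\<alpha> \<in> D"
  shows "card (greenH B (\<star>) `` {\<alpha>}) = fact q"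
proof -
  note \<alpha>c = coordsD[OF \<alpha>]
  have "greenH B (\<star>) `` {\<alpha>} = (\<lambda>g. coord (row \<alpha>, col \<alpha>, g)) ` G"
    unfolding H_class[OF \<alpha>] using coordsD coord_coords[OF \<alpha>c(1,2)] by (auto simp: image_iff) metis
  moreover have "inj_on (\<lambda>g. coord (row \<alpha>, col \<alpha>, g)) G"
    by (rule inj_on_inverseI[of _ grp]) (rule coord_coords(4)[OF \<alpha>c(1,2)])
  ultimately show ?thesis by (simp add: card_image card_isometries_square)
qed

end

section \<open>Counting classes\<close>

lemma greenR_cong:
  assumes "\<And>x y. x \<in> S \<Longrightarrow> y \<in> S \<Longrightarrow> f x y = g x y"
  shows "greenR S f = greenR S g"
proof -
  have "right_ideal S f a = right_ideal S g a" if "a \<in> S" for a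
    using assms[OF that] by (simp add: right_ideal_def)
  thus ?thesis by (auto simp: greenR_def)
qed

lemma greenL_cong:
  assumes "\<And>x y. x \<in> S \<Longrightarrow> y \<in> S \<Longrightarrow> f x y = g x y"
  shows "greenL S f = greenL S g"
proof -
  have "left_ideal S f a = left_ideal S g a" if "a \<in> S" for a
    using assms[OF _ that] by (simp add: left_ideal_def)
  thus ?thesis by (auto simp: greenL_def)
qed

context coordinates
begin

abbreviation P where "P \<equiv> regular_elements (brauer m n) (sandwich \<sigma>)"

text \<open>What \<open>psi\<close> becomes on \<open>brauer m n\<close> once \<open>\<tau>\<close>
  has cancelled against the factor \<open>bstar \<tau>\<close> of \<open>\<sigma>\<close>.\<close>

definition bar :: "brauer_partition \<Rightarrow> brauer_partition" where
  "bar \<alpha> = \<kappa> \<odot> \<alpha> \<odot> bstar \<tau>"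

lemma bar_closed: "\<alpha> \<in> brauer m n \<Longrightarrow> bar \<alpha> \<in> brauer r r"
  by (simp add: bar_def cat)

lemma id_coordinates: "coordinates r r r (bid r) (bid r) (bid r) q T"
  using T_sub T_bij
  by (simp add: coordinates_def coordinates_axioms_def sandwich_pair_def barr_simps)

lemma coords_in_T:
  assumes "\<alpha> \<in> D"
  shows "\<kappa> \<odot> row \<alpha> \<in> T" "\<tau> \<odot> col \<alpha> \<in> T"
  using coordsD[OF assms] by (auto simp: rows_def cols_def)

text \<open>With the identity as sandwich element the coordinates describe \<open>brauer r r\<close> itself, and
  \<open>bar\<close> acts on coordinates.\<close>

lemma hat_classes:
  assumes \<alpha>: "\<alpha> \<in> D"
  shows "hat P bar (greenR (brauer r r) bprod) `` {\<alpha>}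
      = {\<beta> \<in> D. \<kappa> \<odot> row \<beta> = \<kappa> \<odot> row \<alpha>}"
    and "hat P bar (greenL (brauer r r) bprod) `` {\<alpha>}
      = {\<beta> \<in> D. \<tau> \<odot> col \<beta> = \<tau> \<odot> col \<alpha>}"
    and "is_group_on (greenH (brauer r r) bprod `` {bar \<alpha>}) bprod
      \<longleftrightarrow> bstar (\<tau> \<odot> col \<alpha>) \<odot> (\<kappa> \<odot> row \<alpha>) \<in> G"
proof -
  interpret id: coordinates r r r "bid r" "bid r" "bid r" q T by (rule id_coordinates)
  have op: "\<gamma> \<odot> \<delta> = sandwich (bid r) \<gamma> \<delta>" if "\<gamma> \<in> brauer r r" for \<gamma> \<delta>
    using that by (simp add: sandwich_def barr_simps)
  have RL: "greenR (brauer r r) bprod = greenR (brauer r r) (sandwich (bid r))"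
    "greenL (brauer r r) bprod = greenL (brauer r r) (sandwich (bid r))"
    by (intro greenR_cong greenL_cong op; assumption)+
  hence H: "greenH (brauer r r) bprod = greenH (brauer r r) (sandwich (bid r))"
    by (simp add: greenH_def)
  have id_TT: "t \<in> id.rows" "t \<in> id.cols" "bid r \<odot> t = t" if "t \<in> T" for t
    using that T_sub isom[of t r q] by (auto simp: id.rows_def id.cols_def barr_simps)
  have barD: "bar \<beta> \<in> id.D" "id.row (bar \<beta>) = \<kappa> \<odot> row \<beta>" "id.col (bar \<beta>) = \<tau> \<odot> col \<beta>"
    if \<beta>: "\<beta> \<in> D" for \<beta>
  proof -
    note c = coordsD[OF \<beta>]
    note s = isom[OF upperD(2)[OF rows_upper[OF c(1)]]] isom[OF lowerD(2)[OF cols_lower[OF c(2)]]]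
      isom[OF c(3)]
    note T = coords_in_T[OF \<beta>]
    have "bar (coord (row \<beta>, col \<beta>, grp \<beta>)) = id.coord (\<kappa> \<odot> row \<beta>, \<tau> \<odot> col \<beta>, grp \<beta>)"
      by (simp add: bar_def coord_def id.coord_def cat s)
    hence "bar \<beta> = id.coord (\<kappa> \<odot> row \<beta>, \<tau> \<odot> col \<beta>, grp \<beta>)" unfolding c(4) .
    with id.coord_coords[OF id_TT(1)[OF T(1)] id_TT(2)[OF T(2)] c(3)]
    show "bar \<beta> \<in> id.D" "id.row (bar \<beta>) = \<kappa> \<odot> row \<beta>" "id.col (bar \<beta>) = \<tau> \<odot> col \<beta>"
      by simp_all
  qed
  \<comment> \<open>\<open>bar\<close> preserves the rank of regular elements, as
    \<open>\<kappa> \<odot> b\<close> and \<open>\<tau> \<odot> d\<close> are again isometries; a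
    hatted class through \<open>D\<close> therefore stays inside \<open>D\<close>.\<close>
  have D_if_bar: "\<beta> \<in> D" if \<beta>: "\<beta> \<in> P" and D: "bar \<beta> \<in> id.D" for \<beta>
  proof -
    obtain b d where b: "b \<in> upper (brank \<beta>)" and d: "d \<in> lower (brank \<beta>)"
      and eq: "\<beta> = b \<odot> bstar d"
      by (rule regular_elementE[OF \<beta>])
    have "bar (b \<odot> bstar d) = (\<kappa> \<odot> b) \<odot> bstar (\<tau> \<odot> d)"
      using isom[OF upperD(2)[OF b]] isom[OF lowerD(2)[OF d]] by (simp add: bar_def cat)
    hence "brank (bar \<beta>) = brank \<beta>"
      using id.brank_bprod_bstar[OF upperD(1)[OF b] lowerD(1)[OF d]] eq by simp
    thus ?thesis using D \<beta> by (simp add: D_def id.D_def)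
  qed
  have hat: "hat P bar K `` {\<alpha>} = {\<beta> \<in> P. bar \<beta> \<in> K `` {bar \<alpha>}}" for K
    using \<alpha> by (auto simp: hat_def D_def)
  have "hat P bar (greenR (brauer r r) bprod) `` {\<alpha>}
      = {\<beta> \<in> P. bar \<beta> \<in> id.D \<and> id.row (bar \<beta>) = id.row (bar \<alpha>)}"
    unfolding hat RL id.R_class[OF barD(1)[OF \<alpha>]] by blast
  also have "\<dots> = {\<beta> \<in> D. id.row (bar \<beta>) = id.row (bar \<alpha>)}"
    using D_if_bar barD(1) by (auto simp: D_def)
  also have "\<dots> = {\<beta> \<in> D. \<kappa> \<odot> row \<beta> = \<kappa> \<odot> row \<alpha>}"
    using barD(2) \<alpha> by auto
  finally show "hat P bar (greenR (brauer r r) bprod) `` {\<alpha>} = \<dots>" .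
  have "hat P bar (greenL (brauer r r) bprod) `` {\<alpha>}
      = {\<beta> \<in> P. bar \<beta> \<in> id.D \<and> id.col (bar \<beta>) = id.col (bar \<alpha>)}"
    unfolding hat RL id.L_class[OF barD(1)[OF \<alpha>]] by blast
  also have "\<dots> = {\<beta> \<in> D. id.col (bar \<beta>) = id.col (bar \<alpha>)}"
    using D_if_bar barD(1) by (auto simp: D_def)
  also have "\<dots> = {\<beta> \<in> D. \<tau> \<odot> col \<beta> = \<tau> \<odot> col \<alpha>}"
    using barD(3) \<alpha> by auto
  finally show "hat P bar (greenL (brauer r r) bprod) `` {\<alpha>} = \<dots>" .
  note T = coords_in_T[OF \<alpha>]
  have "is_group_on (greenH (brauer r r) bprod `` {bar \<alpha>}) bprod
      \<longleftrightarrow> is_group_on (greenH (brauer r r) bprod `` {bar \<alpha>}) (sandwich (bid r))"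
    by (rule is_group_on_cong, rule op) (auto simp: greenH_def greenR_def)
  thus "is_group_on (greenH (brauer r r) bprod `` {bar \<alpha>}) bprod
      \<longleftrightarrow> bstar (\<tau> \<odot> col \<alpha>) \<odot> (\<kappa> \<odot> row \<alpha>) \<in> G"
    unfolding H id.H_class_is_group_iff[OF barD(1)[OF \<alpha>]] barD(2,3)[OF \<alpha>] id_TT(3)[OF T(1)]
      id_TT(3)[OF T(2)] .
qed

lemma hat_H_class:
  assumes "\<alpha> \<in> D"
  shows "hat P bar (greenH (brauer r r) bprod) `` {\<alpha>}
      = {\<beta> \<in> D. (\<kappa> \<odot> row \<beta>, \<tau> \<odot> col \<beta>) = (\<kappa> \<odot> row \<alpha>, \<tau> \<odot> col \<alpha>)}"
proof -
  have "hat P bar (greenH (brauer r r) bprod) `` {\<alpha>}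
      = hat P bar (greenR (brauer r r) bprod) `` {\<alpha>} \<inter> hat P bar (greenL (brauer r r) bprod) `` {\<alpha>}"
    unfolding hat_def greenH_def by blast
  thus ?thesis unfolding hat_classes(1,2)[OF assms] by auto
qed

section \<open>Fibres over the representatives and the numbers of classes\<close>

definition row_fibre :: "brauer_partition \<Rightarrow> brauer_partition set" where
  "row_fibre t = {a \<in> rows. \<kappa> \<odot> a = t}"

definition col_fibre :: "brauer_partition \<Rightarrow> brauer_partition set" where
  "col_fibre t = {c \<in> cols. \<tau> \<odot> c = t}"

text \<open>For \<open>t\<close> in \<open>T\<close> every solution of
  \<open>\<kappa> \<odot> z = t\<close> is already a normalised row, so the fibre count for products
  applies unchanged.\<close>

lemma card_row_fibre:
  assumes "t \<in> T"
  shows "card (row_fibre t) * dfact (int r + int q - 1) = dfact (int m + int q - 1)"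
proof -
  have "row_fibre t = {z \<in> brauer m q. \<kappa> \<odot> z = t}"
    using assms by (auto simp: row_fibre_def rows_def)
  thus ?thesis using card_bprod_fibre[OF \<kappa>, of t q] assms T_sub isometriesD(1) by auto
qed

end

context coordinates
begin

lemma dual_row_fibre: "coordinates.row_fibre n \<tau> q T = col_fibre"
  by (rule ext) (simp add: coordinates.row_fibre_def[OF dual_coordinates] col_fibre_def dual_rows)

lemmas card_col_fibre = coordinates.card_row_fibre[OF dual_coordinates, unfolded dual_row_fibre]

text \<open>Positivity of the double factorial excludes an empty fibre; this is what makes
  \<open>\<kappa>\<close> map the rows onto \<open>T\<close>.\<close>

lemma row_fibre_nonempty: "t \<in> T \<Longrightarrow> row_fibre t \<noteq> {}"
  using card_row_fibre[of t] dfact_gt_0[of "int m + int q - 1"] by (metis card.empty mult_zero_left less_irrefl)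

lemma col_fibre_nonempty: "t \<in> T \<Longrightarrow> col_fibre t \<noteq> {}"
  using card_col_fibre[of t] dfact_gt_0[of "int n + int q - 1"] by (metis card.empty mult_zero_left less_irrefl)

lemma finite_row_fibre: "finite (row_fibre t)"
  by (rule finite_subset[OF _ finite_brauer[of m q]]) (auto simp: row_fibre_def rows_def)

lemma finite_col_fibre: "finite (col_fibre t)"
  by (rule finite_subset[OF _ finite_brauer[of n q]]) (auto simp: col_fibre_def cols_def)

text \<open>Every orbit has \<open>fact q\<close> elements because the action is free, which cancels
  the factorial in the number of isometries.\<close>

lemma card_T:
  assumes "q \<le> r" "even (r + q)"
  shows "card T = (r choose q) * dfact (int r - int q - 1)"
proof -
  have "card T * fact q = card (isometries r q)"
    using bij_betw_same_card[OF T_bij] by (simp add: card_cartesian_product card_isometries_square)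
  also have "\<dots> = ((r choose q) * dfact (int r - int q - 1)) * fact q"
    using card_isometries[OF assms] by simp
  finally show ?thesis by simp
qed

lemma D_sub_P: "D \<subseteq> P"
  by (auto simp: D_def)

lemma green_refl:
  "s \<in> B \<Longrightarrow> s \<in> greenR B f `` {s}" "s \<in> B \<Longrightarrow> s \<in> greenL B f `` {s}"
  "s \<in> B \<Longrightarrow> s \<in> greenH B f `` {s}"
  by (auto simp: greenH_def greenR_def greenL_def)

lemma hat_refl:
  assumes "s \<in> P"
  shows "s \<in> hat P bar (greenR (brauer r r) bprod) `` {s}"
    "s \<in> hat P bar (greenL (brauer r r) bprod) `` {s}"
    "s \<in> hat P bar (greenH (brauer r r) bprod) `` {s}"
proof -
  have "bar s \<in> brauer r r" using assms bar_closed by (simp add: regular_elements_def)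
  thus "s \<in> hat P bar (greenR (brauer r r) bprod) `` {s}"
    "s \<in> hat P bar (greenL (brauer r r) bprod) `` {s}"
    "s \<in> hat P bar (greenH (brauer r r) bprod) `` {s}"
    using assms by (auto simp: hat_def greenH_def greenR_def greenL_def)
qed

text \<open>Coarse classes are the level sets of \<open>h\<close> after \<open>f\<close> and fine
  ones those of \<open>f\<close>, so the fine classes in a coarse class correspond to a fibre of
  \<open>h\<close> in the image of \<open>f\<close>.\<close>

lemma card_refined_classes:
  assumes refl: "\<And>s. s \<in> P \<Longrightarrow> s \<in> K' `` {s}" "\<And>s. s \<in> B \<Longrightarrow> s \<in> K `` {s}"
    and K': "\<And>\<alpha>. \<alpha> \<in> D \<Longrightarrow> K' `` {\<alpha>} = {\<beta> \<in> D. h (f \<beta>) = h (f \<alpha>)}"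
    and K: "\<And>\<alpha>. \<alpha> \<in> D \<Longrightarrow> K `` {\<alpha>} = {\<beta> \<in> D. f \<beta> = f \<alpha>}"
  shows "card (classes_in P K' D) = card ((\<lambda>\<alpha>. h (f \<alpha>)) ` D)"
    and "C \<in> classes_in P K' D \<Longrightarrow> \<exists>\<alpha>\<in>D. card (classes_in B K C) = card {z \<in> f ` D. h z = h (f \<alpha>)}"
proof -
  show "card (classes_in P K' D) = card ((\<lambda>\<alpha>. h (f \<alpha>)) ` D)"
    by (rule card_classes_in) (use D_sub_P refl(1) K' in auto)
  assume "C \<in> classes_in P K' D"
  also have "classes_in P K' D = (\<lambda>\<alpha>. K' `` {\<alpha>}) ` D"
    by (rule classes_in_eq) (use D_sub_P refl(1) K' in auto)
  finally obtain \<alpha> where \<alpha>: "\<alpha> \<in> D" "C = {\<beta> \<in> D. h (f \<beta>) = h (f \<alpha>)}" using K' by blast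
  have "card (classes_in B K C) = card (f ` C)"
  proof (rule card_classes_in)
    show "C \<subseteq> B" using \<alpha> D_sub by blast
    show "s \<in> K `` {s}" if "s \<in> B" for s by (rule refl(2)[OF that])
    show "K `` {\<gamma>} = {\<beta> \<in> C. f \<beta> = f \<gamma>}" if "\<gamma> \<in> C" for \<gamma>
      using that K[of \<gamma>] \<alpha> by auto
  qed
  also have "f ` C = {z \<in> f ` D. h z = h (f \<alpha>)}" using \<alpha>(2) by blast
  finally show "\<exists>\<alpha>\<in>D. card (classes_in B K C) = card {z \<in> f ` D. h z = h (f \<alpha>)}"
    using \<alpha>(1) by blast
qed

lemma image_row_col: "(\<lambda>\<alpha>. (row \<alpha>, col \<alpha>)) ` D = rows \<times> cols"
proof (intro equalityI subsetI)
  fix z assume "z \<in> rows \<times> cols"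
  hence "coord (fst z, snd z, bid q) \<in> D" "row (coord (fst z, snd z, bid q)) = fst z"
    "col (coord (fst z, snd z, bid q)) = snd z"
    using coord_coords[of "fst z" "snd z" "bid q"] by auto
  thus "z \<in> (\<lambda>\<alpha>. (row \<alpha>, col \<alpha>)) ` D"
    by (intro image_eqI[where x = "coord (fst z, snd z, bid q)"]) simp_all
qed (use coordsD(1,2) in auto)

lemma image_rows: "(\<lambda>a. \<kappa> \<odot> a) ` rows = T"
  using row_fibre_nonempty by (auto simp: row_fibre_def rows_def)

lemma image_cols: "(\<lambda>c. \<tau> \<odot> c) ` cols = T"
  using col_fibre_nonempty by (auto simp: col_fibre_def cols_def)

lemma image_row: "row ` D = rows"
\<comment> \<open>Projecting \<open>rows \<times> cols\<close> yields all rows only if some column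
  exists; if \<open>T\<close> is empty, there are neither rows nor elements of
  \<open>D\<close>.\<close>
proof (cases "T = {}")
  case True
  hence "rows = {}" unfolding rows_def by blast
  thus ?thesis using coordsD(1) by blast
next
  case False
  hence "cols \<noteq> {}" using image_cols by blast
  thus ?thesis using arg_cong[OF image_row_col, of "image fst"] by (simp add: image_image)
qed

lemma image_col: "col ` D = cols"
proof (cases "T = {}")
  case True
  hence "cols = {}" unfolding cols_def by blast
  thus ?thesis using coordsD(2) by blast
next
  case False
  hence "rows \<noteq> {}" using image_rows by blast
  thus ?thesis using arg_cong[OF image_row_col, of "image snd"] by (simp add: image_image)
qed

lemma card_R:
  "card (classes_in P (hat P bar (greenR (brauer r r) bprod)) D) = card T"
  "C \<in> classes_in P (hat P bar (greenR (brauer r r) bprod)) D \<Longrightarrow>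
    card (classes_in B (greenR B (sandwich \<sigma>)) C) * dfact (int r + int q - 1) = dfact (int m + int q - 1)"
proof -
  let ?K' = "hat P bar (greenR (brauer r r) bprod)" and ?K = "greenR B (sandwich \<sigma>)"
  have counts: "card (classes_in P ?K' D) = card ((\<lambda>\<alpha>. \<kappa> \<odot> row \<alpha>) ` D)"
    "C \<in> classes_in P ?K' D \<Longrightarrow>
      \<exists>\<alpha>\<in>D. card (classes_in B ?K C) = card {z \<in> row ` D. \<kappa> \<odot> z = \<kappa> \<odot> row \<alpha>}" for C
    by (rule card_refined_classes[where f = row and h = "(\<odot>) \<kappa>" and K = ?K and K' = ?K'];
      (erule hat_refl(1) | erule green_refl(1) | erule hat_classes(1) | erule R_class | assumption))+
  show "card (classes_in P (hat P bar (greenR (brauer r r) bprod)) D) = card T"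
  proof -
    have "(\<lambda>\<alpha>. \<kappa> \<odot> row \<alpha>) ` D = (\<lambda>a. \<kappa> \<odot> a) ` row ` D" by (simp only: image_image)
    thus ?thesis unfolding counts(1) image_row image_rows by (rule arg_cong)
  qed
  assume "C \<in> classes_in P (hat P bar (greenR (brauer r r) bprod)) D"
  from counts(2)[OF this] obtain \<alpha> where "\<alpha> \<in> D"
    "card (classes_in B (greenR B (sandwich \<sigma>)) C) = card (row_fibre (\<kappa> \<odot> row \<alpha>))"
    unfolding image_row row_fibre_def by blast
  thus "card (classes_in B (greenR B (sandwich \<sigma>)) C) * dfact (int r + int q - 1)
      = dfact (int m + int q - 1)"
    using card_row_fibre[OF coords_in_T(1)] by simp
qed

lemma card_L:
  "card (classes_in P (hat P bar (greenL (brauer r r) bprod)) D) = card T"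
  "C \<in> classes_in P (hat P bar (greenL (brauer r r) bprod)) D \<Longrightarrow>
    card (classes_in B (greenL B (sandwich \<sigma>)) C) * dfact (int r + int q - 1) = dfact (int n + int q - 1)"
proof -
  let ?K' = "hat P bar (greenL (brauer r r) bprod)" and ?K = "greenL B (sandwich \<sigma>)"
  have counts: "card (classes_in P ?K' D) = card ((\<lambda>\<alpha>. \<tau> \<odot> col \<alpha>) ` D)"
    "C \<in> classes_in P ?K' D \<Longrightarrow>
      \<exists>\<alpha>\<in>D. card (classes_in B ?K C) = card {z \<in> col ` D. \<tau> \<odot> z = \<tau> \<odot> col \<alpha>}" for C
    by (rule card_refined_classes[where f = col and h = "(\<odot>) \<tau>" and K = ?K and K' = ?K'];
      (erule hat_refl(2) | erule green_refl(2) | erule hat_classes(2) | erule L_class | assumption))+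
  show "card (classes_in P (hat P bar (greenL (brauer r r) bprod)) D) = card T"
  proof -
    have "(\<lambda>\<alpha>. \<tau> \<odot> col \<alpha>) ` D = (\<lambda>a. \<tau> \<odot> a) ` col ` D" by (simp only: image_image)
    thus ?thesis unfolding counts(1) image_col image_cols by (rule arg_cong)
  qed
  assume "C \<in> classes_in P (hat P bar (greenL (brauer r r) bprod)) D"
  from counts(2)[OF this] obtain \<alpha> where "\<alpha> \<in> D"
    "card (classes_in B (greenL B (sandwich \<sigma>)) C) = card (col_fibre (\<tau> \<odot> col \<alpha>))"
    unfolding image_col col_fibre_def by blast
  thus "card (classes_in B (greenL B (sandwich \<sigma>)) C) * dfact (int r + int q - 1)
      = dfact (int n + int q - 1)"
    using card_col_fibre[OF coords_in_T(2)] by simp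
qed

lemma card_H:
  "card (classes_in P (hat P bar (greenH (brauer r r) bprod)) D) = (card T)\<^sup>2"
  "C \<in> classes_in P (hat P bar (greenH (brauer r r) bprod)) D \<Longrightarrow>
    card (classes_in B (greenH B (sandwich \<sigma>)) C) * (dfact (int r + int q - 1))\<^sup>2
      = dfact (int m + int q - 1) * dfact (int n + int q - 1)"
proof -
  let ?h = "map_prod (\<lambda>a. \<kappa> \<odot> a) (\<lambda>c. \<tau> \<odot> c)"
  let ?K' = "hat P bar (greenH (brauer r r) bprod)" and ?K = "greenH B (sandwich \<sigma>)"
  have hat: "?K' `` {\<alpha>} = {\<beta> \<in> D. ?h (row \<beta>, col \<beta>) = ?h (row \<alpha>, col \<alpha>)}" if "\<alpha> \<in> D" for \<alpha>
    unfolding map_prod_simp by (rule hat_H_class[OF that])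
  have counts: "card (classes_in P ?K' D) = card ((\<lambda>\<alpha>. ?h (row \<alpha>, col \<alpha>)) ` D)"
    "C \<in> classes_in P ?K' D \<Longrightarrow> \<exists>\<alpha>\<in>D. card (classes_in B ?K C)
      = card {z \<in> (\<lambda>\<alpha>. (row \<alpha>, col \<alpha>)) ` D. ?h z = ?h (row \<alpha>, col \<alpha>)}" for C
    by (rule card_refined_classes[where f = "\<lambda>\<alpha>. (row \<alpha>, col \<alpha>)" and h = ?h and K = ?K and K' = ?K'];
      (erule hat_refl(3) | erule green_refl(3) | erule hat | erule H_class | assumption))+
  have "(\<lambda>\<alpha>. ?h (row \<alpha>, col \<alpha>)) ` D = ?h ` ((\<lambda>\<alpha>. (row \<alpha>, col \<alpha>)) ` D)"
    by (simp only: image_image)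
  also have "\<dots> = T \<times> T" unfolding image_row_col by (simp add: map_prod_surj_on[OF image_rows image_cols])
  finally have "(\<lambda>\<alpha>. ?h (row \<alpha>, col \<alpha>)) ` D = T \<times> T" .
  thus "card (classes_in P (hat P bar (greenH (brauer r r) bprod)) D) = (card T)\<^sup>2"
    unfolding counts(1) by (simp add: card_cartesian_product power2_eq_square)
  assume "C \<in> classes_in P (hat P bar (greenH (brauer r r) bprod)) D"
  from counts(2)[OF this] obtain \<alpha> where \<alpha>: "\<alpha> \<in> D" and card:
    "card (classes_in B (greenH B (sandwich \<sigma>)) C)
      = card {z \<in> rows \<times> cols. ?h z = (\<kappa> \<odot> row \<alpha>, \<tau> \<odot> col \<alpha>)}"
    unfolding image_row_col map_prod_simp by blast
  \<comment> \<open>The two conditions concern separate components, so the fibre is a product of a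
    row fibre and a column fibre; each brings its own denominator.\<close>
  have "{z \<in> rows \<times> cols. ?h z = (\<kappa> \<odot> row \<alpha>, \<tau> \<odot> col \<alpha>)}
      = row_fibre (\<kappa> \<odot> row \<alpha>) \<times> col_fibre (\<tau> \<odot> col \<alpha>)"
    by (auto simp: row_fibre_def col_fibre_def)
  hence "card (classes_in B (greenH B (sandwich \<sigma>)) C) * (dfact (int r + int q - 1))\<^sup>2
      = (card (row_fibre (\<kappa> \<odot> row \<alpha>)) * dfact (int r + int q - 1))
        * (card (col_fibre (\<tau> \<odot> col \<alpha>)) * dfact (int r + int q - 1))"
    unfolding card by (simp only: card_cartesian_product power2_eq_square mult_ac)
  thus "card (classes_in B (greenH B (sandwich \<sigma>)) C) * (dfact (int r + int q - 1))\<^sup>2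
      = dfact (int m + int q - 1) * dfact (int n + int q - 1)"
    by (simp only: card_row_fibre[OF coords_in_T(1)[OF \<alpha>]] card_col_fibre[OF coords_in_T(2)[OF \<alpha>]])
qed

text \<open>On a hatted class the middle factor of a product is the constant \<open>p\<close>, which is
  absorbed into the group coordinate.\<close>

lemma hat_class_rectangular:
  assumes \<alpha>: "\<alpha> \<in> D" and p: "bstar (\<tau> \<odot> col \<alpha>) \<odot> (\<kappa> \<odot> row \<alpha>) \<in> G"
  shows "rectangular_group (card (row_fibre (\<kappa> \<odot> row \<alpha>))) (card (col_fibre (\<tau> \<odot> col \<alpha>)))
    (sym_group q) (hat P bar (greenH (brauer r r) bprod) `` {\<alpha>}) (sandwich \<sigma>)"
proof -
  let ?t = "\<kappa> \<odot> row \<alpha>" and ?s = "\<tau> \<odot> col \<alpha>"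
  let ?p = "bstar ?s \<odot> ?t"
  let ?K = "hat P bar (greenH (brauer r r) bprod) `` {\<alpha>}"
  have K: "\<beta> \<in> ?K \<longleftrightarrow> \<beta> \<in> D \<and> row \<beta> \<in> row_fibre ?t \<and> col \<beta> \<in> col_fibre ?s" for \<beta>
    unfolding hat_H_class[OF \<alpha>] using coordsD[of \<beta>] by (auto simp: row_fibre_def col_fibre_def)
  have fib: "a \<in> rows" "\<kappa> \<odot> a = ?t" if "a \<in> row_fibre ?t" for a
    using that by (auto simp: row_fibre_def)
  have fib': "c \<in> cols" "\<tau> \<odot> c = ?s" if "c \<in> col_fibre ?s" for c
    using that by (auto simp: col_fibre_def)
  have mult: "sandwich \<sigma> x y \<in> ?K \<and> row (sandwich \<sigma> x y) = row x \<and> col (sandwich \<sigma> x y) = col y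
      \<and> grp (sandwich \<sigma> x y) = grp x \<odot> ?p \<odot> grp y" if x: "x \<in> ?K" and y: "y \<in> ?K" for x y
  proof -
    have xD: "x \<in> D" "row x \<in> row_fibre ?t" "col x \<in> col_fibre ?s"
      and yD: "y \<in> D" "row y \<in> row_fibre ?t" "col y \<in> col_fibre ?s"
      using x y unfolding K by auto
    note xc = coordsD[OF xD(1)] and yc = coordsD[OF yD(1)]
    have g: "grp x \<odot> ?p \<odot> grp y \<in> G" by (rule isometries_bprod[OF isometries_bprod[OF xc(3) p] yc(3)])
    have "sandwich \<sigma> x y = coord (row x, col y, grp x \<odot> ?p \<odot> grp y)"
      using coord_mult[OF xc(1-3) yc(1-3)] xc(4) yc(4) fib(2)[OF yD(2)] fib'(2)[OF xD(3)] by simp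
    with coord_coords[OF xc(1) yc(2) g] xD yD show ?thesis unfolding K by simp
  qed
  obtain i where i: "bij_betw i (row_fibre ?t) {0..<card (row_fibre ?t)}"
    using ex_bij_betw_finite_nat[OF finite_row_fibre] by blast
  obtain j where j: "bij_betw j (col_fibre ?s) {0..<card (col_fibre ?s)}"
    using ex_bij_betw_finite_nat[OF finite_col_fibre] by blast
  have shift: "bij_betw (\<lambda>g. g \<odot> ?p) G G"
  proof (rule bij_betw_byWitness[where f' = "\<lambda>g. g \<odot> bstar ?p"])
    have arr: "barr ?p" "bdom ?p = q" "bcod ?p = q" using isom[OF p] by simp_all
    show "\<forall>g\<in>G. g \<odot> ?p \<odot> bstar ?p = g"
      using barr_assoc[of _ ?p "bstar ?p"] unit(1)[OF p] arr isom(1-3)[of _ q q] barr_bstar[of ?p]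
      by (simp add: barr_bid_right)
    show "\<forall>g\<in>G. g \<odot> bstar ?p \<odot> ?p = g"
      using barr_assoc[of _ "bstar ?p" ?p] isom(4)[OF p] arr isom(1-3)[of _ q q] barr_bstar[of ?p]
      by (simp add: barr_bid_right)
    show "(\<lambda>g. g \<odot> ?p) ` G \<subseteq> G" using isometries_bprod[OF _ p] by blast
    show "(\<lambda>g. g \<odot> bstar ?p) ` G \<subseteq> G"
      using isometries_bprod[OF _ isometry_square(2)[OF p]] by blast
  qed
  define \<pi> where "\<pi> g = perm_of q (g \<odot> ?p)" for g
  have \<pi>: "bij_betw \<pi> G (carrier (sym_group q))"
    using bij_betw_trans[OF shift bij_betw_perm_of] by (simp add: \<pi>_def[abs_def] comp_def)
  define \<phi> where "\<phi> x = (i (row x), j (col x), \<pi> (grp x))" for x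
  have "bij_betw (\<lambda>x. (row x, col x, grp x)) ?K (row_fibre ?t \<times> col_fibre ?s \<times> G)"
  proof (rule bij_betw_byWitness[where f' = coord])
    show "\<forall>x\<in>?K. coord (row x, col x, grp x) = x" using coordsD(4) K by blast
    show "\<forall>z\<in>row_fibre ?t \<times> col_fibre ?s \<times> G. (row (coord z), col (coord z), grp (coord z)) = z"
      using coord_coords fib fib' by auto
    show "(\<lambda>x. (row x, col x, grp x)) ` ?K \<subseteq> row_fibre ?t \<times> col_fibre ?s \<times> G"
      by (rule image_subsetI) (use coordsD(3) K in simp)
    show "coord ` (row_fibre ?t \<times> col_fibre ?s \<times> G) \<subseteq> ?K"
    proof (rule image_subsetI)
      fix z assume "z \<in> row_fibre ?t \<times> col_fibre ?s \<times> G"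
      then obtain a c g where "z = (a, c, g)" "a \<in> row_fibre ?t" "c \<in> col_fibre ?s" "g \<in> G" by blast
      thus "coord z \<in> ?K" unfolding K by (simp add: coord_coords fib fib')
    qed
  qed
  from bij_betw_trans[OF this bij_betw_map_prod[OF i bij_betw_map_prod[OF j \<pi>]]]
  have bij: "bij_betw \<phi> ?K ({0..<card (row_fibre ?t)} \<times> {0..<card (col_fibre ?s)} \<times> carrier (sym_group q))"
    by (simp add: comp_def \<phi>_def[abs_def])
  have hom: "\<phi> (sandwich \<sigma> x y) = (i (row x), j (col y), \<pi> (grp x) \<otimes>\<^bsub>sym_group q\<^esub> \<pi> (grp y))"
    if x: "x \<in> ?K" and y: "y \<in> ?K" for x y
  proof -
    have g: "grp x \<in> G" "grp y \<in> G" using x y coordsD(3) unfolding K by auto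
    have "grp x \<odot> ?p \<odot> grp y \<odot> ?p = (grp x \<odot> ?p) \<odot> (grp y \<odot> ?p)"
      using isom[OF g(1)] isom[OF g(2)] isom[OF p] isom[OF isometries_bprod[OF g(1) p]]
      by (intro barr_assoc) simp_all
    thus ?thesis
      using mult[OF x y] perm_of_bprod[OF isometries_bprod[OF g(1) p] isometries_bprod[OF g(2) p]]
      by (simp add: \<phi>_def \<pi>_def)
  qed
  have "?K \<subseteq> B" using D_sub unfolding subset_iff K by blast
  hence "semigroup_on ?K (sandwich \<sigma>)"
    using mult semigroup unfolding semigroup_on_def by blast
  moreover have "\<forall>a\<in>?K. \<forall>b\<in>?K. \<forall>u v g u' v' g'. \<phi> a = (u, v, g) \<longrightarrow> \<phi> b = (u', v', g') \<longrightarrow>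
      \<phi> (sandwich \<sigma> a b) = (u, v', g \<otimes>\<^bsub>sym_group q\<^esub> g')"
    using hom by (simp add: \<phi>_def)
  ultimately show ?thesis
    unfolding rectangular_group_def using bij sym_group_is_group
    by (intro conjI exI[of _ "{0..<card (row_fibre ?t)}"] exI[of _ "{0..<card (col_fibre ?s)}"]
        exI[of _ \<phi>]) simp_all
qed

end

section \<open>Transfer from coordinates to the given sandwich element\<close>

theorem theorem6p17:
  fixes m n r q :: nat
    and \<sigma> :: brauer_partition
    and x y :: "nat \<Rightarrow> nat"
    and B P D :: "brauer_partition set"
    and R L H Rhat Lhat Hhat :: "brauer_partition rel"
    and \<Psi> :: "brauer_partition \<Rightarrow> brauer_partition"
  assumes "m mod 2 = n mod 2"
    and "\<sigma> \<in> brauer n m"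
    and "r = brank \<sigma>"
    and "bij_betw (\<lambda>i. {Up (x i), Lo (y i)}) {1..r} (transversals \<sigma>)"
    and "\<Psi> = psi r x \<sigma>"
    and "B = brauer m n"
    and "P = regular_elements B (sandwich \<sigma>)"
    and "R = greenR B (sandwich \<sigma>)"
    and "L = greenL B (sandwich \<sigma>)"
    and "H = greenH B (sandwich \<sigma>)"
    and "Rhat = hat P \<Psi> (greenR (brauer r r) bprod)"
    and "Lhat = hat P \<Psi> (greenL (brauer r r) bprod)"
    and "Hhat = hat P \<Psi> (greenH (brauer r r) bprod)"
    and "q \<le> r"
    and "q mod 2 = r mod 2"
    and "D = {\<alpha>\<in>P. brank \<alpha> = q}"
  shows "(D \<in> P // greenD B (sandwich \<sigma>)) \<and>
    (card (classes_in P Rhat D) = (r choose q) * dfact (int r - int q - 1) \<and>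
         (\<forall>K\<in>classes_in P Rhat D.
            real (card (classes_in B R K)) =
              real (dfact (int m + int q - 1)) / real (dfact (int r + int q - 1)))) \<and>
    (card (classes_in P Lhat D) = (r choose q) * dfact (int r - int q - 1) \<and>
         (\<forall>K\<in>classes_in P Lhat D.
            real (card (classes_in B L K)) =
              real (dfact (int n + int q - 1)) / real (dfact (int r + int q - 1)))) \<and>
    (card (classes_in P Hhat D) = (r choose q)\<^sup>2 * (dfact (int r - int q - 1))\<^sup>2 \<and>
         (\<forall>K\<in>classes_in P Hhat D.
            real (card (classes_in B H K)) =
              real (dfact (int m + int q - 1) * dfact (int n + int q - 1)) /
              real ((dfact (int r + int q - 1))\<^sup>2))) \<and>
    (\<forall>C\<in>classes_in B H D.
           card C = fact q \<and>
           (is_group_on C (sandwich \<sigma>) \<longrightarrow> group_on_iso C (sandwich \<sigma>) (sym_group q))) \<and>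
    (\<forall>\<alpha>\<in>D.
           (is_group_on (H `` {\<alpha>}) (sandwich \<sigma>) \<longleftrightarrow>
            is_group_on (greenH (brauer r r) bprod `` {\<Psi> \<alpha>}) bprod) \<and>
           (is_group_on (H `` {\<alpha>}) (sandwich \<sigma>) \<longrightarrow>
            (\<exists>k l.
               real k = real (dfact (int m + int q - 1)) / real (dfact (int r + int q - 1)) \<and>
               real l = real (dfact (int n + int q - 1)) / real (dfact (int r + int q - 1)) \<and>
               rectangular_group k l (sym_group q) (Hhat `` {\<alpha>}) (sandwich \<sigma>))))"
proof -
  note B = assms(6) and P = assms(7)[unfolded assms(6)]
  \<comment> \<open>The second factor of \<open>\<sigma>\<close> is \<open>tau\<close> of the
    reflection, whose transversals have the upper points \<open>y i\<close>.\<close>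
  define \<kappa> where "\<kappa> = tau r y (bstar \<sigma>)"
  define \<tau> where "\<tau> = tau r x \<sigma>"
  interpret e: transversal_enum n m r \<sigma> x y
    using assms(2,4) by (simp add: transversal_enum_def)
  interpret e': transversal_enum m n r "bstar \<sigma>" y x by (rule e.transversal_enum_bstar)
  have "sandwich_pair m n r \<kappa> \<tau> \<sigma>"
    by unfold_locales
      (use e.tau_isometry e'.tau_isometry e.tau_factor in \<open>simp_all add: \<kappa>_def \<tau>_def\<close>)
  moreover obtain T where "T \<subseteq> isometries r q"
    "bij_betw (\<lambda>(t, g). t \<odot> g) (T \<times> isometries q q) (isometries r q)"
    by (rule orbit_representatives)
  ultimately interpret c: coordinates m n r \<kappa> \<tau> \<sigma> q T
    by (simp add: coordinates_def coordinates_axioms_def)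
  \<comment> \<open>On \<open>P\<close> the domains fit, and \<open>\<tau> \<odot> \<sigma>\<close>
    reduces to \<open>\<kappa>\<close>; agreement there suffices because hatted relations are
    confined to \<open>P\<close>.\<close>
  have hat_eq: "hat P \<Psi> K = hat P c.bar K" for K
  proof -
    have "\<Psi> \<alpha> = c.bar \<alpha>" if "\<alpha> \<in> P" for \<alpha>
    proof -
      have "barr \<alpha>" "bdom \<alpha> = m" "bcod \<alpha> = n"
        using that by (auto simp: P regular_elements_def brauer_iff_barr)
      thus ?thesis
        unfolding assms(5) psi_def c.bar_def \<tau>_def[symmetric] by (simp add: c.cat)
    qed
    thus ?thesis by (auto simp: hat_def)
  qed
  have D: "D = c.D" by (simp add: assms(16) c.D_def P)
  have \<Psi>: "\<Psi> \<alpha> = c.bar \<alpha>" if "\<alpha> \<in> D" for \<alpha>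
  proof -
    have "barr \<alpha>" "bdom \<alpha> = m" "bcod \<alpha> = n"
      using that c.D_sub by (auto simp: D brauer_iff_barr)
    thus ?thesis
      unfolding assms(5) psi_def c.bar_def \<tau>_def[symmetric] by (simp add: c.cat)
  qed
  note eqs = assms(8-13)[unfolded B P hat_eq[unfolded P]]
  have parity: "even (r + q)" using assms(15) by presburger
  have real_eq: "real a = real b / real d" if "a * d = b" "d > 0" for a b d
    using that by (auto simp: field_simps simp flip: of_nat_mult)
  have T_card: "card T = (r choose q) * dfact (int r - int q - 1)"
    by (rule c.card_T[OF assms(14) parity])
  \<comment> \<open>To be a class, \<open>D\<close> must be inhabited: \<open>q \<le> r\<close>
    makes the binomial positive, so \<open>T\<close> has an element, and a row over it is the row of
    some element of \<open>D\<close>.\<close>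
  hence "card T > 0" using assms(14) dfact_gt_0 by simp
  then obtain t where "t \<in> T" by (metis card.empty equals0I less_irrefl)
  hence "(\<lambda>a. \<kappa> \<odot> a) ` c.row ` c.D \<noteq> {}" unfolding c.image_row c.image_rows by blast
  then obtain \<alpha>\<^sub>0 where \<alpha>\<^sub>0: "\<alpha>\<^sub>0 \<in> c.D" by blast
  have 0: "D \<in> P // greenD B (sandwich \<sigma>)"
    using c.D_class[OF \<alpha>\<^sub>0] c.D_sub_P \<alpha>\<^sub>0 unfolding quotient_def D P B by blast
  have 1: "card (classes_in P Rhat D) = (r choose q) * dfact (int r - int q - 1)"
    unfolding eqs D P B c.card_R(1) T_card ..
  have R_count: "\<forall>K\<in>classes_in P Rhat D. real (card (classes_in B R K)) =
      real (dfact (int m + int q - 1)) / real (dfact (int r + int q - 1))"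
    unfolding eqs D P B by (intro ballI real_eq c.card_R(2) dfact_gt_0)
  have 2: "card (classes_in P Lhat D) = (r choose q) * dfact (int r - int q - 1)"
    unfolding eqs D P B c.card_L(1) T_card ..
  have L_count: "\<forall>K\<in>classes_in P Lhat D. real (card (classes_in B L K)) =
      real (dfact (int n + int q - 1)) / real (dfact (int r + int q - 1))"
    unfolding eqs D P B by (intro ballI real_eq c.card_L(2) dfact_gt_0)
  have 3: "card (classes_in P Hhat D) = (r choose q)\<^sup>2 * (dfact (int r - int q - 1))\<^sup>2"
    unfolding eqs D P B c.card_H(1) T_card by (simp add: power_mult_distrib)
  have 4: "\<forall>K\<in>classes_in P Hhat D. real (card (classes_in B H K)) =
      real (dfact (int m + int q - 1) * dfact (int n + int q - 1)) /
      real ((dfact (int r + int q - 1))\<^sup>2)"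
    unfolding eqs D P B by (intro ballI real_eq c.card_H(2) zero_less_power dfact_gt_0)
  have 5: "\<forall>C\<in>classes_in B H D. card C = fact q \<and>
      (is_group_on C (sandwich \<sigma>) \<longrightarrow> group_on_iso C (sandwich \<sigma>) (sym_group q))"
  proof
    fix C assume "C \<in> classes_in B H D"
    also have "classes_in B H D = (\<lambda>\<alpha>. H `` {\<alpha>}) ` D"
      unfolding eqs D B by (rule classes_in_eq[OF c.D_sub c.green_refl(3)]) (auto simp: c.H_class)
    finally obtain \<alpha> where \<alpha>: "\<alpha> \<in> c.D" "C = greenH (brauer m n) (sandwich \<sigma>) `` {\<alpha>}"
      unfolding eqs D by blast
    show "card C = fact q \<and>
      (is_group_on C (sandwich \<sigma>) \<longrightarrow> group_on_iso C (sandwich \<sigma>) (sym_group q))"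
      using c.card_H_class[OF \<alpha>(1)] c.H_class_is_group_iff[OF \<alpha>(1)] c.H_class_group[OF \<alpha>(1)]
      unfolding \<alpha>(2) by blast
  qed
  have 6: "(is_group_on (H `` {\<alpha>}) (sandwich \<sigma>) \<longleftrightarrow>
            is_group_on (greenH (brauer r r) bprod `` {\<Psi> \<alpha>}) bprod) \<and>
           (is_group_on (H `` {\<alpha>}) (sandwich \<sigma>) \<longrightarrow>
            (\<exists>k l.
               real k = real (dfact (int m + int q - 1)) / real (dfact (int r + int q - 1)) \<and>
               real l = real (dfact (int n + int q - 1)) / real (dfact (int r + int q - 1)) \<and>
               rectangular_group k l (sym_group q) (Hhat `` {\<alpha>}) (sandwich \<sigma>)))"
    if \<alpha>D: "\<alpha> \<in> D" for \<alpha>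
  proof -
    have \<alpha>: "\<alpha> \<in> c.D" using \<alpha>D D by simp
    have "real (card (c.row_fibre (\<kappa> \<odot> c.row \<alpha>)))
        = real (dfact (int m + int q - 1)) / real (dfact (int r + int q - 1))"
      "real (card (c.col_fibre (\<tau> \<odot> c.col \<alpha>)))
        = real (dfact (int n + int q - 1)) / real (dfact (int r + int q - 1))"
      using c.card_row_fibre c.card_col_fibre c.coords_in_T[OF \<alpha>] by (intro real_eq dfact_gt_0; blast)+
    thus ?thesis
      using c.hat_class_rectangular[OF \<alpha>]
      unfolding \<Psi>[OF \<alpha>D] eqs c.hat_classes(3)[OF \<alpha>] c.H_class_is_group_iff[OF \<alpha>] by blast
  qed
  show ?thesis using 0 1 R_count 2 L_count 3 4 5 6 by blast
qed

end
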